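(* Let $\Gamma=\operatorname{PGL}(3,\mathbb{F}_q[t])$, a discrete subgroup of $\operatorname{PGL}(3,\mathbb{F}_q(\!(t^{-1})\!))$ acting on its Bruhat–Tits building $\mathcal{B}$. For each positive integer $m$, let $$N_m(\Gamma\backslash\mathcal{B})=\sum_{c:\ \ell(c)=m}w(c)\,\ell(c_0),$$ where $c$ runs over the cycles of type 1 of length $m$ in $\Gamma\backslash\mathcal{B}$ and $c_0$ is the prime cycle underlying $c$. Then $$N_{m}(\Gamma\backslash\mathcal{B})=\begin{cases}3q^{6r}-6q^{4r}+3q^{3r} & \text{if } m=3r \text{ for some integer } r\ge 1,\\ 0 & \text{otherwise.}\end{cases}$$
   Context: Let $\mathbb{F}_q$ be the finite field with $q$ elements, $F=\mathbb{F}_q(\!(t^{-1})\!)$, $\mathcal{O}=\mathbb{F}_q[\![t^{-1}]\!]$, $\pi=t^{-1}$. Building: the vertices of $\mathcal{B}$ are the homothety classes $[L]$ of rank-3 $\mathcal{O}$-lattices $L\subset F^3$; three vertices form a 2-simplex (chamber) if they have representatives with $\pi L_1\subsetneq L_3\subsetneq L_2\subsetneq L_1$; edges are the pairs of distinct vertices contained in a common chamber. A directed edge $\tilde e$ has source $s(\tilde e)$ and target $t(\tilde e)$. The directed edge $x\to y$ has type 1 if there are representatives $L\in x$, $L'\in y$ with $\pi L'\subset L\subset L'$ and $[L':L]=q$. The group $\operatorname{PGL}(3,F)$ acts on $\mathcal{B}$ by left translation, preserving types. A pair $(\tilde e,\tilde e')$ of type 1 directed edges with $t(\tilde e)=s(\tilde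 e')$ is a geodesic path if the vertices $s(\tilde e),\,t(\tilde e)=s(\tilde e'),\,t(\tilde e')$ do not form a chamber. Quotient and weights: let $X=\Gamma\backslash\mathcal{B}$ and let $\operatorname{E}_1(X)$ be the set of $\Gamma$-orbits of type 1 directed edges of $\mathcal{B}$; let $p$ denote the projection. For $e,e'\in \operatorname{E}_1(X)$ let $$w(e,e')=\#\{\tilde e'\text{ of type }1\text{ in }\mathcal{B}: p(\tilde e')=e',\ (\tilde e,\tilde e')\text{ is a geodesic path}\},$$ where $\tilde e$ is any lift of $e$ (independent of the choice). Cycles: a closed path of type 1 and length $n$ is a sequence $(e_1,\dots,e_n)$ in $\operatorname{E}_1(X)$ with $w(e_j,e_{j+1})\neq 0$ for all $j$ modulo $n$ (including the pair $(e_n,e_1)$). A cycle $c$ is an equivalence class of such closed paths under cyclic shift; $\ell(c)=n$ is its length and $w(c)=\prod_{j \bmod n}w(e_j,e_{j+1})$ its weight. A cycle is prime if it is not an $m$-fold repetition ($m\ge2$) of a shorter cycle; every cycle $c$ is a power of a unique prime cycle $c_0$. *)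

theory Defs
  imports
    "HOL-Analysis.Cartesian_Space"
    "HOL-Computational_Algebra.Formal_Laurent_Series"
    "HOL-Algebra.Group_Action"
begin

unbundle no Formal_Power_Series.fps_syntax

text \<open>
  The finite field with \<open>q\<close> elements is an arbitrary type \<open>'k :: {field, finite}\<close> with
  \<open>q = CARD('k)\<close>. The field \<open>F\<close> of Laurent series in the inverse of \<open>t\<close> is \<open>'k fls\<close>, whose
  variable \<open>fls_X\<close> is the uniformizer, so that \<open>t\<close> itself is \<open>fls_X_inv\<close>.
\<close>

definition int_ring :: "'k::field fls set" where
  "int_ring = range fps_to_fls"

definition poly_ring :: "'k::field fls set" where
  "poly_ring = range (\<lambda>p :: 'k poly. poly (map_poly fls_const p) fls_X_inv)"

type_synonym 'k vec3 = "'k fls ^ 3"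
type_synonym 'k mat3 = "'k fls ^ 3 ^ 3"

definition lattice :: "'k::field vec3 set \<Rightarrow> bool" where
  "lattice L \<longleftrightarrow> (\<exists>B. vec.independent B \<and> card B = 3 \<and>
     L = {(\<Sum>b\<in>B. c b *s b) | c. \<forall>b\<in>B. c b \<in> int_ring})"

definition scale :: "'k::field fls \<Rightarrow> 'k vec3 set \<Rightarrow> 'k vec3 set" where
  "scale a L = (\<lambda>v. a *s v) ` L"

type_synonym 'k vertex = "'k vec3 set set"

definition hclass :: "'k::field vec3 set \<Rightarrow> 'k vertex" where
  "hclass L = {scale a L | a. a \<noteq> 0}"

definition vertices :: "'k::field vertex set" where
  "vertices = hclass ` {L. lattice L}"

definition chamber :: "'k::field vertex set \<Rightarrow> bool" where
  "chamber S \<longleftrightarrow> (\<exists>x\<in>vertices. \<exists>y\<in>vertices. \<exists>z\<in>vertices. S = {x, y, z} \<and>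
     (\<exists>L1\<in>x. \<exists>L2\<in>y. \<exists>L3\<in>z. scale fls_X L1 \<subset> L3 \<and> L3 \<subset> L2 \<and> L2 \<subset> L1))"

text \<open>A directed edge is the pair of its source and its target.\<close>

type_synonym 'k edge = "'k vertex \<times> 'k vertex"

definition directed_edges :: "'k::field edge set" where
  "directed_edges = {(x, y). x \<noteq> y \<and> (\<exists>S. chamber S \<and> x \<in> S \<and> y \<in> S)}"

definition lattice_index :: "'k::field vec3 set \<Rightarrow> 'k vec3 set \<Rightarrow> nat" where
  "lattice_index L' L = card ((\<lambda>v. (+) v ` L) ` L')"

definition type1_edges :: "'k::{field,finite} edge set" where
  "type1_edges = {(x, y) \<in> directed_edges. \<exists>L\<in>x. \<exists>L'\<in>y.
     scale fls_X L' \<subseteq> L \<and> L \<subseteq> L' \<and> lattice_index L' L = CARD('k)}"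

definition geodesic :: "'k::{field,finite} edge \<Rightarrow> 'k edge \<Rightarrow> bool" where
  "geodesic e e' \<longleftrightarrow> e \<in> type1_edges \<and> e' \<in> type1_edges \<and> snd e = fst e' \<and>
     \<not> chamber {fst e, snd e, snd e'}"

definition GL3 :: "'k::field fls set \<Rightarrow> 'k mat3 monoid" where
  "GL3 R = \<lparr>carrier = {g. (\<forall>i j. g $ i $ j \<in> R) \<and>
       (\<exists>h. (\<forall>i j. h $ i $ j \<in> R) \<and> g ** h = mat 1 \<and> h ** g = mat 1)},
     mult = (**), one = mat 1\<rparr>"

definition scalar_mats :: "'k::field mat3 set" where
  "scalar_mats = {mat a | a. a \<noteq> 0}"

definition PGL3 :: "'k::field mat3 set monoid" where
  "PGL3 = GL3 UNIV Mod scalar_mats"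

text \<open>
  The group \<open>PGL(3, F\<^sub>q[t])\<close> as a subgroup of \<open>PGL(3, F)\<close>: the image of \<open>GL(3, F\<^sub>q[t])\<close>.
\<close>

definition PGL3_poly :: "'k::field mat3 set monoid" where
  "PGL3_poly = PGL3\<lparr>carrier :=
     (\<lambda>g. scalar_mats #>\<^bsub>GL3 UNIV\<^esub> g) ` carrier (GL3 poly_ring)\<rparr>"

text \<open>
  An element of \<open>PGL(3, F)\<close> is a set of proportional matrices and a vertex is a set of
  homothetic lattices; left translation multiplies all representatives.
\<close>

definition act_vertex :: "'k::field mat3 set \<Rightarrow> 'k vertex \<Rightarrow> 'k vertex" where
  "act_vertex \<gamma> x = {(\<lambda>v. g *v v) ` L | g L. g \<in> \<gamma> \<and> L \<in> x}"

definition act_edge :: "'k::field mat3 set \<Rightarrow> 'k edge \<Rightarrow> 'k edge" where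
  "act_edge \<gamma> = map_prod (act_vertex \<gamma>) (act_vertex \<gamma>)"

lemma mat_mult_left: "mat a ** (A :: 'a::comm_ring_1^'n^'n) = (\<chi> i j. a * A $ i $ j)"
  by (simp add: matrix_matrix_mult_def mat_def vec_eq_iff if_distrib[of "\<lambda>x. x * _"] cong: if_cong)

lemma mat_mult_right: "(A :: 'a::comm_ring_1^'n^'n) ** mat a = (\<chi> i j. a * A $ i $ j)"
  by (simp add: matrix_matrix_mult_def mat_def vec_eq_iff if_distrib[of "\<lambda>x. _ * x"] mult.commute cong: if_cong)

lemma group_GL3:
  assumes "0 \<in> R" "1 \<in> R" "\<And>a b. a \<in> R \<Longrightarrow> b \<in> R \<Longrightarrow> a + b \<in> R"
    "\<And>a b. a \<in> R \<Longrightarrow> b \<in> R \<Longrightarrow> a * b \<in> R"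
  shows "group (GL3 R)"
proof -
  have sm: "(g ** h) $ i $ j \<in> R" if "\<forall>i j. g $ i $ j \<in> R" "\<forall>i j. h $ i $ j \<in> R"
    for g h :: "'a mat3" and i j
    using that assms by (simp add: matrix_matrix_mult_def sum_3)
  show ?thesis
  proof (rule groupI)
    fix x y assume "x \<in> carrier (GL3 R)" "y \<in> carrier (GL3 R)"
    then obtain x' y' where *: "\<forall>i j. x $ i $ j \<in> R" "\<forall>i j. y $ i $ j \<in> R"
      "\<forall>i j. x' $ i $ j \<in> R" "\<forall>i j. y' $ i $ j \<in> R"
      "x ** x' = mat 1" "x' ** x = mat 1" "y ** y' = mat 1" "y' ** y = mat 1"
      unfolding GL3_def by simp metis
    have "(x ** y) ** (y' ** x') = mat 1" "(y' ** x') ** (x ** y) = mat 1"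
      using * by (metis matrix_mul_assoc matrix_mul_lid)+
    then show "x \<otimes>\<^bsub>GL3 R\<^esub> y \<in> carrier (GL3 R)"
      using * sm by (auto simp: GL3_def intro!: exI[of _ "y' ** x'"])
  next
    show "\<one>\<^bsub>GL3 R\<^esub> \<in> carrier (GL3 R)"
      using assms by (auto simp: GL3_def mat_def intro!: exI[of _ "mat 1"])
        (auto simp: mat_def matrix_mul_lid[unfolded mat_def])
  next
    fix x assume "x \<in> carrier (GL3 R)"
    then show "\<exists>y\<in>carrier (GL3 R). y \<otimes>\<^bsub>GL3 R\<^esub> x = \<one>\<^bsub>GL3 R\<^esub>"
      by (auto simp: GL3_def)
  qed (auto simp: GL3_def matrix_mul_assoc)
qed

lemma group_GL3_field: "group (GL3 (UNIV :: 'k::field fls set))"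
  by (rule group_GL3) auto

lemma mat_mult_mat: "mat a ** mat b = (mat (a * b) :: 'a::comm_ring_1^'n^'n)"
  by (simp add: mat_mult_left) (simp add: mat_def vec_eq_iff)

lemma scalar_mats_subgroup: "subgroup scalar_mats (GL3 (UNIV :: 'k::field fls set))"
proof (rule group.subgroupI[OF group_GL3_field])
  have inv: "mat a ** mat (inverse a) = (mat 1 :: 'k mat3)"
       "mat (inverse a) ** mat a = (mat 1 :: 'k mat3)" if "a \<noteq> 0" for a :: "'k fls"
    using that by (simp_all add: mat_mult_mat)
  then show sub: "scalar_mats \<subseteq> carrier (GL3 (UNIV :: 'k fls set))"
    unfolding scalar_mats_def GL3_def by auto
  show "scalar_mats \<noteq> ({} :: 'k mat3 set)"
    by (auto simp: scalar_mats_def intro: exI[of _ 1])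
  show "x \<otimes>\<^bsub>GL3 UNIV\<^esub> y \<in> scalar_mats" if "x \<in> scalar_mats" "y \<in> scalar_mats" for x y :: "'k mat3"
    using that by (auto simp: scalar_mats_def GL3_def mat_mult_mat)
  fix x :: "'k mat3" assume "x \<in> scalar_mats"
  then obtain a where a: "x = mat a" "a \<noteq> 0" by (auto simp: scalar_mats_def)
  have m: "mat (inverse a) \<in> scalar_mats" using a by (auto simp: scalar_mats_def)
  have "inv\<^bsub>GL3 UNIV\<^esub> x = mat (inverse a)"
    by (rule group.inv_equality[OF group_GL3_field])
      (use a m sub \<open>x \<in> scalar_mats\<close> in \<open>auto simp: GL3_def inv mat_mult_mat\<close>)
  then show "inv\<^bsub>GL3 UNIV\<^esub> x \<in> scalar_mats" using m by simp
qed

lemma scalar_mats_normal: "scalar_mats \<lhd> GL3 (UNIV :: 'k::field fls set)"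
proof (rule group.normalI[OF group_GL3_field scalar_mats_subgroup])
  show "\<forall>x\<in>carrier (GL3 (UNIV :: 'k fls set)).
      scalar_mats #>\<^bsub>GL3 UNIV\<^esub> x = x <#\<^bsub>GL3 UNIV\<^esub> scalar_mats"
    by (auto simp: r_coset_def l_coset_def GL3_def scalar_mats_def mat_mult_left mat_mult_right)
qed

lemma group_PGL3: "group (PGL3 :: 'k::field mat3 set monoid)"
  unfolding PGL3_def by (rule normal.factorgroup_is_group[OF scalar_mats_normal])

lemma group_GL3_poly: "group (GL3 (poly_ring :: 'k::field fls set))"
proof (rule group_GL3)
  let ?e = "\<lambda>p :: 'k poly. poly (map_poly fls_const p) fls_X_inv"
  have add: "map_poly fls_const (p + r) = map_poly fls_const p + map_poly fls_const r"
    for p r :: "'k poly"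
    by (rule poly_eqI) (simp add: coeff_map_poly fls_plus_const)
  have e0: "?e 0 = 0" by simp
  have e1: "?e 1 = 1" by (simp add: map_poly_1)
  have eadd: "?e (p + r) = ?e p + ?e r" for p r by (simp add: add)
  have esm: "?e (smult c r) = fls_const c * ?e r" for c r
  proof -
    have "map_poly fls_const (smult c r) = smult (fls_const c) (map_poly fls_const r)"
      by (rule poly_eqI) (simp add: coeff_map_poly)
    then show ?thesis by simp
  qed
  have emul: "?e (p * r) = ?e p * ?e r" for p r
    by (induction p) (simp_all add: map_poly_pCons eadd esm algebra_simps)
  show "0 \<in> (poly_ring :: 'k fls set)" unfolding poly_ring_def by (metis e0 rangeI)
  show "1 \<in> (poly_ring :: 'k fls set)" unfolding poly_ring_def by (metis e1 rangeI)
  show "a + b \<in> poly_ring" if "a \<in> poly_ring" "b \<in> poly_ring" for a b :: "'k fls"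
    using that unfolding poly_ring_def by (auto simp: eadd[symmetric])
  show "a * b \<in> poly_ring" if "a \<in> poly_ring" "b \<in> poly_ring" for a b :: "'k fls"
    using that unfolding poly_ring_def by (auto simp: emul[symmetric])
qed

lemma PGL3_poly_subgroup: "subgroup (carrier PGL3_poly) (PGL3 :: 'k::field mat3 set monoid)"
proof -
  have h: "(\<lambda>g. scalar_mats #>\<^bsub>GL3 UNIV\<^esub> g) \<in> hom (GL3 UNIV) (PGL3 :: 'k mat3 set monoid)"
    unfolding PGL3_def by (rule normal.r_coset_hom_Mod[OF scalar_mats_normal])
  have sub: "carrier (GL3 poly_ring) \<subseteq> carrier (GL3 (UNIV :: 'k fls set))"
    by (auto simp: GL3_def)
  have "(\<lambda>g. scalar_mats #>\<^bsub>GL3 UNIV\<^esub> g) \<in> hom (GL3 poly_ring) (PGL3 :: 'k mat3 set monoid)"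
    using h sub unfolding hom_def by (simp add: Pi_iff subset_iff) (simp add: GL3_def)
  then interpret group_hom "GL3 poly_ring" "PGL3 :: 'k mat3 set monoid"
      "\<lambda>g. scalar_mats #>\<^bsub>GL3 UNIV\<^esub> g"
    by (simp add: group_hom_def group_hom_axioms_def group_GL3_poly group_PGL3)
  show ?thesis using img_is_subgroup by (simp add: PGL3_poly_def)
qed

text \<open>
  In what follows \<open>G\<close> is a subgroup of \<open>PGL(3, F)\<close>. An element of the quotient of the set of type 1 edges by \<open>G\<close> is an orbit, that
  is, a set of edges of the building; so its lifts are its elements, and an edge projects to \<open>e'\<close> iff
  it belongs to \<open>e'\<close>.
\<close>

definition quot_edges :: "'k::{field,finite} mat3 set monoid \<Rightarrow> 'k edge set set" where
  "quot_edges G = orbits G type1_edges act_edge"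

definition edge_weight :: "'k::{field,finite} edge set \<Rightarrow> 'k edge set \<Rightarrow> nat" where
  "edge_weight e e' = card {d' \<in> type1_edges. d' \<in> e' \<and> geodesic (SOME d. d \<in> e) d'}"

definition closed_path :: "'k::{field,finite} mat3 set monoid \<Rightarrow> 'k edge set list \<Rightarrow> bool" where
  "closed_path G es \<longleftrightarrow> es \<noteq> [] \<and> set es \<subseteq> quot_edges G \<and>
     (\<forall>j<length es. edge_weight (es ! j) (es ! (Suc j mod length es)) \<noteq> 0)"

definition shift_class :: "'a list \<Rightarrow> 'a list set" where
  "shift_class es = {rotate k es | k. True}"

definition cycles :: "'k::{field,finite} mat3 set monoid \<Rightarrow> 'k edge set list set set" where
  "cycles G = shift_class ` {es. closed_path G es}"

definition cycle_length :: "'a list set \<Rightarrow> nat" where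
  "cycle_length c = length (SOME es. es \<in> c)"

definition cycle_weight :: "'k::{field,finite} edge set list set \<Rightarrow> nat" where
  "cycle_weight c = (let es = (SOME es. es \<in> c) in
     \<Prod>j<length es. edge_weight (es ! j) (es ! (Suc j mod length es)))"

definition cycle_power :: "nat \<Rightarrow> 'a list set \<Rightarrow> 'a list set" where
  "cycle_power m c = shift_class (concat (replicate m (SOME es. es \<in> c)))"

definition prime_cycle ::
    "'k::{field,finite} mat3 set monoid \<Rightarrow> 'k edge set list set \<Rightarrow> bool" where
  "prime_cycle G c \<longleftrightarrow> c \<in> cycles G \<and> \<not> (\<exists>m\<ge>2. \<exists>d\<in>cycles G. c = cycle_power m d)"

definition underlying_prime ::
    "'k::{field,finite} mat3 set monoid \<Rightarrow> 'k edge set list set \<Rightarrow> 'k edge set list set" where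
  "underlying_prime G c = (THE d. prime_cycle G d \<and> (\<exists>m\<ge>1. c = cycle_power m d))"

definition cycle_count :: "'k::{field,finite} mat3 set monoid \<Rightarrow> nat \<Rightarrow> nat" where
  "cycle_count G m = (\<Sum>c | c \<in> cycles G \<and> cycle_length c = m.
     cycle_weight c * cycle_length (underlying_prime G c))"

end

theory Submission
  imports Defs "HOL-Analysis.Determinants"
begin

text \<open>
  A lattice is \<open>g\<close> times a diagonal lattice with exponents \<open>n\<close>, for some \<open>g\<close> in \<open>GL(3, F\<^sub>q[t])\<close>
  (Birkhoff-Grothendieck), so the orbits of type 1 edges are the triples \<open>(x, y, v)\<close>, \<open>x \<le> y\<close>, of
  exponents of the target, \<open>v\<close> being the one that was just raised, up to a common shift. The
  geodesic successors of such an edge are parametrised by the \<open>q\<^sup>2\<close> lines through a vector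
  \<open>(a, b, 1)\<close>, and each raises the smallest exponent in the support of that vector. So
  \<open>N\<^sub>m\<close> counts closed walks of an explicit weighted graph.

  In every closed walk the maximum of the exponents grows at exactly one third of the steps, so it
  suffices to count walks that start at a state \<open>(a, c) = (y - x, v - y)\<close> with \<open>c \<ge> 1\<close>. Between two
  growths of the maximum the smallest exponent may be reset, and a reset costs
  \<open>q\<^sup>2\<close> for each unit of the gap \<open>a\<close>. Charging this cost when the gap grows makes the weights
  independent of \<open>a\<close>; walks without a reset never return to their \<open>a\<close>, while every other walk
  determines \<open>a\<close>. Hence the trace is the difference of the traces of two one-parameter chains,
  \<open>(q\<^sup>6\<^sup>r - q\<^sup>4\<^sup>r) - (q\<^sup>4\<^sup>r - q\<^sup>3\<^sup>r)\<close>.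
\<close>

text \<open>The quotient graph is infinite, so the finiteness of the set of closed paths of a given
  length has to be proved, and a trace over all gaps \<open>a\<close> has to be shown to be a finite
  sum; a support bound for closed walks gives both. The exchange behind the trace: fix
  \<open>c\<close>, \<open>c'\<close> and the number of growths of the maximum. The walks with a
  reset from gap \<open>a\<close> to gap \<open>a'\<close> number \<open>q ^ (2 * a)\<close> times a
  quantity p(a') that depends on the target only. The diagonal value \<open>q ^ (2 * a)\<close> p(a)
  is therefore also the term of \<open>a' = a\<close> in the sum over \<open>a'\<close> of
  \<open>q ^ (2 * a')\<close> p(a'), which concerns walks from the single gap 0. That weighted sum
  can be computed because the profile \<open>q ^ (2 * a)\<close> is reproduced by the recursion from
  one growth of the maximum to the next. Counting is done with functions that satisfy
  \<open>h = transfer q h\<close> at every state where the last exponent is not the maximum. All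
  targets are states where it is, so the exceptional term of the target never enters the analysis
  between two growths.\<close>

notation fls_nth (infixl "$$" 75)

section \<open>Cycles and closed paths\<close>

lemma rotate1_concat_replicate:
  "rotate1 (concat (replicate k v)) = concat (replicate k (rotate1 v))"
proof (cases v)
  case (Cons x w)
  have "concat (replicate k (x # w)) @ [x] = x # concat (replicate k (w @ [x]))" for k
    by (induction k) auto
  then show ?thesis using Cons by (cases k) auto
qed (induction k, auto)

lemma rotate_concat_replicate:
  "rotate i (concat (replicate k v)) = concat (replicate k (rotate i v))"
  by (induction i) (simp_all add: rotate1_concat_replicate)

lemma length_concat_replicate: "length (concat (replicate k v)) = k * length v"
  by (induction k) auto

lemma concat_replicate_append_commute:
  "concat (replicate k v) @ v = v @ concat (replicate k v)"
  by (induction k) auto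

lemma concat_replicate_replicate:
  "concat (replicate k (concat (replicate j v))) = concat (replicate (k * j) v)"
  by (induction k) (auto simp: replicate_add)

lemma rotate_length_concat_replicate:
  "rotate (length v) (concat (replicate k v)) = concat (replicate k v)"
proof (cases k)
  case (Suc j)
  show ?thesis unfolding Suc
    by (simp add: rotate_append concat_replicate_append_commute)
qed simp

lemma take_concat_replicate:
  "j \<le> k \<Longrightarrow> take (j * length v) (concat (replicate k v)) = concat (replicate j v)"
proof -
  assume "j \<le> k"
  then have "concat (replicate k v) = concat (replicate j v) @ concat (replicate (k - j) v)"
    by (metis concat_append le_add_diff_inverse replicate_add)
  then show ?thesis by (simp add: length_concat_replicate)
qed

text \<open>Stripping one copy of \<open>u\<close> from the front of \<open>d\<close> keeps the
  commutation and the divisibility, so the length decreases until nothing is left.\<close>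

lemma commuting_power:
  assumes "u @ d = d @ u" "length u dvd length d" "u \<noteq> []"
  shows "d = concat (replicate (length d div length u) u)"
  using assms(1,2)
proof (induction "length d" arbitrary: d rule: less_induct)
  case less
  show ?case
  proof (cases "d = []")
    case False
    then have le: "length u \<le> length d" using less.prems(2) by (simp add: dvd_imp_le)
    obtain d' where d': "d = u @ d'"
      using less.prems(1) le by (metis append_eq_append_conv_if append_take_drop_id)
    have "d' = concat (replicate (length d' div length u) u)"
      using less.prems assms(3) unfolding d' by (intro less.hyps) (auto simp: d')
    then show ?thesis using assms(3) by (simp add: d')
  qed simp
qed

lemma inj_rotate: "inj (rotate k)"
  unfolding rotate_def by (rule inj_fn) (rule inj_rotate1)

lemma mem_shift_class: "fs \<in> shift_class es \<longleftrightarrow> (\<exists>k. fs = rotate k es)"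
  by (simp add: shift_class_def)

lemma self_shift_class [simp]: "es \<in> shift_class es"
  unfolding mem_shift_class by (rule exI[of _ 0]) simp

lemma shift_class_rotate: "shift_class (rotate k es) = shift_class es"
proof (cases "es = []")
  case False
  have "shift_class es \<subseteq> shift_class (rotate k es)"
  proof
    fix fs assume "fs \<in> shift_class es"
    then obtain i where i: "fs = rotate i es" by (auto simp: mem_shift_class)
    let ?n = "length es"
    have le: "k mod ?n \<le> ?n" using False by (simp add: less_imp_le)
    have "rotate (i + (?n - k mod ?n)) (rotate k es) = rotate (i + (?n - k mod ?n)) (rotate (k mod ?n) es)"
      by (subst rotate_conv_mod) (rule refl)
    also have "\<dots> = rotate (i + ?n) es" using le by (simp add: rotate_rotate)
    also have "\<dots> = rotate i es" by (simp flip: rotate_rotate)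
    finally show "fs \<in> shift_class (rotate k es)" unfolding mem_shift_class i by metis
  qed
  moreover have "shift_class (rotate k es) \<subseteq> shift_class es"
    by (auto simp: shift_class_def rotate_rotate)
  ultimately show ?thesis by blast
qed (simp add: shift_class_def)

lemma shift_class_eq: "fs \<in> shift_class es \<Longrightarrow> shift_class fs = shift_class es"
  by (auto simp: mem_shift_class shift_class_rotate)

lemma some_in_shift_class: "(SOME fs. fs \<in> shift_class es) \<in> shift_class es"
  by (rule someI[of _ es]) simp

lemma length_shift_class: "fs \<in> shift_class es \<Longrightarrow> length fs = length es"
  by (auto simp: mem_shift_class)

lemma cycle_length_shift_class: "cycle_length (shift_class es) = length es"
  unfolding cycle_length_def using length_shift_class[OF some_in_shift_class] .

lemma cycle_power_shift_class:
  "cycle_power k (shift_class v) = shift_class (concat (replicate k v))"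
proof -
  obtain i where "(SOME fs. fs \<in> shift_class v) = rotate i v"
    using some_in_shift_class[of v] unfolding mem_shift_class by blast
  then show ?thesis
    by (simp add: cycle_power_def shift_class_rotate flip: rotate_concat_replicate)
qed

section \<open>Rotation periods and primitive roots of closed paths\<close>

definition rotation_period :: "'a list \<Rightarrow> nat" where
  "rotation_period es = (LEAST p. 0 < p \<and> rotate p es = es)"

lemma
  assumes "es \<noteq> []"
  shows rotation_period_pos: "0 < rotation_period es"
    and rotate_rotation_period: "rotate (rotation_period es) es = es"
    and rotation_period_le: "0 < p \<Longrightarrow> rotate p es = es \<Longrightarrow> rotation_period es \<le> p"
proof -
  have ex: "0 < length es \<and> rotate (length es) es = es" using assms by simp
  show "0 < rotation_period es" "rotate (rotation_period es) es = es"
    unfolding rotation_period_def using LeastI[of "\<lambda>p. 0 < p \<and> rotate p es = es", OF ex] by auto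
  show "0 < p \<Longrightarrow> rotate p es = es \<Longrightarrow> rotation_period es \<le> p"
    unfolding rotation_period_def by (rule Least_le) auto
qed

lemma rotate_mult_period: "rotate p es = es \<Longrightarrow> rotate (k * p) es = es"
proof (induction k)
  case (Suc k)
  then show ?case using rotate_rotate[of p "k * p" es] by simp
qed simp

lemma rotate_mod_period: "rotate p es = es \<Longrightarrow> rotate k es = rotate (k mod p) es"
  by (metis div_mult_mod_eq add.commute rotate_rotate rotate_mult_period)

lemma rotation_period_dvd:
  assumes "es \<noteq> []" "rotate p es = es"
  shows "rotation_period es dvd p"
proof (rule ccontr)
  assume "\<not> ?thesis"
  then have "0 < p mod rotation_period es" by (simp add: dvd_eq_mod_eq_0)
  moreover have "rotate (p mod rotation_period es) es = es"
    using assms rotate_mod_period[OF rotate_rotation_period[OF assms(1)]] by metis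
  ultimately have "rotation_period es \<le> p mod rotation_period es"
    by (rule rotation_period_le[OF assms(1)])
  then show False using rotation_period_pos[OF assms(1)] by (meson mod_less_divisor not_less)
qed

lemma card_shift_class:
  assumes "es \<noteq> []"
  shows "card (shift_class es) = rotation_period es"
proof -
  let ?p = "rotation_period es"
  have "shift_class es = (\<lambda>k. rotate k es) ` {..<?p}"
    using rotate_mod_period[OF rotate_rotation_period[OF assms]] rotation_period_pos[OF assms]
    by (auto simp: shift_class_def image_iff) (metis lessThan_iff mod_less_divisor)
  moreover have "inj_on (\<lambda>k. rotate k es) {..<?p}"
  proof (rule linorder_inj_onI)
    fix i j assume "i < j" "i \<in> {..<?p}" "j \<in> {..<?p}"
    show "rotate i es \<noteq> rotate j es"
    proof
      assume "rotate i es = rotate j es"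
      then have "rotate i (rotate (j - i) es) = rotate i es"
        using \<open>i < j\<close> by (simp add: rotate_rotate)
      then have "rotate (j - i) es = es" by (rule injD[OF inj_rotate])
      then have "?p \<le> j - i" using \<open>i < j\<close> by (intro rotation_period_le[OF assms]) auto
      then show False using \<open>j \<in> {..<?p}\<close> \<open>i < j\<close> by auto
    qed
  qed auto
  ultimately show ?thesis by (simp add: card_image)
qed

text \<open>Rotation by the period exchanges the two pieces of the word without changing it, so the
  prefix of that length commutes with the whole word.\<close>

lemma rotation_root:
  assumes "es \<noteq> []"
  shows "es = concat (replicate (length es div rotation_period es) (take (rotation_period es) es))"
proof -
  let ?p = "rotation_period es"
  have dvd: "?p dvd length es" by (rule rotation_period_dvd[OF assms]) simp
  then have le: "?p \<le> length es" using assms by (simp add: dvd_imp_le)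
  have "drop (?p mod length es) es @ take (?p mod length es) es = es"
    using rotate_rotation_period[OF assms] by (simp add: rotate_drop_take)
  \<comment> \<open>For a primitive word the period is the full length, where
    \<open>?p mod length es\<close> is 0; hence the case distinction.\<close>
  then have "drop ?p es @ take ?p es = es"
    using le by (cases "?p = length es") auto
  then have "take ?p es @ es = es @ take ?p es"
    by (metis append.assoc append_take_drop_id)
  then show ?thesis
    using commuting_power[of "take ?p es" es] dvd le rotation_period_pos[OF assms] assms
    by (simp add: min_absorb2)
qed

lemma bij_betw_Suc_mod:
  assumes "0 < n"
  shows "bij_betw (\<lambda>j. Suc j mod n) {..<n} {..<n}"
proof -
  have "inj_on (\<lambda>j. Suc j mod n) {..<n}" by (auto simp: inj_on_def mod_Suc split: if_splits)
  moreover have "(\<lambda>j. Suc j mod n) ` {..<n} \<subseteq> {..<n}" using assms by auto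
  ultimately show ?thesis by (simp add: bij_betw_def endo_inj_surj)
qed

definition path_weight :: "'k::{field,finite} edge set list \<Rightarrow> nat" where
  "path_weight es = (\<Prod>j<length es. edge_weight (es ! j) (es ! (Suc j mod length es)))"

lemma closed_path_iff_weight:
  "closed_path G es \<longleftrightarrow> es \<noteq> [] \<and> set es \<subseteq> quot_edges G \<and> path_weight es \<noteq> 0"
  by (auto simp: closed_path_def path_weight_def)

lemma path_weight_rotate: "path_weight (rotate k es) = path_weight es"
proof (induction k)
  case (Suc k)
  have "path_weight (rotate1 fs) = path_weight fs" for fs :: "'a edge set list"
  proof (cases "fs = []")
    case False
    let ?n = "length fs"
    have "path_weight (rotate1 fs) =
      (\<Prod>j<?n. edge_weight (fs ! (Suc j mod ?n)) (fs ! (Suc (Suc j mod ?n) mod ?n)))"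
      using False by (auto simp: path_weight_def nth_rotate1 intro!: prod.cong)
    also have "\<dots> = (\<Prod>j<?n. edge_weight (fs ! j) (fs ! (Suc j mod ?n)))"
      using False by (intro prod.reindex_bij_betw[OF bij_betw_Suc_mod]) simp
    finally show ?thesis by (simp add: path_weight_def)
  qed simp
  then show ?case using Suc by simp
qed simp

lemma closed_path_rotate: "closed_path G (rotate k es) \<longleftrightarrow> closed_path G es"
  by (simp add: closed_path_iff_weight path_weight_rotate)

lemma cycle_weight_shift_class: "cycle_weight (shift_class es) = path_weight es"
proof -
  obtain i where i: "(SOME fs. fs \<in> shift_class es) = rotate i es"
    using some_in_shift_class[of es] unfolding mem_shift_class by blast
  show ?thesis unfolding cycle_weight_def Let_def i
    using path_weight_rotate[of i es] by (simp add: path_weight_def)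
qed

text \<open>The pair (last, first) of \<open>v\<close> is also a cyclically adjacent pair of the
  power: at the seam between two copies, or, for \<open>k = 1\<close>, at the end of the
  word.\<close>

lemma closed_path_root:
  assumes "closed_path G (concat (replicate k v))"
  shows "closed_path G v"
proof -
  have k: "k \<noteq> 0" and v: "v \<noteq> []" using assms by (auto simp: closed_path_def)
  then obtain k' where k': "k = Suc k'" by (cases k) auto
  let ?es = "concat (replicate k v)"
  have "edge_weight (v ! j) (v ! (Suc j mod length v)) \<noteq> 0" if j: "j < length v" for j
  proof -
    have n: "length ?es = k * length v" by (rule length_concat_replicate)
    have jn: "j < length ?es" using j k unfolding n by (simp add: less_le_trans)
    have "?es ! j = v ! j" using j by (simp add: k' nth_append)
    moreover have "?es ! (Suc j mod length ?es) = v ! (Suc j mod length v)"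
    proof (cases "Suc j < length v")
      case True
      then have "Suc j < length ?es" using k unfolding n by (simp add: less_le_trans)
      then show ?thesis using True by (simp add: k' nth_append)
    next
      case False
      then have e: "Suc j = length v" using j by simp
      show ?thesis
      proof (cases k')
        case 0
        then show ?thesis using e v by (simp add: k')
      next
        case (Suc k'')
        then show ?thesis using e v by (simp add: k' nth_append)
      qed
    qed
    ultimately show ?thesis using assms jn unfolding closed_path_def by metis
  qed
  then show ?thesis using assms v k by (auto simp: closed_path_def k')
qed

text \<open>The prefix is primitive because a shorter root would give a shorter period. For
  uniqueness: the length of any other root is a multiple of the period, so a rotation of that root
  is a power of the prefix, and primality forces the exponent to be 1.\<close>

lemma underlying_prime_shift_class:
  assumes "closed_path G es"
  shows "underlying_prime G (shift_class es) = shift_class (take (rotation_period es) es)"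
proof -
  have ne: "es \<noteq> []" using assms by (simp add: closed_path_def)
  let ?p = "rotation_period es"
  let ?u = "take ?p es"
  let ?N = "length es div ?p"
  have root: "es = concat (replicate ?N ?u)" by (rule rotation_root[OF ne])
  have dvd: "?p dvd length es" by (rule rotation_period_dvd[OF ne]) simp
  have lu: "length ?u = ?p" using dvd ne by (simp add: dvd_imp_le)
  have p0: "0 < ?p" by (rule rotation_period_pos[OF ne])
  have N1: "1 \<le> ?N" using dvd ne p0 by (simp add: Suc_le_eq div_greater_zero_iff dvd_imp_le)
  have cu: "closed_path G ?u" using closed_path_root assms root by metis
  have power: "shift_class es = cycle_power ?N (shift_class ?u)"
    using root by (simp add: cycle_power_shift_class)
  have prime: "prime_cycle G (shift_class ?u)"
    unfolding prime_cycle_def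
  proof (intro conjI notI)
    show "shift_class ?u \<in> cycles G" using cu by (auto simp: cycles_def)
    assume "\<exists>m\<ge>2. \<exists>d\<in>cycles G. shift_class ?u = cycle_power m d"
    then obtain k v where k: "k \<ge> 2" and v: "closed_path G v"
      and e: "shift_class ?u = cycle_power k (shift_class v)"
      by (auto simp: cycles_def)
    have "?u \<in> shift_class (concat (replicate k v))"
      using e self_shift_class[of ?u] by (simp add: cycle_power_shift_class)
    then obtain i where i: "?u = concat (replicate k (rotate i v))"
      by (auto simp: mem_shift_class rotate_concat_replicate)
    have es: "es = concat (replicate (?N * k) (rotate i v))"
      using root i by (metis concat_replicate_replicate)
    have lv: "0 < length v" using v by (simp add: closed_path_def)
    have "rotate (length v) es = es"
      using rotate_length_concat_replicate[of "rotate i v" "?N * k"] unfolding es[symmetric] by simp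
    then have "?p \<le> length v" by (rule rotation_period_le[OF ne lv])
    moreover have "?p = k * length v"
      using lu arg_cong[OF i, of length] by (simp add: length_concat_replicate)
    ultimately show False using k lv by simp
  qed
  show ?thesis unfolding underlying_prime_def
  proof (rule the_equality)
    show "prime_cycle G (shift_class ?u) \<and> (\<exists>m\<ge>1. shift_class es = cycle_power m (shift_class ?u))"
      using prime power N1 by blast
    fix d assume d: "prime_cycle G d \<and> (\<exists>m\<ge>1. shift_class es = cycle_power m d)"
    then obtain v k where v: "closed_path G v" "d = shift_class v" and k: "k \<ge> 1"
      and e: "shift_class es = cycle_power k (shift_class v)"
      by (auto simp: prime_cycle_def cycles_def)
    have "es \<in> shift_class (concat (replicate k v))"
      using e self_shift_class[of es] by (simp add: cycle_power_shift_class)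
    then obtain i where i: "es = concat (replicate k (rotate i v))"
      by (auto simp: mem_shift_class rotate_concat_replicate)
    let ?v = "rotate i v"
    have "rotate (length ?v) es = es"
      using rotate_length_concat_replicate[of ?v k] i by simp
    then obtain j where j: "length ?v = j * ?p"
      using rotation_period_dvd[OF ne] by (metis dvd_def mult.commute)
    have "length es = k * length ?v" by (subst i) (rule length_concat_replicate)
    then have "j * ?p \<le> ?N * ?p" using j k dvd by simp
    then have jN: "j \<le> ?N" using p0 by simp
    have "?v = take (1 * length ?v) (concat (replicate k ?v))"
      using take_concat_replicate[OF k, of ?v] by simp
    also have "\<dots> = take (j * ?p) es" unfolding i[symmetric] j by simp
    also have "\<dots> = concat (replicate j ?u)"
      using take_concat_replicate[OF jN, of ?u] unfolding lu root[symmetric] .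
    finally have vj: "?v = concat (replicate j ?u)" .
    have dj: "d = cycle_power j (shift_class ?u)"
      using v(2) vj shift_class_rotate[of i v] by (simp add: cycle_power_shift_class)
    have "j \<noteq> 0" using j v(1) by (cases "j = 0") (auto simp: closed_path_def)
    moreover have "\<not> j \<ge> 2" using d dj cu by (auto simp: prime_cycle_def cycles_def)
    ultimately have "j = 1" by simp
    then show "d = shift_class ?u" using dj by (simp add: cycle_power_shift_class)
  qed
qed

text \<open>A cycle has as many distinct representatives as its prime root has edges, and they all
  have the same weight. So the factor given by the length of the prime cycle unfolds the cycle into
  its closed paths, and the count becomes a trace.\<close>

lemma cycle_count_eq_sum_paths:
  assumes fin: "finite {es. closed_path G es \<and> length es = m}"
  shows "cycle_count G m = (\<Sum>es | closed_path G es \<and> length es = m. path_weight es)"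
proof -
  let ?P = "{es. closed_path G es \<and> length es = m}"
  let ?C = "{c \<in> cycles G. cycle_length c = m}"
  have C: "?C = shift_class ` ?P"
    by (auto simp: cycles_def cycle_length_shift_class)
  have un: "\<Union>?C = ?P"
    by (auto simp: C closed_path_rotate mem_shift_class)
  have "finite A" if "A \<in> ?C" for A
    by (rule finite_subset[OF _ fin]) (use that un in blast)
  moreover have "A \<inter> B = {}" if AB: "A \<in> ?C" "B \<in> ?C" "A \<noteq> B" for A B
  proof (rule ccontr)
    obtain es es' where "A = shift_class es" "B = shift_class es'"
      using AB(1,2) unfolding C by blast
    moreover assume "A \<inter> B \<noteq> {}"
    ultimately show False using AB(3) shift_class_eq by blast
  qed
  ultimately have "sum path_weight (\<Union>?C) = (\<Sum>c\<in>?C. \<Sum>es\<in>c. path_weight es)"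
    by (subst sum.Union_disjoint) auto
  then have "(\<Sum>es\<in>?P. path_weight es) = (\<Sum>c\<in>?C. \<Sum>es\<in>c. path_weight es)"
    unfolding un .
  also have "\<dots> = (\<Sum>c\<in>?C. cycle_weight c * cycle_length (underlying_prime G c))"
  proof (rule sum.cong[OF refl])
    fix c assume "c \<in> ?C"
    then obtain es where es: "closed_path G es" and c: "c = shift_class es" unfolding C by auto
    have ne: "es \<noteq> []" using es by (simp add: closed_path_def)
    have "(\<Sum>fs\<in>c. path_weight fs) = (\<Sum>fs\<in>c. path_weight es)"
      by (rule sum.cong) (auto simp: c mem_shift_class path_weight_rotate)
    also have "\<dots> = path_weight es * rotation_period es"
      by (simp add: c card_shift_class[OF ne])
    also have "rotation_period es = cycle_length (underlying_prime G c)"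
    proof -
      have "rotation_period es dvd length es" by (rule rotation_period_dvd[OF ne]) simp
      then show ?thesis using ne
        by (simp add: c underlying_prime_shift_class[OF es] cycle_length_shift_class dvd_imp_le)
    qed
    finally show "(\<Sum>fs\<in>c. path_weight fs) = cycle_weight c * cycle_length (underlying_prime G c)"
      by (simp add: c cycle_weight_shift_class)
  qed
  finally show ?thesis by (simp add: cycle_count_def)
qed

section \<open>Counting walks\<close>

type_synonym gaps = "int \<times> int \<times> int"

text \<open>This is the sum of \<open>f\<close> over the q^2 geodesic successors of a state. The
  coefficients count the pairs \<open>(a, b)\<close> for which the least exponent in the support of
  \<open>(a, b, 1)\<close> is the one that gets raised; in a tie the last exponent \<open>v\<close>
  is raised.\<close>

fun transfer :: "int \<Rightarrow> (gaps \<Rightarrow> int) \<Rightarrow> gaps \<Rightarrow> int" where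
  "transfer q f (x, y, v) =
    (if v \<le> x then q\<^sup>2 * f (x, y, v + 1)
     else if v \<le> y then q * (q - 1) * f (v, y, x + 1) + q * f (x, y, v + 1)
     else q * (q - 1) * f (y, v, x + 1) + (q - 1) * f (x, v, y + 1) + f (x, y, v + 1))"

fun total :: "gaps \<Rightarrow> int" where "total (x, y, v) = x + y + v"

text \<open>Counts weighted walks from \<open>s\<close> to the target \<open>t\<close>. Each step
  adds 1 to \<open>total\<close>, so the length is forced; if the target lies below the source, the
  truncated length 0 yields the correct value 0.\<close>

definition green :: "int \<Rightarrow> gaps \<Rightarrow> gaps \<Rightarrow> int" where
  "green q t s = (transfer q ^^ nat (total t - total s)) (\<lambda>s. if s = t then 1 else 0) s"

lemma transfer_cong:
  assumes "\<And>s'. total s' = total s + 1 \<Longrightarrow> f s' = g s'"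
  shows "transfer q f s = transfer q g s"
  using assms by (cases s) (auto simp: algebra_simps)

lemma transfer_zero: "(\<And>s'. total s' = total s + 1 \<Longrightarrow> f s' = 0) \<Longrightarrow> transfer q f s = 0"
  by (cases s) (auto simp: algebra_simps)

lemma green_eq: "green q t s = (if s = t then 1 else 0) + transfer q (green q t) s"
proof (cases "total s < total t")
  case True
  then obtain m where m: "nat (total t - total s) = Suc m"
    by (metis Suc_pred zero_less_diff zero_less_nat_eq diff_gt_0_iff_gt)
  have "green q t s = transfer q ((transfer q ^^ m) (\<lambda>s. if s = t then 1 else 0)) s"
    by (simp add: green_def m)
  also have "\<dots> = transfer q (green q t) s"
  proof (rule transfer_cong)
    fix s' assume "total s' = total s + 1"
    then have "nat (total t - total s') = m" using m by linarith
    then show "(transfer q ^^ m) (\<lambda>s. if s = t then 1 else 0) s' = green q t s'"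
      by (simp add: green_def)
  qed
  finally show ?thesis using True by auto
next
  case False
  have "transfer q (green q t) s = 0"
  proof (rule transfer_zero)
    fix s' assume "total s' = total s + 1"
    then show "green q t s' = 0" using False by (auto simp: green_def)
  qed
  then show ?thesis using False by (simp add: green_def)
qed

text \<open>The maximum of the exponents never decreases along a walk, so a target with a smaller
  maximum is out of reach.\<close>

lemma transfer_power_level:
  assumes "x \<le> y" "x' \<le> y'" "max y v > max y' v'"
  shows "(transfer q ^^ m) (\<lambda>s. if s = (x', y', v') then 1 else 0) (x, y, v) = 0"
  using assms
proof (induction m arbitrary: x y v)
  case (Suc m)
  define f where "f = (transfer q ^^ m) (\<lambda>s. if s = (x', y', v') then 1 else 0)"
  have IH: "f (x, y, v) = 0" if "x \<le> y" "max y v > max y' v'" for x y v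
    unfolding f_def using that Suc.prems(2) by (intro Suc.IH)
  have "transfer q f (x, y, v) = 0"
  proof -
    have "f (x, y, v + 1) = 0" "v \<le> y \<Longrightarrow> f (v, y, x + 1) = 0"
      "y < v \<Longrightarrow> f (y, v, x + 1) = 0" "y < v \<Longrightarrow> f (x, v, y + 1) = 0"
      using Suc.prems(1,3) by (auto intro!: IH)
    then show ?thesis by simp
  qed
  then show ?case by (simp add: f_def)
qed auto

lemma green_level:
  "x \<le> y \<Longrightarrow> x' \<le> y' \<Longrightarrow> max y v > max y' v' \<Longrightarrow> green q (x', y', v') (x, y, v) = 0"
  by (simp add: green_def transfer_power_level)

section \<open>Harmonic functions between two growths of the maximum\<close>

lemma forced_moves:
  assumes harm: "\<And>x v. x \<le> y \<Longrightarrow> v \<le> y \<Longrightarrow> h (x, y, v) = transfer q h (x, y, v)"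
  shows "w \<le> y \<Longrightarrow> h (w, y, w + 1 - int n) = q ^ (2 * n) * h (w, y, w + 1)"
proof (induction n)
  case (Suc n)
  have e: "w + 1 - int (Suc n) + 1 = w + 1 - int n" by simp
  have "h (w, y, w + 1 - int (Suc n)) = transfer q h (w, y, w + 1 - int (Suc n))"
    using Suc.prems by (intro harm) auto
  \<comment> \<open>While the last exponent is at most \<open>w\<close>, it is the least one and
    there is a single branch, of weight q^2. These forced moves are the cost of a reset.\<close>
  also have "\<dots> = q\<^sup>2 * h (w, y, w + 1 - int n)"
    using Suc.prems by (simp add: e del: of_nat_Suc)
  finally show ?case using Suc by (simp add: power2_eq_square)
qed simp

text \<open>
  The constant \<open>C\<close> below collects the walks that reset the smallest exponent before the maximum grows;
  the factor \<open>q ^ (2 * d)\<close> is the cost of the first reset.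
\<close>

lemma middle_shape:
  assumes harm: "\<And>x v. x \<le> y \<Longrightarrow> v \<le> y \<Longrightarrow> h (x, y, v) = transfer q h (x, y, v)"
  shows "\<exists>C. (\<forall>d\<ge>1. h (y - int g - int d, y, y - int g) =
        q ^ (g + 1) * h (y - int (d + g), y, y + 1) + q ^ (2 * d) * C) \<and>
      ((\<forall>i\<le>g. h (y - int i, y, y + 1) = 0) \<longrightarrow> C = 0)"
proof (induction g)
  case 0
  have "h (y - int d, y, y) = q * h (y - int d, y, y + 1) + q ^ (2 * d) * (q * (q - 1) * h (y, y, y + 1))"
    if "d \<ge> 1" for d
  proof -
    have "h (y - int d, y, y) = q * (q - 1) * h (y, y, y + 1 - int d) + q * h (y - int d, y, y + 1)"
      using that by (subst harm) (auto simp: algebra_simps)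
    then show ?thesis by (simp add: forced_moves[OF harm])
  qed
  then show ?case by (intro exI[of _ "q * (q - 1) * h (y, y, y + 1)"]) auto
next
  case (Suc g)
  then obtain C where C: "\<And>d. d \<ge> 1 \<Longrightarrow> h (y - int g - int d, y, y - int g) =
        q ^ (g + 1) * h (y - int (d + g), y, y + 1) + q ^ (2 * d) * C"
    and C0: "(\<forall>i\<le>g. h (y - int i, y, y + 1) = 0) \<longrightarrow> C = 0" by blast
  \<comment> \<open>Either the reset happens now and leads to gap 1 at level \<open>g\<close>, from
    where further resets may or may not follow; or the exponent is raised and the first reset comes
    later from gap \<open>d + 1\<close>, which accounts for the extra factor
    \<open>q\<^sup>2\<close>.\<close>
  define C' where "C' = q * (q - 1) * (q ^ (g + 1) * h (y - int (1 + g), y, y + 1) + q\<^sup>2 * C) + q * q\<^sup>2 * C"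
  have "h (y - int (Suc g) - int d, y, y - int (Suc g)) =
        q ^ (Suc g + 1) * h (y - int (d + Suc g), y, y + 1) + q ^ (2 * d) * C'" if d: "d \<ge> 1" for d
  proof -
    let ?w = "y - int (Suc g)"
    have "h (?w - int d, y, ?w) = q * (q - 1) * h (?w, y, ?w + 1 - int d) + q * h (?w - int d, y, ?w + 1)"
      using d by (subst harm) (auto simp: algebra_simps)
    also have "h (?w, y, ?w + 1 - int d) = q ^ (2 * d) * h (?w, y, ?w + 1)"
      by (rule forced_moves[OF harm]) auto
    also have "h (?w, y, ?w + 1) = q ^ (g + 1) * h (y - int (1 + g), y, y + 1) + q\<^sup>2 * C"
      using C[of 1] by (simp add: algebra_simps power2_eq_square)
    also have "h (?w - int d, y, ?w + 1) =
        q ^ (g + 1) * h (y - int (d + Suc g), y, y + 1) + q ^ (2 * Suc d) * C"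
      using C[of "Suc d"] by (simp add: algebra_simps)
    finally show ?thesis
      by (simp add: C'_def algebra_simps power_add power2_eq_square)
  qed
  moreover have "C' = 0" if "\<forall>i\<le>Suc g. h (y - int i, y, y + 1) = 0"
    using that C0 by (auto simp: C'_def)
  ultimately show ?case by blast
qed

text \<open>With the profile \<open>q ^ (2 * i)\<close> at the top, the branches with and without a
  reset carry the same power of \<open>q\<close>, and \<open>q * (q - 1) + q = q\<^sup>2\<close>
  collapses the recursion to a single power.\<close>

lemma middle_harmonic:
  assumes harm: "\<And>x v. x \<le> y \<Longrightarrow> v \<le> y \<Longrightarrow> h (x, y, v) = transfer q h (x, y, v)"
    and top: "\<And>i. i \<le> K \<Longrightarrow> h (y - int i, y, y + 1) = q ^ (2 * i) * \<mu>"
  shows "d \<ge> 1 \<Longrightarrow> d + g \<le> K \<Longrightarrow> h (y - int g - int d, y, y - int g) = q ^ (2 * (d + 1 + 2 * g)) * \<mu>"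
proof (induction g arbitrary: d)
  case 0
  have "h (y - int d, y, y) = q * (q - 1) * h (y, y, y + 1 - int d) + q * h (y - int d, y, y + 1)"
    using 0 by (subst harm) (auto simp: algebra_simps)
  also have "h (y, y, y + 1 - int d) = q ^ (2 * d) * h (y, y, y + 1)"
    by (rule forced_moves[OF harm]) auto
  finally show ?case using 0 top[of d] top[of 0]
    by (simp add: algebra_simps power2_eq_square)
next
  case (Suc g)
  let ?w = "y - int (Suc g)"
  have "h (?w - int d, y, ?w) = q * (q - 1) * h (?w, y, ?w + 1 - int d) + q * h (?w - int d, y, ?w + 1)"
    using Suc.prems by (subst harm) (auto simp: algebra_simps)
  also have "h (?w, y, ?w + 1 - int d) = q ^ (2 * d) * h (?w, y, ?w + 1)"
    by (rule forced_moves[OF harm]) auto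
  also have "h (?w, y, ?w + 1) = q ^ (2 * (2 + 2 * g)) * \<mu>"
    using Suc.IH[of 1] Suc.prems by (simp add: algebra_simps)
  also have "h (?w - int d, y, ?w + 1) = q ^ (2 * (Suc d + 1 + 2 * g)) * \<mu>"
    using Suc.IH[of "Suc d"] Suc.prems by (simp add: algebra_simps)
  also have "q ^ (2 * (2 + 2 * g)) = q ^ 4 * q ^ (4 * g)" unfolding power_add[symmetric] by (rule arg_cong[where f = "power q"]) simp
  also have "q ^ (2 * (Suc d + 1 + 2 * g)) = q ^ (2 * d) * (q ^ 4 * q ^ (4 * g))"
    unfolding power_add[symmetric] by (rule arg_cong[where f = "power q"]) simp
  also have "q * (q - 1) * (q ^ (2 * d) * (q ^ 4 * q ^ (4 * g) * \<mu>)) +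
      q * (q ^ (2 * d) * (q ^ 4 * q ^ (4 * g)) * \<mu>) = q ^ (2 * d) * (q ^ 6 * q ^ (4 * g)) * \<mu>"
    by algebra
  also have "q ^ (2 * d) * (q ^ 6 * q ^ (4 * g)) = q ^ (2 * (d + 1 + 2 * Suc g))"
    unfolding power_add[symmetric] by (rule arg_cong[where f = "power q"]) simp
  finally show ?case .
qed

section \<open>From one growth of the maximum to the next\<close>

definition top_state :: "nat \<Rightarrow> nat \<Rightarrow> int \<Rightarrow> gaps" where
  "top_state a c v = (v - int c - int a, v - int c, v)"

text \<open>The three summands raise the greatest, the least and the middle exponent. The left side
  applies \<open>transfer\<close> instead of evaluating \<open>h\<close>, because the target of a
  walk is itself a top state and \<open>h\<close> may fail to be harmonic there.\<close>

lemma top_level: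
  assumes harm: "\<And>x v'. x \<le> v \<Longrightarrow> v' \<le> v \<Longrightarrow> h (x, v, v') = transfer q h (x, v, v')"
    and "c \<ge> 1"
  shows "transfer q h (top_state a c v) = h (top_state a (c + 1) (v + 1)) +
    q ^ (2 * a) * (q * (q - 1) * h (v - int c, v, v - int c + 1)) +
    (q - 1) * h (v - int c - int a, v, v - int c + 1)"
proof -
  have "h (v - int c, v, v - int c - int a + 1) = q ^ (2 * a) * h (v - int c, v, v - int c + 1)"
    using forced_moves[OF harm, where w = "v - int c" and n = a] by (simp add: algebra_simps)
  then show ?thesis using assms(2) by (simp add: top_state_def algebra_simps)
qed

text \<open>The only route without a reset that passes the maximum from below raises the middle
  exponent, once with weight \<open>q - 1\<close> and then \<open>c\<close> more times with weight
  \<open>q\<close>; the least exponent stays, so the new gap is \<open>a + c\<close>. All routes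
  with a reset are collected in \<open>E\<close>. The essential point is the order of the
  quantifiers: \<open>E\<close> does not depend on \<open>a\<close>.\<close>

lemma top_shape:
  assumes harm: "\<And>x v'. x \<le> v \<Longrightarrow> v' \<le> v \<Longrightarrow> h (x, v, v') = transfer q h (x, v, v')"
    and "c \<ge> 1"
  shows "\<exists>E. (\<forall>a. transfer q h (top_state a c v) = h (top_state a (c + 1) (v + 1)) +
      q ^ (2 * a) * E + (q - 1) * q ^ c * h (top_state (a + c) 1 (v + 1))) \<and>
     ((\<forall>i\<le>c. h (top_state i 1 (v + 1)) = 0) \<longrightarrow> E = 0)"
proof -
  obtain g where g: "c = Suc g" using assms(2) by (cases c) auto
  have top: "h (top_state i 1 (v + 1)) = h (v - int i, v, v + 1)" for i
    by (simp add: top_state_def)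
  obtain C where C: "\<And>d. d \<ge> 1 \<Longrightarrow> h (v - int g - int d, v, v - int g) =
        q ^ (g + 1) * h (v - int (d + g), v, v + 1) + q ^ (2 * d) * C"
    and C0: "(\<forall>i\<le>g. h (v - int i, v, v + 1) = 0) \<longrightarrow> C = 0"
    using middle_shape[OF harm, of g] by blast
  define B where "B = q ^ c * h (v - int c, v, v + 1) + q\<^sup>2 * C"
  have B: "h (v - int c, v, v - int c + 1) = B"
    using C[of 1] g by (simp add: B_def algebra_simps power2_eq_square)
  have *: "h (v - int c - int a, v, v - int c + 1) = q ^ c * h (top_state (a + c) 1 (v + 1)) + q ^ (2 * a) * q\<^sup>2 * C" for a
    unfolding top using C[of "Suc a"] g by (simp add: algebra_simps power_add power2_eq_square)
  have "\<forall>a. transfer q h (top_state a c v) = h (top_state a (c + 1) (v + 1)) +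
      q ^ (2 * a) * (q * (q - 1) * B + (q - 1) * q\<^sup>2 * C) + (q - 1) * q ^ c * h (top_state (a + c) 1 (v + 1))"
  proof
    fix a
    show "transfer q h (top_state a c v) = h (top_state a (c + 1) (v + 1)) +
      q ^ (2 * a) * (q * (q - 1) * B + (q - 1) * q\<^sup>2 * C) + (q - 1) * q ^ c * h (top_state (a + c) 1 (v + 1))"
      by (subst top_level[OF assms], assumption, assumption)
        (simp only: B *, simp add: algebra_simps)
  qed
  moreover have "q * (q - 1) * B + (q - 1) * q\<^sup>2 * C = 0" if "\<forall>i\<le>c. h (top_state i 1 (v + 1)) = 0"
  proof -
    have "h (v - int i, v, v + 1) = 0" if "i \<le> c" for i
      using \<open>\<forall>i\<le>c. h (top_state i 1 (v + 1)) = 0\<close> that unfolding top by blast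
    from this[of c] this C0 show ?thesis using g by (simp add: B_def)
  qed
  ultimately show ?thesis by blast
qed

text \<open>Raising the least and raising the middle exponent contribute the same power of
  \<open>q\<close>, with coefficients \<open>q * (q - 1)\<close> and \<open>q - 1\<close>, whose sum
  is \<open>q\<^sup>2 - 1\<close>. The gaps that occur at the next growth are at most
  \<open>a + c\<close>, so the profile has to be known only up to there.\<close>

lemma top_harmonic:
  assumes harm: "\<And>x v'. x \<le> v \<Longrightarrow> v' \<le> v \<Longrightarrow> h (x, v, v') = transfer q h (x, v, v')"
    and "c \<ge> 1" and top: "\<And>i. i \<le> a + c \<Longrightarrow> h (top_state i 1 (v + 1)) = q ^ (2 * i) * \<mu>"
  shows "transfer q h (top_state a c v) =
    h (top_state a (c + 1) (v + 1)) + (q\<^sup>2 - 1) * q ^ (2 * a + 4 * c) * \<mu>"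
proof -
  obtain g where g: "c = Suc g" using assms(2) by (cases c) auto
  note mid = middle_harmonic[OF harm, of "a + c" \<mu>, OF _ _ top[unfolded top_state_def, simplified]]
  have "h (v - int c, v, v - int c + 1) = q ^ (4 * c) * \<mu>"
  proof -
    have "2 * (1 + 1 + 2 * g) = 4 * c" "v - int g - int 1 = v - int c" "v - int c + 1 = v - int g"
      using g by simp_all
    then show ?thesis using mid[of 1 g] g by (simp only:)
  qed
  moreover have "h (v - int c - int a, v, v - int c + 1) = q ^ (2 * a + 4 * c) * \<mu>"
  proof -
    have "2 * (Suc a + 1 + 2 * g) = 2 * a + 4 * c" "v - int g - int (Suc a) = v - int c - int a"
      "v - int c + 1 = v - int g"
      using g by simp_all
    then show ?thesis using mid[of "Suc a" g] g by (simp only:)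
  qed
  ultimately show ?thesis
    by (subst top_level[OF assms(1,2)]) (simp_all add: algebra_simps power_add power2_eq_square)
qed

text \<open>The target is a top state by \<open>c' \<ge> 1\<close>, so the term of the target in
  \<open>green_eq\<close> vanishes at all states with \<open>v \<le> y\<close>.\<close>

lemma green_harmonic:
  assumes "x \<le> y" "v \<le> y" "c' \<ge> 1"
  shows "green q (top_state a' c' v') (x, y, v) = transfer q (green q (top_state a' c' v')) (x, y, v)"
  using assms by (subst green_eq) (auto simp: top_state_def)

lemma top_state_eq_iff [simp]: "top_state a c v = top_state a' c' v' \<longleftrightarrow> a = a' \<and> c = c' \<and> v = v'"
  by (auto simp: top_state_def)

text \<open>
  The values below are the numbers of walks with \<open>n\<close> steps from \<open>c\<close> to \<open>c'\<close> in the chains in which \<open>c\<close> goes to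
  \<open>c + 1\<close> with weight \<open>1\<close>, and to \<open>1\<close> with weight \<open>(q - 1) q\<^sup>c\<close> (no reset) resp.
  \<open>(q\<^sup>2 - 1) q\<^sup>4\<^sup>c\<close> (resets allowed and charged in advance).
\<close>

definition unpaid :: "int \<Rightarrow> nat \<Rightarrow> nat \<Rightarrow> nat \<Rightarrow> int" where
  "unpaid q c' n c = (if c' = c + n then 1 else 0) +
     (if c' \<le> n then (q - 1) * q ^ (c + 2 * (n - c')) else 0)"

definition paid :: "int \<Rightarrow> nat \<Rightarrow> nat \<Rightarrow> nat \<Rightarrow> int" where
  "paid q c' n c = (if c' = c + n then 1 else 0) +
     (if c' \<le> n then (q\<^sup>2 - 1) * q ^ (4 * c + 6 * (n - c')) else 0)"

lemma green_above: "c \<ge> 1 \<Longrightarrow> c' \<ge> 1 \<Longrightarrow> v > v' \<Longrightarrow> green q (top_state a' c' v') (top_state a c v) = 0"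
  unfolding top_state_def by (rule green_level) auto

text \<open>Walks are split by whether the least exponent is ever reset; \<open>n\<close> is the
  number of growths of the maximum. Without a reset the least exponent is constant, so
  \<open>a + c\<close> grows by exactly \<open>n\<close>. With a reset, the starting gap enters only
  through the cost \<open>q ^ (2 * a)\<close> of the first one. After a reset the least exponent of
  a top state is at least the middle exponent of the start, and some later growth has set
  \<open>c\<close> back to 1; these two facts are the vanishing conditions on
  \<open>p\<close>.\<close>

lemma green_shape:
  assumes "c' \<ge> 1"
  shows "\<exists>p. (\<forall>a c. c \<ge> 1 \<longrightarrow> green q (top_state a' c' v) (top_state a c (v - int n)) =
      q ^ (2 * a) * p c + (if a' + c' = a + c + n then unpaid q c' n c else 0)) \<and>
    (\<forall>c. c' > n \<or> a' > c + n \<longrightarrow> p c = 0)"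
proof (induction n)
  case 0
  have "green q (top_state a' c' v) (top_state a c v) =
      (if a' + c' = a + c then unpaid q c' 0 c else 0)" if c: "c \<ge> 1" for a c
  proof -
    obtain E where E: "transfer q (green q (top_state a' c' v)) (top_state a c v) =
       green q (top_state a' c' v) (top_state a (c + 1) (v + 1)) +
      q ^ (2 * a) * E + (q - 1) * q ^ c * green q (top_state a' c' v) (top_state (a + c) 1 (v + 1))"
     "(\<forall>i\<le>c. green q (top_state a' c' v) (top_state i 1 (v + 1)) = 0) \<longrightarrow> E = 0"
      using top_shape[where h = "green q (top_state a' c' v)" and v = v and q = q, OF green_harmonic c] assms by blast
    have "transfer q (green q (top_state a' c' v)) (top_state a c v) = 0"
      using E c assms by (simp add: green_above)
    then show ?thesis
      using assms c by (subst green_eq) (auto simp: unpaid_def)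
  qed
  then show ?case by (intro exI[of _ "\<lambda>_. 0"]) auto
next
  case (Suc n)
  let ?G = "green q (top_state a' c' v)"
  obtain p where p: "\<And>a c. c \<ge> 1 \<Longrightarrow> ?G (top_state a c (v - int n)) =
      q ^ (2 * a) * p c + (if a' + c' = a + c + n then unpaid q c' n c else 0)"
    and p0: "\<And>c. c' > n \<or> a' > c + n \<Longrightarrow> p c = 0" using Suc by blast
  let ?v = "v - int (Suc n)"
  have v: "?v + 1 = v - int n" by simp
  define step where "step c E \<longleftrightarrow> (\<forall>a. transfer q ?G (top_state a c ?v) = ?G (top_state a (c + 1) (v - int n)) +
      q ^ (2 * a) * E + (q - 1) * q ^ c * ?G (top_state (a + c) 1 (v - int n))) \<and>
      ((\<forall>i\<le>c. ?G (top_state i 1 (v - int n)) = 0) \<longrightarrow> E = 0)" for c E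
  have "\<exists>E. step c E" if "c \<ge> 1" for c
    using top_shape[where h = ?G and v = ?v and q = q, OF green_harmonic that] assms
    unfolding v step_def by blast
  then obtain E where stepE: "\<And>c. c \<ge> 1 \<Longrightarrow> step c (E c)" by metis
  have E: "transfer q ?G (top_state a c ?v) = ?G (top_state a (c + 1) (v - int n)) +
      q ^ (2 * a) * E c + (q - 1) * q ^ c * ?G (top_state (a + c) 1 (v - int n))" if "c \<ge> 1" for a c
    using stepE[OF that] unfolding step_def by blast
  have E0: "E c = 0" if "c \<ge> 1" "\<And>i. i \<le> c \<Longrightarrow> ?G (top_state i 1 (v - int n)) = 0" for c
    using stepE[OF that(1)] that(2) unfolding step_def by blast
  \<comment> \<open>The three terms of the first round: the maximum grows again, a reset occurs in
    this round, or the gap becomes \<open>a + c\<close> and the reset comes later, where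
    \<open>q ^ (2 * (a + c)) * q ^ c\<close> leaves \<open>q ^ (3 * c)\<close> next to
    \<open>q ^ (2 * a)\<close>. The value at 0 is fixed by hand because \<open>E\<close> is
    specified only for \<open>c \<ge> 1\<close>.\<close>
  define P where "P c = (if c = 0 then 0 else p (c + 1) + E c + (q - 1) * q ^ (3 * c) * p 1)" for c
  have unp: "unpaid q c' (Suc n) c = unpaid q c' n (c + 1) + (q - 1) * q ^ c * unpaid q c' n 1" if "c \<ge> 1" for c
  proof (cases "c' \<le> n")
    case True
    define X where "X = q ^ (2 * (n - c'))"
    have "Suc n - c' = Suc (n - c')" using True by simp
    then have *: "unpaid q c' (Suc n) c = (q - 1) * (q ^ c * (q\<^sup>2 * X))"
      "unpaid q c' n (c + 1) = (q - 1) * (q * (q ^ c * X))" "unpaid q c' n 1 = (q - 1) * (q * X)"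
      using True that assms by (simp_all add: unpaid_def X_def power_add power2_eq_square)
    show ?thesis unfolding * by (simp add: algebra_simps power2_eq_square)
  next
    case False
    then show ?thesis using that by (auto simp: unpaid_def)
  qed
  have "?G (top_state a c ?v) =
      q ^ (2 * a) * P c + (if a' + c' = a + c + Suc n then unpaid q c' (Suc n) c else 0)" if "c \<ge> 1" for a c
  proof -
    have "?G (top_state a c ?v) = transfer q ?G (top_state a c ?v)"
      using that by (subst green_eq) auto
    also have "\<dots> = q ^ (2 * a) * p (c + 1) + (if a' + c' = a + c + Suc n then unpaid q c' n (c + 1) else 0) +
        q ^ (2 * a) * E c + (q - 1) * q ^ c * (q ^ (2 * (a + c)) * p 1 +
          (if a' + c' = a + c + Suc n then unpaid q c' n 1 else 0))"
      using that by (subst E) (simp_all add: p del: of_nat_Suc)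
    also have "q ^ (2 * (a + c)) = q ^ (2 * a) * q ^ (2 * c)" by (simp add: power_add)
    also have "q ^ (2 * a) * p (c + 1) + (if a' + c' = a + c + Suc n then unpaid q c' n (c + 1) else 0) +
        q ^ (2 * a) * E c + (q - 1) * q ^ c * (q ^ (2 * a) * q ^ (2 * c) * p 1 +
          (if a' + c' = a + c + Suc n then unpaid q c' n 1 else 0)) =
        q ^ (2 * a) * (p (c + 1) + E c + (q - 1) * (q ^ c * q ^ (2 * c)) * p 1) +
        (if a' + c' = a + c + Suc n then unpaid q c' n (c + 1) + (q - 1) * q ^ c * unpaid q c' n 1 else 0)"
      by (simp add: algebra_simps)
    also have "q ^ c * q ^ (2 * c) = q ^ (3 * c)" by (simp flip: power_add)
    finally show ?thesis using that by (simp add: P_def unp)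
  qed
  moreover have "P c = 0" if "c' > Suc n \<or> a' > c + Suc n" for c
  proof (cases "c = 0")
    case False
    have "E c = 0"
    proof (rule E0)
      show "?G (top_state i 1 (v - int n)) = 0" if "i \<le> c" for i
      proof -
        have "p 1 = 0" using \<open>c' > Suc n \<or> a' > c + Suc n\<close> by (intro p0) auto
        \<comment> \<open>If \<open>a'\<close> is too large, the equation cannot hold for any
          \<open>i \<le> c\<close>; if \<open>c'\<close> is too large, both terms of
          \<open>unpaid\<close> are absent.\<close>
        moreover have "a' + c' = i + 1 + n \<Longrightarrow> unpaid q c' n 1 = 0"
          using \<open>c' > Suc n \<or> a' > c + Suc n\<close> that assms by (auto simp: unpaid_def)
        ultimately show ?thesis by (simp add: p)
      qed
    qed (use False in auto)
    moreover have "p (c + 1) = 0" "p 1 = 0" using that by (auto intro!: p0)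
    ultimately show ?thesis by (simp add: P_def)
  qed (simp add: P_def)
  ultimately show ?case by blast
qed

lemma transfer_sum:
  "finite A \<Longrightarrow> transfer q (\<lambda>s. \<Sum>i\<in>A. w i * f i s) s = (\<Sum>i\<in>A. w i * transfer q (f i) s)"
proof (induction A rule: finite_induct)
  case empty
  show ?case by (cases s) simp
next
  case (insert i A)
  then show ?case by (cases s) (auto simp: algebra_simps split: if_splits)
qed

text \<open>Weighting the target by \<open>q ^ (2 * a')\<close> pays for a reset from that gap in
  advance. This profile is reproduced in every round by \<open>top_harmonic\<close>, so the starting
  gap survives only as a factor and \<open>c\<close> performs the chain of \<open>paid\<close>. The
  truncation at \<open>K\<close> is harmless since no gap beyond \<open>a + c + n\<close> is
  reached.\<close>

lemma green_total:
  assumes "c' \<ge> 1" "c \<ge> 1" "a + c + n \<le> K"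
  shows "(\<Sum>a'\<le>K. q ^ (2 * a') * green q (top_state a' c' v) (top_state a c (v - int n))) =
    q ^ (2 * a) * paid q c' n c"
proof -
  define h where "h = (\<lambda>s. \<Sum>a'\<le>K. q ^ (2 * a') * green q (top_state a' c' v) s)"
  have T: "transfer q h s = (\<Sum>a'\<le>K. q ^ (2 * a') * transfer q (green q (top_state a' c' v)) s)" for s
    unfolding h_def by (rule transfer_sum) simp
  have harm: "h (x, w, w') = transfer q h (x, w, w')" if "x \<le> w" "w' \<le> w" for x w w'
    unfolding T unfolding h_def using that assms(1) by (intro sum.cong refl arg_cong2[of _ _ _ _ "(*)"] green_harmonic)
  have "h (top_state a c (v - int n)) = q ^ (2 * a) * paid q c' n c"
    using assms(2,3)
  proof (induction n arbitrary: a c)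
    case 0
    \<comment> \<open>Above the common level of the targets \<open>h\<close> vanishes, so the
      profile holds there with \<open>\<mu> = 0\<close>.\<close>
    have "transfer q h (top_state a c v) = h (top_state a (c + 1) (v + 1)) + (q\<^sup>2 - 1) * q ^ (2 * a + 4 * c) * 0"
      using 0 assms(1) by (intro top_harmonic harm) (auto simp: h_def green_above)
    then have t0: "transfer q h (top_state a c v) = 0"
      using 0 assms(1) by (simp add: h_def green_above)
    have "h (top_state a c v) = (\<Sum>a'\<le>K. q ^ (2 * a') * (if a = a' \<and> c = c' then 1 else 0)) + transfer q h (top_state a c v)"
      unfolding T unfolding h_def by (subst green_eq) (simp add: distrib_left sum.distrib)
    also have "\<dots> = q ^ (2 * a) * paid q c' 0 c"
      using 0 assms(1) unfolding t0 by (auto simp: paid_def if_distrib[of "(*) _"] cong: if_cong)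
    finally show ?case by simp
  next
    case (Suc n)
    let ?v = "v - int (Suc n)"
    have v: "?v + 1 = v - int n" by simp
    have "h (top_state a c ?v) = transfer q h (top_state a c ?v)"
      unfolding T unfolding h_def by (subst green_eq) (simp add: algebra_simps)
    also have "\<dots> = h (top_state a (c + 1) (?v + 1)) + (q\<^sup>2 - 1) * q ^ (2 * a + 4 * c) * paid q c' n 1"
      by (rule top_harmonic[OF harm]) (use Suc.prems Suc.IH in \<open>auto simp: v\<close>)
    also have "\<dots> = q ^ (2 * a) * (paid q c' n (c + 1) + (q\<^sup>2 - 1) * q ^ (4 * c) * paid q c' n 1)"
      using Suc.prems unfolding v by (subst Suc.IH) (auto simp: algebra_simps power_add)
    also have "paid q c' n (c + 1) + (q\<^sup>2 - 1) * q ^ (4 * c) * paid q c' n 1 = paid q c' (Suc n) c"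
    proof (cases "c' \<le> n")
      case True
      define X where "X = q ^ (4 * c + 6 * (n - c'))"
      define Y where "Y = q ^ (6 * (n - c'))"
      have XY: "X = q ^ (4 * c) * Y" by (simp add: X_def Y_def power_add)
      have "Suc n - c' = Suc (n - c')" using True by simp
      then have *: "paid q c' (Suc n) c = (q\<^sup>2 - 1) * (q ^ 6 * X)"
        using True Suc.prems by (simp add: paid_def X_def power_add eval_nat_numeral)
      have **: "paid q c' n (c + 1) = (q\<^sup>2 - 1) * (q ^ 4 * X)"
        using True Suc.prems by (simp add: paid_def X_def power_add eval_nat_numeral)
      have ***: "paid q c' n 1 = (q\<^sup>2 - 1) * (q ^ 4 * Y)"
        using True Suc.prems assms(1) by (simp add: paid_def Y_def power_add)
      have "(q\<^sup>2 - 1) * (q ^ 4 * (Z * Y)) + (q\<^sup>2 - 1) * Z * ((q\<^sup>2 - 1) * (q ^ 4 * Y)) =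
          (q\<^sup>2 - 1) * (q ^ 6 * (Z * Y))" for Z :: int by algebra
      then show ?thesis unfolding * ** *** XY .
    next
      case False
      then show ?thesis using Suc.prems by (auto simp: paid_def)
    qed
    finally show ?case .
  qed
  then show ?thesis by (simp add: h_def)
qed

section \<open>Support and trace of the diagonal\<close>

lemma green_diagonal_support:
  assumes "c \<ge> 1" "n \<ge> 1" "green q (top_state a c v) (top_state a c (v - int n)) \<noteq> 0"
  shows "c \<le> n" "a \<le> 2 * n"
proof -
  \<comment> \<open>A walk without a reset would require \<open>a + c = a + c + n\<close>,
    impossible for \<open>n \<ge> 1\<close>; only the reset term with its vanishing conditions
    remains.\<close>
  obtain p where p: "green q (top_state a c v) (top_state a c (v - int n)) = q ^ (2 * a) * p c"
    and p0: "c > n \<or> a > c + n \<Longrightarrow> p c = 0"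
  proof -
    obtain p where "\<forall>b c'. c' \<ge> 1 \<longrightarrow> green q (top_state a c v) (top_state b c' (v - int n)) =
        q ^ (2 * b) * p c' + (if a + c = b + c' + n then unpaid q c n c' else 0)"
      "\<forall>c'. c > n \<or> a > c' + n \<longrightarrow> p c' = 0"
      using green_shape[OF assms(1), of q a v n] by blast
    then show ?thesis using assms that[of p] by auto
  qed
  have "p c \<noteq> 0" using p assms by auto
  then have "c \<le> n \<and> a \<le> c + n" using p0 by linarith
  then show "c \<le> n" "a \<le> 2 * n" by auto
qed

text \<open>The diagonal value at gap \<open>a\<close> is \<open>q ^ (2 * a) * p a\<close>, where
  \<open>p\<close> depends on the target gap only. The weighted total of all walks that start at gap
  0 is the sum of the same numbers plus the contribution of the walks without a reset, which end at
  gap \<open>n\<close> and carry the weight \<open>q ^ (2 * n)\<close>. Since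
  \<open>c \<le> n\<close>, the cutoff \<open>2 * n\<close> is admissible in
  \<open>green_total\<close>.\<close>

lemma green_diagonal_sum:
  assumes "c \<ge> 1" "n \<ge> 1" "c \<le> n"
  shows "(\<Sum>a\<le>2*n. green q (top_state a c v) (top_state a c (v - int n))) =
    (q\<^sup>2 - 1) * q ^ (6 * n - 2 * c) - (q - 1) * q ^ (4 * n - c)"
proof -
  have "\<exists>p. \<forall>a. green q (top_state a' c v) (top_state a c (v - int n)) =
      q ^ (2 * a) * p + (if a' = a + n then unpaid q c n c else 0)" for a'
  proof -
    obtain p where "\<forall>b c'. c' \<ge> 1 \<longrightarrow> green q (top_state a' c v) (top_state b c' (v - int n)) =
        q ^ (2 * b) * p c' + (if a' + c = b + c' + n then unpaid q c n c' else 0)"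
      using green_shape[OF assms(1), of q a' v n] by blast
    then have "\<forall>b. green q (top_state a' c v) (top_state b c (v - int n)) =
        q ^ (2 * b) * p c + (if a' = b + n then unpaid q c n c else 0)"
      using assms(1) by auto
    then show ?thesis by blast
  qed
  then obtain p where p: "\<And>a' a. green q (top_state a' c v) (top_state a c (v - int n)) =
      q ^ (2 * a) * p a' + (if a' = a + n then unpaid q c n c else 0)" by metis
  have "paid q c n c = (\<Sum>a'\<le>2*n. q ^ (2 * a') * green q (top_state a' c v) (top_state 0 c (v - int n)))"
    using green_total[of c c 0 n "2 * n" q v] assms by simp
  also have "\<dots> = (\<Sum>a'\<le>2*n. q ^ (2 * a') * p a') + q ^ (2 * n) * unpaid q c n c"
    unfolding p by (simp add: distrib_left sum.distrib if_distrib[of "(*) _"] cong: if_cong)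
  also have "(\<Sum>a'\<le>2*n. q ^ (2 * a') * p a') = (\<Sum>a\<le>2*n. green q (top_state a c v) (top_state a c (v - int n)))"
    using assms by (simp add: p)
  finally have "(\<Sum>a\<le>2*n. green q (top_state a c v) (top_state a c (v - int n))) =
     paid q c n c - q ^ (2 * n) * unpaid q c n c" by simp
  also have "paid q c n c = (q\<^sup>2 - 1) * q ^ (6 * n - 2 * c)"
  proof -
    have "4 * c + 6 * (n - c) = 6 * n - 2 * c" using assms by simp
    then show ?thesis using assms by (simp add: paid_def)
  qed
  also have "q ^ (2 * n) * unpaid q c n c = (q - 1) * q ^ (4 * n - c)"
  proof -
    have "4 * n - c = 2 * n + (c + 2 * (n - c))" using assms by simp
    then show ?thesis using assms by (simp add: unpaid_def power_add)
  qed
  finally show ?thesis .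
qed

text \<open>Telescoping: \<open>(q\<^sup>2 - 1) * q ^ (6 * n - 2 * c)\<close> is the difference of
  two consecutive powers of \<open>q\<^sup>2\<close>, and \<open>(q - 1) * q ^ (4 * n - c)\<close>
  is one of consecutive powers of \<open>q\<close>.\<close>

lemma geometric_step:
  "k \<le> n \<Longrightarrow> (\<Sum>c=1..k. ((q::int)\<^sup>2 - 1) * q ^ (6 * n - 2 * c) - (q - 1) * q ^ (4 * n - c)) =
    q ^ (6 * n) - q ^ (6 * n - 2 * k) - (q ^ (4 * n) - q ^ (4 * n - k))"
proof (induction k)
  case (Suc k)
  have e: "6 * n - 2 * k = Suc (Suc (6 * n - 2 * Suc k))" "4 * n - k = Suc (4 * n - Suc k)"
    using Suc.prems by auto
  have "(\<Sum>c=1..Suc k. (q\<^sup>2 - 1) * q ^ (6 * n - 2 * c) - (q - 1) * q ^ (4 * n - c)) =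
     q ^ (6 * n) - q ^ (6 * n - 2 * k) - (q ^ (4 * n) - q ^ (4 * n - k)) +
    ((q\<^sup>2 - 1) * q ^ (6 * n - 2 * Suc k) - (q - 1) * q ^ (4 * n - Suc k))"
    using Suc by simp
  then show ?case unfolding e by (simp add: algebra_simps power2_eq_square)
qed simp

lemma green_trace:
  assumes "n \<ge> 1"
  shows "(\<Sum>c=1..n. \<Sum>a\<le>2*n. green q (top_state a c v) (top_state a c (v - int n))) =
    q ^ (6 * n) - 2 * q ^ (4 * n) + q ^ (3 * n)"
proof -
  have "(\<Sum>c=1..n. \<Sum>a\<le>2*n. green q (top_state a c v) (top_state a c (v - int n))) =
     (\<Sum>c=1..n. (q\<^sup>2 - 1) * q ^ (6 * n - 2 * c) - (q - 1) * q ^ (4 * n - c))"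
    using assms by (intro sum.cong refl green_diagonal_sum) auto
  then show ?thesis using geometric_step[of n n q] by simp
qed

section \<open>Lattices\<close>

lemma fls_mult_nth_below:
  fixes f g :: "'a::semiring_0 fls"
  assumes "\<And>k. k < a \<Longrightarrow> f $$ k = 0" "\<And>k. k < b \<Longrightarrow> g $$ k = 0" "n < a + b"
  shows "(f * g) $$ n = 0"
proof (cases "f = 0 \<or> g = 0")
  case False
  then have "a \<le> fls_subdegree f" "b \<le> fls_subdegree g"
    using assms(1,2) by (auto intro!: fls_subdegree_geI)
  then show ?thesis using assms(3) by (intro fls_times_nth_eq0) linarith
qed auto

lemma fls_mult_nth_lowest:
  fixes f g :: "'a::semiring_0 fls"
  assumes "\<And>k. k < a \<Longrightarrow> f $$ k = 0" "\<And>k. k < b \<Longrightarrow> g $$ k = 0"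
  shows "(f * g) $$ (a + b) = f $$ a * g $$ b"
proof (cases "f = 0 \<or> g = 0")
  case False
  then have le: "a \<le> fls_subdegree f" "b \<le> fls_subdegree g"
    using assms by (auto intro!: fls_subdegree_geI)
  show ?thesis
  proof (cases "a = fls_subdegree f \<and> b = fls_subdegree g")
    case True
    then show ?thesis by simp
  next
    case False
    then have lt: "a < fls_subdegree f \<or> b < fls_subdegree g" using le by linarith
    then have "(f * g) $$ (a + b) = 0" using le by (intro fls_times_nth_eq0) linarith
    moreover have "f $$ a = 0 \<or> g $$ b = 0" using lt by (auto simp: fls_eq0_below_subdegree)
    ultimately show ?thesis by auto
  qed
qed auto

lemma int_ring_iff: "f \<in> int_ring \<longleftrightarrow> (\<forall>k<0. f $$ k = 0)"
proof
  assume "\<forall>k<0. f $$ k = 0"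
  then have "0 \<le> fls_subdegree f" by (cases "f = 0") (auto intro!: fls_subdegree_geI)
  then have "fps_to_fls (fls_regpart f) = f" by (rule fls_regpart_to_fls_trivial)
  then show "f \<in> int_ring" unfolding int_ring_def by (metis rangeI)
qed (auto simp: int_ring_def)

lemma int_ring_add: "a \<in> int_ring \<Longrightarrow> b \<in> int_ring \<Longrightarrow> a + b \<in> int_ring"
  by (simp add: int_ring_iff)

lemma int_ring_mult: "a \<in> int_ring \<Longrightarrow> b \<in> int_ring \<Longrightarrow> a * b \<in> int_ring"
  unfolding int_ring_iff using fls_mult_nth_below[of 0 a 0 b] by auto

lemma int_ring_uminus: "a \<in> int_ring \<Longrightarrow> - a \<in> int_ring"
  by (simp add: int_ring_iff)

lemma int_ring_simps [simp]:
  "0 \<in> int_ring" "1 \<in> int_ring" "fls_X \<in> int_ring" "fls_const c \<in> int_ring"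
  by (auto simp: int_ring_iff)

lemma fls_subdegree_int_ring: "a \<noteq> 0 \<Longrightarrow> a \<in> int_ring \<longleftrightarrow> 0 \<le> fls_subdegree a"
  by (auto simp: int_ring_iff intro!: fls_subdegree_geI)

lemma nth_poly_fls_X_inv:
  fixes p :: "'k::field poly"
  shows "poly (map_poly fls_const p) fls_X_inv $$ k = (if k \<le> 0 then coeff p (nat (- k)) else 0)"
proof (induction p arbitrary: k)
  case (pCons a p)
  have "map_poly fls_const (pCons a p) = pCons (fls_const a) (map_poly fls_const p)"
    using pCons by (simp add: map_poly_pCons)
  then have "poly (map_poly fls_const (pCons a p)) fls_X_inv $$ k =
      (if k = 0 then a else 0) + poly (map_poly fls_const p) fls_X_inv $$ (k + 1)"
    by (simp add: fls_X_inv_times_conv_shift)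
  also have "\<dots> = (if k \<le> 0 then coeff (pCons a p) (nat (- k)) else 0)"
  proof (cases "k < 0")
    case True
    then have "nat (- k) = Suc (nat (- (k + 1)))" by simp
    then show ?thesis using True by (simp add: pCons.IH)
  qed (auto simp: pCons.IH)
  finally show ?case .
qed simp

lemma poly_ring_iff: "f \<in> poly_ring \<longleftrightarrow> (\<forall>k>0. f $$ k = 0)"
proof
  assume f: "\<forall>k>0. f $$ k = 0"
  define p where "p = Abs_poly (\<lambda>i. f $$ (- int i))"
  have "coeff p = (\<lambda>i. f $$ (- int i))"
    unfolding p_def by (rule coeff_Abs_poly[of "nat (- fls_subdegree f)"]) (auto simp: fls_eq0_below_subdegree)
  then have "poly (map_poly fls_const p) fls_X_inv = f"
    using f by (intro fls_eqI) (auto simp: nth_poly_fls_X_inv)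
  then show "f \<in> poly_ring" unfolding poly_ring_def by (metis rangeI)
qed (auto simp: poly_ring_def nth_poly_fls_X_inv)

section \<open>Modules over the integer ring and homothety\<close>

definition lat_module :: "'k::field vec3 set \<Rightarrow> bool" where
  "lat_module L \<longleftrightarrow> (\<forall>v\<in>L. \<forall>w\<in>L. v + w \<in> L) \<and> (\<forall>a\<in>int_ring. \<forall>v\<in>L. a *s v \<in> L)"

lemma lat_module_add: "lat_module L \<Longrightarrow> v \<in> L \<Longrightarrow> w \<in> L \<Longrightarrow> v + w \<in> L"
  by (simp add: lat_module_def)

lemma lat_module_smult: "lat_module L \<Longrightarrow> a \<in> int_ring \<Longrightarrow> v \<in> L \<Longrightarrow> a *s v \<in> L"
  by (simp add: lat_module_def)

lemma lat_module_uminus: "lat_module L \<Longrightarrow> v \<in> L \<Longrightarrow> - v \<in> L"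
  using lat_module_smult[of L "- 1" v] int_ring_uminus[of 1] by simp

abbreviation int_span :: "'k::field vec3 set \<Rightarrow> 'k vec3 set" where
  "int_span B \<equiv> {(\<Sum>b\<in>B. c b *s b) | c. \<forall>b\<in>B. c b \<in> int_ring}"

lemma lattice_module: "lattice L \<Longrightarrow> lat_module L"
proof -
  assume "lattice L"
  then obtain B where L: "L = int_span B"
    unfolding lattice_def by blast
  have "v + w \<in> L" if vw: "v \<in> L" "w \<in> L" for v w
  proof -
    obtain c d where "v = (\<Sum>b\<in>B. c b *s b)" "w = (\<Sum>b\<in>B. d b *s b)"
      "\<forall>b\<in>B. c b \<in> int_ring" "\<forall>b\<in>B. d b \<in> int_ring" using vw unfolding L by blast
    then have "v + w = (\<Sum>b\<in>B. (c b + d b) *s b)" "\<forall>b\<in>B. c b + d b \<in> int_ring"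
      by (auto simp: sum.distrib vector_sadd_rdistrib int_ring_add)
    then show ?thesis unfolding L by (intro CollectI exI[of _ "\<lambda>b. c b + d b"]) auto
  qed
  moreover have "a *s v \<in> L" if a: "a \<in> int_ring" "v \<in> L" for a v
  proof -
    obtain c where "v = (\<Sum>b\<in>B. c b *s b)" "\<forall>b\<in>B. c b \<in> int_ring" using a unfolding L by blast
    then have "a *s v = (\<Sum>b\<in>B. (a * c b) *s b)" "\<forall>b\<in>B. a * c b \<in> int_ring"
      using a by (auto simp: vec.scale_sum_right int_ring_mult)
    then show ?thesis unfolding L by (intro CollectI exI[of _ "\<lambda>b. a * c b"]) auto
  qed
  ultimately show ?thesis unfolding lat_module_def by blast
qed

lemma scale_scale: "scale a (scale b L) = scale (a * b) L"
  by (simp add: scale_def image_image)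

lemma scale_1 [simp]: "scale 1 L = L"
  by (simp add: scale_def)

lemma scale_inverse [simp]: "a \<noteq> 0 \<Longrightarrow> scale (inverse a) (scale a L) = L" "a \<noteq> 0 \<Longrightarrow> scale a (scale (inverse a) L) = L"
  by (simp_all add: scale_scale)

lemma inj_scale: "a \<noteq> 0 \<Longrightarrow> inj (\<lambda>v. a *s (v :: 'k::field vec3))"
  by (auto simp: inj_def)

lemma scale_mono_iff: "a \<noteq> 0 \<Longrightarrow> scale a A \<subseteq> scale a B \<longleftrightarrow> A \<subseteq> B"
  unfolding scale_def by (rule inj_image_subset_iff[OF inj_scale])

lemma scale_strict_mono_iff: "a \<noteq> 0 \<Longrightarrow> scale a A \<subset> scale a B \<longleftrightarrow> A \<subset> B"
  by (simp add: psubset_eq scale_mono_iff) (metis scale_inverse(1))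

lemma scale_commute: "scale a (scale b L) = scale b (scale a L)"
  by (simp add: scale_scale mult.commute)

lemma lat_module_scale: "lat_module L \<Longrightarrow> lat_module (scale a L)"
  unfolding lat_module_def scale_def
  by (auto simp: image_iff vector_add_ldistrib[symmetric] mult.commute)
     (metis vec.scale_left_commute vec.scale_scale)+

lemma scale_subset: "lat_module L \<Longrightarrow> a \<in> int_ring \<Longrightarrow> scale a L \<subseteq> L"
  by (auto simp: scale_def lat_module_smult)

lemma subset_scale:
  assumes "lat_module L" "a \<noteq> 0" "fls_subdegree a \<le> 0"
  shows "L \<subseteq> scale a L"
proof -
  have "scale (inverse a) L \<subseteq> L"
    using assms by (intro scale_subset) (simp_all add: fls_subdegree_int_ring)
  then have "scale a (scale (inverse a) L) \<subseteq> scale a L" using assms by (simp add: scale_mono_iff del: scale_inverse)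
  then show ?thesis using assms by simp
qed

lemma scale_subset_scale_X:
  assumes "lat_module L" "a \<noteq> 0" "fls_subdegree a \<ge> 1"
  shows "scale a L \<subseteq> scale fls_X L"
proof -
  have "scale (inverse fls_X * a) L \<subseteq> L"
    using assms by (intro scale_subset) (simp_all add: fls_subdegree_int_ring)
  then have "scale fls_X (scale (inverse fls_X * a) L) \<subseteq> scale fls_X L"
    by (simp add: scale_mono_iff)
  then show ?thesis by (simp add: scale_scale mult.assoc[symmetric])
qed

text \<open>If \<open>a\<close> had positive valuation, \<open>scale a B\<close> would lie in
  \<open>scale fls_X B\<close> and hence in \<open>scale fls_X A\<close>; for negative valuation the
  roles of \<open>B\<close> and \<open>scale a B\<close> are exchanged. So \<open>a\<close> is a
  unit of the integer ring.\<close>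

lemma between_unique:
  assumes mod: "lat_module A" "lat_module B" and a: "a \<noteq> 0"
    and B: "scale fls_X A \<subset> B" "B \<subset> A" and aB: "scale fls_X A \<subset> scale a B" "scale a B \<subset> A"
  shows "scale a B = B"
proof -
  have "scale fls_X B \<subseteq> scale fls_X A" "scale fls_X (scale a B) \<subseteq> scale fls_X A"
    using B aB by (auto simp: scale_mono_iff)
  moreover have "scale a B \<subseteq> scale fls_X B" if "fls_subdegree a \<ge> 1"
    by (rule scale_subset_scale_X) (use mod a that in auto)
  moreover have "B \<subseteq> scale fls_X (scale a B)" if "fls_subdegree a \<le> - 1"
  proof -
    have "scale (inverse a) (scale a B) \<subseteq> scale fls_X (scale a B)"
      by (rule scale_subset_scale_X) (use mod a that in \<open>auto intro: lat_module_scale\<close>)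
    then show ?thesis using a by simp
  qed
  ultimately have "\<not> fls_subdegree a \<ge> 1" "\<not> fls_subdegree a \<le> - 1"
    using B aB by blast+
  then have 0: "fls_subdegree a = 0" by simp
  show ?thesis
    using scale_subset[OF mod(2), of a] subset_scale[OF mod(2) a] a 0
    by (auto simp: fls_subdegree_int_ring)
qed

lemma between_not_homothetic:
  assumes "lat_module A" "scale fls_X A \<subset> B" "B \<subset> A" "a \<noteq> 0"
  shows "B \<noteq> scale a A"
  using assms scale_subset_scale_X[of A a] subset_scale[of A a] by (cases "fls_subdegree a \<ge> 1") auto

lemma self_hclass [simp]: "L \<in> hclass L"
  unfolding hclass_def by (auto intro!: exI[of _ 1])

lemma hclass_scale: "a \<noteq> 0 \<Longrightarrow> hclass (scale a L) = hclass L"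
proof -
  assume a: "a \<noteq> 0"
  have "scale b L = scale (b * inverse a) (scale a L)" for b
    using a by (simp add: scale_scale mult.assoc)
  then show ?thesis using a unfolding hclass_def
    by (auto simp: scale_scale) (metis inverse_nonzero_iff_nonzero no_zero_divisors)+
qed

lemma mem_hclass: "L' \<in> hclass L \<longleftrightarrow> (\<exists>a. a \<noteq> 0 \<and> L' = scale a L)"
  by (auto simp: hclass_def)

lemma invertible_image_image:
  "(*v) g ` (*v) h ` L = (*v) (g ** h) ` (L :: 'k::field vec3 set)"
  by (simp add: image_image matrix_vector_mul_assoc)

lemma inj_mult_vec: "h ** g = mat 1 \<Longrightarrow> inj ((*v) (g :: 'k::field mat3))"
  by (rule inj_on_inverseI[of _ "(*v) h"]) (simp add: matrix_vector_mul_assoc)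

lemma lattice_image:
  fixes g :: "'k::field mat3"
  assumes "h ** g = mat 1" "lattice L"
  shows "lattice ((*v) g ` L)"
proof -
  obtain B where B: "vec.independent B" "card B = 3"
    and L: "L = int_span B"
    using assms(2) unfolding lattice_def by blast
  have inj: "inj ((*v) g)" using assms(1) by (rule inj_mult_vec)
  have lin: "Vector_Spaces.linear (*s) (*s) ((*v) g)" by (rule matrix_vector_mul_linear_gen)
  have "vec.independent ((*v) g ` B)"
    by (rule vec.linear_independent_injective_image[OF lin B(1)]) (use inj in \<open>auto intro: inj_on_subset\<close>)
  moreover have "card ((*v) g ` B) = 3" using inj B(2) by (simp add: card_image inj_on_subset)
  moreover have "(*v) g ` L = int_span ((*v) g ` B)"
  proof -
    have e: "(\<Sum>b\<in>(*v) g ` B. c b *s b) = g *v (\<Sum>b\<in>B. c (g *v b) *s b)" for c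
      using inj by (subst sum.reindex) (auto intro: inj_on_subset simp: vec.linear_sum[OF lin] vec.linear_scale[OF lin])
    show ?thesis
    proof (intro equalityI subsetI)
      fix w assume "w \<in> (*v) g ` L"
      then obtain c where c: "w = g *v (\<Sum>b\<in>B. c b *s b)" "\<forall>b\<in>B. c b \<in> int_ring" unfolding L by blast
      have "w = (\<Sum>b\<in>(*v) g ` B. c (h *v b) *s b)"
        unfolding e c by (simp add: matrix_vector_mul_assoc assms(1))
      moreover have "\<forall>b\<in>(*v) g ` B. c (h *v b) \<in> int_ring"
        using c by (simp add: matrix_vector_mul_assoc assms(1))
      ultimately show "w \<in> int_span ((*v) g ` B)"
        by (intro CollectI exI[of _ "\<lambda>b. c (h *v b)"]) simp
    next
      fix w assume "w \<in> int_span ((*v) g ` B)"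
      then obtain c where c: "w = (\<Sum>b\<in>(*v) g ` B. c b *s b)" "\<forall>b\<in>(*v) g ` B. c b \<in> int_ring" by blast
      show "w \<in> (*v) g ` L" unfolding c(1) e L
        by (rule imageI, rule CollectI, rule exI[of _ "\<lambda>b. c (g *v b)"]) (use c(2) in auto)
    qed
  qed
  ultimately show ?thesis unfolding lattice_def by blast
qed

lemma image_scale: "(*v) g ` scale a L = scale a ((*v) g ` (L :: 'k::field vec3 set))"
  by (simp add: scale_def image_image matrix_vector_mult_scaleR vector_scalar_commute)

section \<open>Diagonal lattices\<close>

abbreviation tpow :: "int \<Rightarrow> 'k::field fls" where "tpow n \<equiv> fls_shift n 1"

lemma nth_tpow_mult: "(tpow n * f) $$ k = f $$ (k + n)" for f :: "'k::field fls"
  using fls_X_intpow_times_conv_shift(1)[of "- n" f] by simp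

text \<open>The direct sum of the modules generated by \<open>t\<close> to the power
  \<open>n i\<close>. The coefficient at \<open>k\<close> belongs to the power \<open>- k\<close> of
  \<open>t\<close>, which explains the sign; raising an exponent enlarges the lattice.\<close>

definition diag_lat :: "(3 \<Rightarrow> int) \<Rightarrow> 'k::field vec3 set" where
  "diag_lat n = {v. \<forall>i. \<forall>k < - n i. v $ i $$ k = 0}"

lemma lat_module_diag_lat: "lat_module (diag_lat n)"
  unfolding lat_module_def diag_lat_def
  by (auto simp: int_ring_iff intro!: fls_mult_nth_below[of 0])

definition tdiag :: "(3 \<Rightarrow> int) \<Rightarrow> 'k::field mat3" where
  "tdiag n = (\<chi> i j. if i = j then tpow (n i) else 0)"

lemma tdiag_mult_vec: "(tdiag n *v v) $ i = tpow (n i) * v $ i"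
  by (simp add: tdiag_def matrix_vector_mult_def if_distrib[of "\<lambda>x. x * _"] cong: if_cong)

lemma tdiag_inverse: "tdiag (\<lambda>i. - n i) ** tdiag n = mat 1"
proof -
  have "(tpow (- a) :: 'a fls) * tpow a = 1" for a
    using fls_X_intpow_times_fls_X_intpow[of a "- a", where 'a = 'a] by simp
  then show ?thesis
    by (simp add: matrix_eq vec_eq_iff tdiag_mult_vec mult.assoc[symmetric] flip: matrix_vector_mul_assoc)
qed

lemma lattice_diag_lat: "lattice (diag_lat n)"
proof -
  have "vec.independent (cart_basis :: 'a vec3 set)" by (rule independent_cart_basis)
  moreover have "card (cart_basis :: 'a vec3 set) = 3" by (simp add: card_cart_basis)
  moreover have "diag_lat (\<lambda>_. 0) = int_span (cart_basis :: 'a vec3 set)"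
  proof -
    have e: "(\<Sum>b\<in>cart_basis. c b *s b) $ i = c (axis i 1)" for c :: "'a vec3 \<Rightarrow> 'a fls" and i
    proof -
      have "inj (\<lambda>i::3. axis i 1 :: 'a vec3)" by (auto simp: inj_def axis_eq_axis)
      then have "(\<Sum>b\<in>cart_basis. c b *s b) = (\<Sum>j\<in>UNIV. c (axis j 1) *s axis j 1)"
        unfolding cart_basis_def Setcompr_eq_image by (subst sum.reindex) auto
      then show ?thesis by (simp add: axis_def if_distrib[of "(*) _"] cong: if_cong)
    qed
    show ?thesis
    proof (intro equalityI subsetI)
      fix v :: "'a vec3" assume v: "v \<in> diag_lat (\<lambda>_. 0)"
      define c where "c b = v $ (THE i. b = axis i 1)" for b :: "'a vec3"
      have c: "c (axis i 1) = v $ i" for i by (simp add: c_def axis_eq_axis)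
      have "v = (\<Sum>b\<in>cart_basis. c b *s b)" unfolding vec_eq_iff e c by simp
      moreover have "\<forall>b\<in>(cart_basis :: 'a vec3 set). c b \<in> int_ring"
        using v by (auto simp: cart_basis_def c diag_lat_def int_ring_iff)
      ultimately show "v \<in> int_span (cart_basis :: 'a vec3 set)"
        by blast
    next
      fix v assume "v \<in> int_span (cart_basis :: 'a vec3 set)"
      then obtain c where c: "v = (\<Sum>b\<in>cart_basis. c b *s b)" "\<forall>b\<in>(cart_basis :: 'a vec3 set). c b \<in> int_ring" by blast
      then have "v $ i \<in> int_ring" for i unfolding c(1) e by (auto simp: cart_basis_def)
      then show "v \<in> diag_lat (\<lambda>_. 0)" by (simp add: diag_lat_def int_ring_iff)
    qed
  qed
  ultimately have "lattice (diag_lat (\<lambda>_. 0) :: 'a vec3 set)" unfolding lattice_def by blast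
  then have "lattice ((*v) (tdiag n) ` (diag_lat (\<lambda>_. 0) :: 'a vec3 set))"
    by (rule lattice_image[OF tdiag_inverse])
  moreover have "(*v) (tdiag n) ` (diag_lat (\<lambda>_. 0)) = (diag_lat n :: 'a vec3 set)"
  proof (intro equalityI subsetI)
    fix v :: "'a vec3" assume v: "v \<in> diag_lat n"
    have "tdiag (\<lambda>i. - n i) *v v \<in> diag_lat (\<lambda>_. 0)" using v by (simp add: diag_lat_def tdiag_mult_vec nth_tpow_mult)
    moreover have "v = tdiag n *v (tdiag (\<lambda>i. - n i) *v v)"
      using tdiag_inverse[of "\<lambda>i. - n i", where 'a = 'a] by (simp add: matrix_vector_mul_assoc)
    ultimately show "v \<in> (*v) (tdiag n) ` (diag_lat (\<lambda>_. 0))" by blast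
  qed (auto simp: diag_lat_def tdiag_mult_vec nth_tpow_mult)
  ultimately show ?thesis by simp
qed

section \<open>Polynomial matrices and the pivot step\<close>

definition GLpoly :: "'k::field mat3 set" where
  "GLpoly = carrier (GL3 poly_ring)"

lemma GLpoly_iff: "g \<in> GLpoly \<longleftrightarrow> (\<forall>i j. g $ i $ j \<in> poly_ring) \<and>
    (\<exists>h. (\<forall>i j. h $ i $ j \<in> poly_ring) \<and> g ** h = mat 1 \<and> h ** g = mat 1)"
  by (simp add: GLpoly_def GL3_def)

lemma GLpoly_inverse:
  assumes "g \<in> GLpoly"
  obtains h where "h \<in> GLpoly" "g ** h = mat 1" "h ** g = mat 1"
  using assms unfolding GLpoly_iff by blast

lemma GLpoly_mult: "g \<in> GLpoly \<Longrightarrow> h \<in> GLpoly \<Longrightarrow> g ** h \<in> GLpoly"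
  using group.is_monoid[OF group_GL3_poly, THEN monoid.m_closed]
  by (simp add: GLpoly_def GL3_def)

lemma GLpoly_one: "mat 1 \<in> GLpoly"
  using group.is_monoid[OF group_GL3_poly, THEN monoid.one_closed]
  by (simp add: GLpoly_def GL3_def)

lemma image_eq_by_inverse:
  fixes g :: "'k::field mat3"
  assumes "g ** h = mat 1" "(*v) g ` A \<subseteq> B" "(*v) h ` B \<subseteq> A"
  shows "(*v) g ` A = B"
proof
  show "B \<subseteq> (*v) g ` A"
  proof
    fix w assume "w \<in> B"
    then have "h *v w \<in> A" using assms(3) by blast
    moreover have "w = g *v (h *v w)" by (simp add: matrix_vector_mul_assoc assms(1))
    ultimately show "w \<in> (*v) g ` A" by blast
  qed
qed (rule assms(2))

definition transvec :: "3 \<Rightarrow> (3 \<Rightarrow> 'k::field fls) \<Rightarrow> 'k mat3" where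
  "transvec i r = (\<chi> k j. (if k = j then 1 else 0) + (if j = i \<and> k \<noteq> i then r k else 0))"

lemma transvec_mult_vec:
  "(transvec i r *v v) $ k = v $ k + (if k \<noteq> i then r k * v $ i else 0)"
  by (simp add: transvec_def matrix_vector_mult_def distrib_right sum.distrib
      if_distrib[of "\<lambda>x. x * _"] cong: if_cong)

lemma transvec_inverse: "transvec i (\<lambda>k. - r k) ** transvec i r = mat 1"
  by (simp add: matrix_eq vec_eq_iff transvec_mult_vec flip: matrix_vector_mul_assoc)

lemma transvec_inverse': "transvec i r ** transvec i (\<lambda>k. - r k) = mat 1"
  using transvec_inverse[of i "\<lambda>k. - r k"] by simp

lemma transvec_GLpoly: "(\<And>k. r k \<in> poly_ring) \<Longrightarrow> transvec i r \<in> GLpoly"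
  unfolding GLpoly_iff
  by (intro conjI allI exI[of _ "transvec i (\<lambda>k. - r k)"] transvec_inverse transvec_inverse')
    (auto simp: transvec_def poly_ring_iff)

text \<open>The quotient of \<open>t\<close> times \<open>diag_lat n\<close> by
  \<open>diag_lat n\<close> is a three-dimensional space over the residue field, with coordinates
  the coefficients at \<open>- n i - 1\<close>. This is the preimage of the line through
  \<open>u\<close>.\<close>

definition line_ext :: "(3 \<Rightarrow> int) \<Rightarrow> (3 \<Rightarrow> 'k::field) \<Rightarrow> 'k vec3 set" where
  "line_ext n u = {v. (\<forall>i. \<forall>k < - n i - 1. v $ i $$ k = 0) \<and> (\<exists>c. \<forall>i. v $ i $$ (- n i - 1) = c * u i)}"

text \<open>Subtracting \<open>u k / u i\<close> times \<open>t\<close> to the power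
  \<open>n k - n i\<close> times coordinate \<open>i\<close> from coordinate \<open>k\<close> clears
  the leading vector outside \<open>i\<close>. The multiplier is a polynomial in \<open>t\<close>
  because \<open>i\<close> has the least exponent in the support of \<open>u\<close>; this is why a
  step always raises such an exponent.\<close>

lemma pivot:
  fixes u :: "3 \<Rightarrow> 'k::field"
  assumes ui: "u i \<noteq> 0" and min: "\<And>k. u k \<noteq> 0 \<Longrightarrow> n i \<le> n k"
  obtains g where "g \<in> GLpoly" "(*v) g ` diag_lat n = diag_lat n"
    "(*v) g ` line_ext n u = diag_lat (n(i := n i + 1))"
proof -
  define r where "r k = fls_const (u k / u i) * tpow (n k - n i)" for k
  let ?g = "transvec i (\<lambda>k. - r k)" and ?h = "transvec i r"
  have rn: "(r k * f) $$ j = u k / u i * f $$ (j + (n k - n i))" for k j f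
    by (simp add: r_def mult.assoc nth_tpow_mult)
  have "r k $$ j = 0" if "j > 0" for k j
    using rn[of k 1 j] min[of k] that by (cases "u k = 0") auto
  then have poly: "r k \<in> poly_ring" "- r k \<in> poly_ring" for k by (auto simp: poly_ring_iff)
  \<comment> \<open>The slack \<open>d\<close> is 0 for vectors of \<open>diag_lat n\<close> and 1
    for vectors of \<open>line_ext n u\<close>.\<close>
  have zero: "(r k * f) $$ j = 0" if "\<And>j. j < - n i - d \<Longrightarrow> f $$ j = 0" "j < - n k - d" for f j k d
    unfolding rn using that by simp
  have inv: "?g ** ?h = mat 1" "?h ** ?g = mat 1"
    by (rule transvec_inverse, rule transvec_inverse')
  have "(*v) ?g ` diag_lat n \<subseteq> diag_lat n" "(*v) ?h ` diag_lat n \<subseteq> diag_lat n"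
    using zero[of 0] by (auto simp: diag_lat_def transvec_mult_vec)
  then have D: "(*v) ?g ` diag_lat n = diag_lat n"
    by (rule image_eq_by_inverse[OF inv(1)])
  have "(*v) ?g ` line_ext n u \<subseteq> diag_lat (n(i := n i + 1))"
  proof safe
    fix v assume v: "v \<in> line_ext n u"
    then obtain c where c: "\<And>i. v $ i $$ (- n i - 1) = c * u i"
      and v0: "\<And>i k. k < - n i - 1 \<Longrightarrow> v $ i $$ k = 0" by (auto simp: line_ext_def)
    have "(?g *v v) $ k $$ j = 0" if "k \<noteq> i" "j < - n k" for k j
    proof (cases "j = - n k - 1")
      case True
      then have "j + (n k - n i) = - n i - 1" by simp
      then have "v $ i $$ (j + (n k - n i)) = c * u i" "v $ k $$ j = c * u k"
        using c[of i] c[of k] True by (simp_all only:)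
      then show ?thesis using that ui by (simp add: transvec_mult_vec rn)
    next
      case False
      then show ?thesis using that v0 zero[of 1 "v $ i"] by (simp add: transvec_mult_vec)
    qed
    then show "?g *v v \<in> diag_lat (n(i := n i + 1))"
      using v0 by (auto simp: diag_lat_def transvec_mult_vec)
  qed
  moreover have "(*v) ?h ` diag_lat (n(i := n i + 1)) \<subseteq> line_ext n u"
  proof safe
    fix v :: "'k vec3" assume "v \<in> diag_lat (n(i := n i + 1))"
    then have v: "\<And>k j. j < - (n(i := n i + 1)) k \<Longrightarrow> v $ k $$ j = 0" by (simp add: diag_lat_def)
    have vi: "v $ i $$ j = 0" if "j < - n i - 1" for j using v[of j i] that by simp
    have vk: "v $ k $$ j = 0" if "k \<noteq> i" "j < - n k" for j k using v[of j k] that by simp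
    have "(?h *v v) $ k $$ (- n k - 1) = v $ i $$ (- n i - 1) / u i * u k" for k
      using vk[of k] ui by (auto simp: transvec_mult_vec rn algebra_simps)
    moreover have "(?h *v v) $ k $$ j = 0" if "j < - n k - 1" for k j
    proof (cases "k = i")
      case True
      then show ?thesis using vi that by (simp add: transvec_mult_vec)
    next
      case False
      then have "v $ k $$ j = 0" using vk that by simp
      moreover have "(r k * v $ i) $$ j = 0" by (rule zero[of 1, OF vi that])
      ultimately show ?thesis using False by (simp add: transvec_mult_vec)
    qed
    ultimately show "?h *v v \<in> line_ext n u" unfolding line_ext_def by blast
  qed
  ultimately have "(*v) ?g ` line_ext n u = diag_lat (n(i := n i + 1))"
    by (rule image_eq_by_inverse[OF inv(1)])
  then show ?thesis by (rule that[OF transvec_GLpoly[OF poly(2)] D])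
qed

lemma obtain_pivot:
  fixes u :: "3 \<Rightarrow> 'k::field" and n :: "3 \<Rightarrow> int"
  assumes "\<exists>i. u i \<noteq> 0"
  obtains i where "u i \<noteq> 0" "\<And>k. u k \<noteq> 0 \<Longrightarrow> n i \<le> n k"
proof -
  have "finite {i. u i \<noteq> 0}" "{i. u i \<noteq> 0} \<noteq> {}" using assms by auto
  then obtain i where "i \<in> {i. u i \<noteq> 0}" "\<forall>k\<in>{i. u i \<noteq> 0}. n i \<le> n k"
    using arg_min_if_finite(1)[of "{i. u i \<noteq> 0}" n] arg_min_least[of "{i. u i \<noteq> 0}" _ n] by blast
  then show ?thesis using that by blast
qed

section \<open>Splitting of lattices (Birkhoff-Grothendieck)\<close>

definition split_lattice :: "'k::field vec3 set \<Rightarrow> bool" where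
  "split_lattice M \<longleftrightarrow> (\<exists>g\<in>GLpoly. \<exists>n. M = (*v) g ` diag_lat n)"

definition adjoin :: "'k::field vec3 set \<Rightarrow> 'k vec3 \<Rightarrow> 'k vec3 set" where
  "adjoin M v = {m + a *s v | m a. m \<in> M \<and> a \<in> int_ring}"

lemma split_lattice_lattice: "split_lattice M \<Longrightarrow> lattice M"
  unfolding split_lattice_def
proof (elim bexE exE)
  fix g n assume "g \<in> GLpoly" "M = (*v) g ` diag_lat n"
  then show "lattice M" using lattice_image[OF _ lattice_diag_lat] GLpoly_inverse by metis
qed

lemma split_lattice_image: "split_lattice M \<Longrightarrow> g \<in> GLpoly \<Longrightarrow> split_lattice ((*v) g ` M)"
  unfolding split_lattice_def
proof (elim bexE exE)
  fix h n assume "g \<in> GLpoly" "h \<in> GLpoly" "M = (*v) h ` diag_lat n"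
  then show "\<exists>g'\<in>GLpoly. \<exists>n. (*v) g ` M = (*v) g' ` diag_lat n"
    by (intro bexI[of _ "g ** h"] exI[of _ n]) (simp_all add: invertible_image_image GLpoly_mult)
qed

lemma split_diag_lat: "split_lattice (diag_lat n)"
  unfolding split_lattice_def by (intro bexI[of _ "mat 1"] exI[of _ n]) (simp_all add: GLpoly_one)

lemma split_line_ext: "\<exists>i. u i \<noteq> 0 \<Longrightarrow> split_lattice (line_ext n u)"
proof -
  assume "\<exists>i. u i \<noteq> 0"
  then obtain i where "u i \<noteq> 0" "\<And>k. u k \<noteq> 0 \<Longrightarrow> n i \<le> n k" using obtain_pivot[of u n] by metis
  then obtain g where g: "g \<in> GLpoly" "(*v) g ` line_ext n u = diag_lat (n(i := n i + 1))"
    by (rule pivot)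
  obtain h where h: "h \<in> GLpoly" "h ** g = mat 1" using g(1) by (rule GLpoly_inverse)
  have "line_ext n u = (*v) h ` diag_lat (n(i := n i + 1))"
    unfolding g(2)[symmetric] by (simp add: invertible_image_image h)
  then show ?thesis using h(1) by (auto simp: split_lattice_def)
qed

lemma adjoin_absorb: "lat_module M \<Longrightarrow> v \<in> M \<Longrightarrow> adjoin M v = M"
proof (intro equalityI subsetI)
  fix w assume "lat_module M" "v \<in> M" "w \<in> M"
  then show "w \<in> adjoin M v" unfolding adjoin_def by (intro CollectI exI[of _ w] exI[of _ 0]) simp
qed (auto simp: adjoin_def intro!: lat_module_add lat_module_smult)

lemma image_adjoin: "(*v) g ` adjoin M v = adjoin ((*v) g ` M) (g *v v)"
proof (intro equalityI subsetI)
  fix w assume "w \<in> (*v) g ` adjoin M v"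
  then obtain m a where "w = g *v m + a *s (g *v v)" "m \<in> M" "a \<in> int_ring"
    by (auto simp: adjoin_def matrix_vector_right_distrib vector_scalar_commute)
  then show "w \<in> adjoin ((*v) g ` M) (g *v v)" unfolding adjoin_def by blast
next
  fix w assume "w \<in> adjoin ((*v) g ` M) (g *v v)"
  then obtain m a where w: "w = g *v m + a *s (g *v v)" "m \<in> M" "a \<in> int_ring"
    by (auto simp: adjoin_def)
  then have "w = g *v (m + a *s v)" by (simp add: matrix_vector_right_distrib vector_scalar_commute)
  then show "w \<in> (*v) g ` adjoin M v" using w unfolding adjoin_def by blast
qed

lemma adjoin_diag_lat:
  assumes "fls_X *s w \<in> diag_lat n" and u: "\<And>i. u i = w $ i $$ (- n i - 1)"
  shows "adjoin (diag_lat n) w = line_ext n u"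
proof -
  have w0: "w $ i $$ k = 0" if "k < - n i - 1" for i k
  proof -
    have "(fls_X *s w) $ i $$ (k + 1) = 0" using assms(1) that unfolding diag_lat_def by auto
    then show ?thesis by (simp add: fls_X_times_conv_shift)
  qed
  show ?thesis
  proof (intro equalityI subsetI)
    fix v assume "v \<in> adjoin (diag_lat n) w"
    then obtain m a where v: "v = m + a *s w" "m \<in> diag_lat n" "a \<in> int_ring"
      by (auto simp: adjoin_def)
    have "v $ i $$ k = 0" if "k < - n i - 1" for i k
      using v that w0 fls_mult_nth_below[of 0 a "- n i - 1" "w $ i" k]
      by (auto simp: diag_lat_def int_ring_iff)
    moreover have "v $ i $$ (- n i - 1) = a $$ 0 * u i" for i
      using v w0 fls_mult_nth_lowest[of 0 a "- n i - 1" "w $ i"]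
      by (auto simp: diag_lat_def int_ring_iff u)
    ultimately show "v \<in> line_ext n u" unfolding line_ext_def by blast
  next
    fix v assume "v \<in> line_ext n u"
    then obtain c where c: "\<And>i. v $ i $$ (- n i - 1) = c * u i"
      and v0: "\<And>i k. k < - n i - 1 \<Longrightarrow> v $ i $$ k = 0" by (auto simp: line_ext_def)
    have "(v - fls_const c *s w) $ i $$ k = 0" if "k < - n i" for i k
      using that c[of i] v0[of k i] w0[of k i] u[of i] by (cases "k = - n i - 1") auto
    then have "v - fls_const c *s w \<in> diag_lat n" by (simp add: diag_lat_def)
    moreover have "v = (v - fls_const c *s w) + fls_const c *s w" by simp
    ultimately show "v \<in> adjoin (diag_lat n) w"
      unfolding adjoin_def by (intro CollectI exI[of _ "v - fls_const c *s w"] exI[of _ "fls_const c"]) auto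
  qed
qed

lemma line_ext_zero: "line_ext n (\<lambda>_. 0) = diag_lat n"
proof -
  have "(\<forall>k < - n i - 1. v $ i $$ k = 0) \<and> v $ i $$ (- n i - 1) = 0 \<longleftrightarrow> (\<forall>k < - n i. v $ i $$ k = 0)"
    for v :: "'a vec3" and i
  proof -
    have "k < - n i \<longleftrightarrow> k < - n i - 1 \<or> k = - n i - 1" for k by linarith
    then show ?thesis by auto
  qed
  then have "(\<forall>i. (\<forall>k < - n i - 1. v $ i $$ k = 0) \<and> v $ i $$ (- n i - 1) = 0) \<longleftrightarrow>
      (\<forall>i. \<forall>k < - n i. v $ i $$ k = 0)" for v :: "'a vec3" by simp
  then show ?thesis unfolding line_ext_def diag_lat_def by (simp add: all_conj_distrib)
qed

text \<open>In coordinates in which \<open>M\<close> is diagonal, adjoining \<open>v\<close> gives a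
  line extension, or nothing new if its leading vector is zero; the pivot makes the extension
  diagonal again.\<close>

lemma split_adjoin_step:
  assumes "split_lattice M" "fls_X *s v \<in> M"
  shows "split_lattice (adjoin M v)"
proof -
  obtain g n where g: "g \<in> GLpoly" and M: "M = (*v) g ` diag_lat n"
    using assms(1) by (auto simp: split_lattice_def)
  obtain h where h: "h \<in> GLpoly" "g ** h = mat 1" "h ** g = mat 1" using g by (rule GLpoly_inverse)
  define w where "w = h *v v"
  have v: "v = g *v w" by (simp add: w_def matrix_vector_mul_assoc h)
  have "h *v (fls_X *s v) \<in> (*v) h ` M" using assms(2) by blast
  then have "fls_X *s w \<in> diag_lat n"
    by (simp add: M invertible_image_image h w_def vector_scalar_commute)
  then have "adjoin (diag_lat n) w = line_ext n (\<lambda>i. w $ i $$ (- n i - 1))"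
    by (rule adjoin_diag_lat) simp
  moreover have "split_lattice (line_ext n (\<lambda>i. w $ i $$ (- n i - 1)))"
  proof (cases "\<exists>i. w $ i $$ (- n i - 1) \<noteq> 0")
    case True
    then show ?thesis by (rule split_line_ext)
  next
    case False
    then have "(\<lambda>i. w $ i $$ (- n i - 1)) = (\<lambda>_. 0)" by auto
    then show ?thesis by (simp only: line_ext_zero split_diag_lat)
  qed
  ultimately have "split_lattice ((*v) g ` adjoin (diag_lat n) w)"
    using g by (simp add: split_lattice_image)
  then show ?thesis by (simp add: image_adjoin M v)
qed

text \<open>Adjoining \<open>fls_X *s v\<close> before \<open>v\<close> breaks the extension into
  steps by lines; the intermediate vector is absorbed once \<open>v\<close> is present.\<close>

lemma split_adjoin:
  assumes "split_lattice M" "fls_X ^ N *s v \<in> M"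
  shows "split_lattice (adjoin M v)"
  using assms
proof (induction N arbitrary: M v)
  case 0
  then show ?case by (simp add: adjoin_absorb lattice_module split_lattice_lattice)
next
  case (Suc N)
  have "fls_X ^ N *s (fls_X *s v) \<in> M" using Suc.prems(2) by (simp add: mult.commute)
  then have M': "split_lattice (adjoin M (fls_X *s v))" using Suc by blast
  have mod: "lat_module M" using Suc.prems(1) by (intro lattice_module split_lattice_lattice)
  have "0 \<in> M" using lat_module_smult[OF mod, of 0] Suc.prems(2) by force
  then have "fls_X *s v \<in> adjoin M (fls_X *s v)"
    unfolding adjoin_def by (intro CollectI exI[of _ 0] exI[of _ 1]) auto
  then have "split_lattice (adjoin (adjoin M (fls_X *s v)) v)" by (rule split_adjoin_step[OF M'])
  also have "adjoin (adjoin M (fls_X *s v)) v = adjoin M v"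
  proof (intro equalityI subsetI)
    fix w assume "w \<in> adjoin (adjoin M (fls_X *s v)) v"
    then obtain m a b where w: "w = m + a *s (fls_X *s v) + b *s v" "m \<in> M" "a \<in> int_ring" "b \<in> int_ring"
      by (auto simp: adjoin_def)
    then have "w = m + (a * fls_X + b) *s v" "a * fls_X + b \<in> int_ring"
      by (auto simp: vector_sadd_rdistrib intro!: int_ring_add int_ring_mult)
    then show "w \<in> adjoin M v" using w(2) unfolding adjoin_def by blast
  next
    fix w assume "w \<in> adjoin M v"
    then obtain m b where w: "w = m + b *s v" "m \<in> M" "b \<in> int_ring" by (auto simp: adjoin_def)
    have "m \<in> adjoin M (fls_X *s v)"
      using w(2) unfolding adjoin_def by (intro CollectI exI[of _ m] exI[of _ 0]) auto
    then show "w \<in> adjoin (adjoin M (fls_X *s v)) v" using w unfolding adjoin_def by blast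
  qed
  finally show ?case .
qed

lemma diag_lat_absorbs:
  fixes v :: "'k::field vec3"
  shows "\<exists>N0. \<forall>N\<ge>N0. fls_X ^ N *s v \<in> diag_lat (\<lambda>_. - m)"
proof -
  define N0 where "N0 = nat (m - Min (range (\<lambda>i. fls_subdegree (v $ i))))"
  have "fls_X ^ N *s v \<in> diag_lat (\<lambda>_. - m)" if "N \<ge> N0" for N
  proof -
    have "(fls_X ^ N *s v) $ i $$ k = 0" if "k < m" for i k
    proof -
      have "Min (range (\<lambda>i. fls_subdegree (v $ i))) \<le> fls_subdegree (v $ i)" by (rule Min_le) auto
      then have "k - int N < fls_subdegree (v $ i)"
        using that \<open>N \<ge> N0\<close> unfolding N0_def by linarith
      then show ?thesis by (simp add: fls_X_power_times_conv_shift fls_eq0_below_subdegree)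
    qed
    then show ?thesis by (simp add: diag_lat_def)
  qed
  then show ?thesis by blast
qed

text \<open>Instead of reducing a matrix, \<open>L\<close> is built up from a deep diagonal
  sublattice by adjoining the vectors of a basis, each of which enters that sublattice after
  multiplication by a power of the uniformizer.\<close>

theorem lattice_split:
  fixes L :: "'k::field vec3 set"
  assumes "lattice L"
  shows "split_lattice L"
proof -
  obtain B where B: "vec.independent B" "card B = 3"
    and L: "L = int_span B"
    using assms unfolding lattice_def by blast
  have mod: "lat_module L" by (rule lattice_module[OF assms])
  have fin: "finite B" using B(2) by (simp add: card_eq_0_iff[symmetric] card_ge_0_finite)
  have "UNIV \<subseteq> vec.span B"
    by (rule vec.card_ge_dim_independent) (use B in \<open>auto simp: card_cart_basis\<close>)
  then have "\<exists>r. axis i 1 = (\<Sum>b\<in>B. r b *s b)" for i :: 3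
    unfolding vec.span_finite[OF fin] by auto
  then obtain r where r: "\<And>i :: 3. axis i 1 = (\<Sum>b\<in>B. r i b *s b)" by metis
  \<comment> \<open>All coordinates of the standard vectors in the basis \<open>B\<close> have
    valuation at least \<open>- m\<close>, so vectors of valuation at least \<open>m\<close> have
    integral coordinates in \<open>B\<close>.\<close>
  define m where "m = Max (range (\<lambda>i. Max ((\<lambda>b. - fls_subdegree (r i b)) ` B)))"
  have m: "- m \<le> fls_subdegree (r i b)" if "b \<in> B" for i b
  proof -
    have "- fls_subdegree (r i b) \<le> Max ((\<lambda>b. - fls_subdegree (r i b)) ` B)"
      using that fin by (intro Max_ge) auto
    also have "\<dots> \<le> m" unfolding m_def by (rule Max_ge) auto
    finally show ?thesis by simp
  qed
  have sub: "diag_lat (\<lambda>_. - m) \<subseteq> L"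
  proof
    fix v :: "'k vec3" assume v: "v \<in> diag_lat (\<lambda>_. - m)"
    have "v = (\<Sum>i\<in>UNIV. v $ i *s axis i 1)" by (rule basis_expansion[symmetric])
    also have "\<dots> = (\<Sum>b\<in>B. (\<Sum>i\<in>UNIV. v $ i * r i b) *s b)"
      unfolding r by (subst vec.scale_sum_right, subst sum.swap) (simp add: vec.scale_sum_left)
    finally have "v = (\<Sum>b\<in>B. (\<Sum>i\<in>UNIV. v $ i * r i b) *s b)" .
    moreover have "v $ i * r i b \<in> int_ring" if "b \<in> B" for i b
      unfolding int_ring_iff
    proof (intro allI impI)
      fix k :: int assume "k < 0"
      show "(v $ i * r i b) $$ k = 0"
        by (rule fls_mult_nth_below[of m _ "- m"])
          (use v m[OF that, of i] \<open>k < 0\<close> in \<open>auto simp: diag_lat_def fls_eq0_below_subdegree\<close>)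
    qed
    then have "\<forall>b\<in>B. (\<Sum>i\<in>UNIV. v $ i * r i b) \<in> int_ring"
      by (auto simp: sum_3 intro!: int_ring_add)
    ultimately show "v \<in> L"
      unfolding L by (intro CollectI exI[of _ "\<lambda>b. \<Sum>i\<in>UNIV. v $ i * r i b"]) auto
  qed
  obtain b1 b2 b3 where b: "B = {b1, b2, b3}" "b1 \<noteq> b2" "b1 \<noteq> b3" "b2 \<noteq> b3"
    using B(2) unfolding card_3_iff by auto
  have "\<exists>N. \<forall>b\<in>B. fls_X ^ N *s b \<in> diag_lat (\<lambda>_. - m)"
  proof -
    obtain N where "\<And>v N'. N' \<ge> N v \<Longrightarrow> fls_X ^ N' *s (v :: 'k vec3) \<in> diag_lat (\<lambda>_. - m)"
      using diag_lat_absorbs[of _ m] by metis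
    then show ?thesis using fin by (intro exI[of _ "Max (N ` B)"]) auto
  qed
  then obtain N where N: "\<And>b. b \<in> B \<Longrightarrow> fls_X ^ N *s b \<in> diag_lat (\<lambda>_. - m)" by blast
  let ?D = "diag_lat (\<lambda>_. - m) :: 'k vec3 set"
  have mono: "?D \<subseteq> adjoin M w" if "?D \<subseteq> M" for M and w :: "'k vec3"
  proof
    fix v assume "v \<in> ?D"
    then show "v \<in> adjoin M w" unfolding adjoin_def
      by (intro CollectI exI[of _ v] exI[of _ 0]) (use that in auto)
  qed
  have "split_lattice (adjoin (adjoin (adjoin ?D b1) b2) b3)"
  proof (intro split_adjoin[of _ N] split_diag_lat)
    show "fls_X ^ N *s b1 \<in> ?D" "fls_X ^ N *s b2 \<in> adjoin ?D b1"
      "fls_X ^ N *s b3 \<in> adjoin (adjoin ?D b1) b2"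
      using N[of b1] N[of b2] N[of b3] mono[OF order_refl] mono[OF mono[OF order_refl]] b(1)
      by blast+
  qed
  also have "adjoin (adjoin (adjoin ?D b1) b2) b3 = L"
  proof (intro equalityI subsetI)
    fix v assume "v \<in> L"
    then obtain c where c: "v = (\<Sum>b\<in>B. c b *s b)" "\<forall>b\<in>B. c b \<in> int_ring" unfolding L by blast
    have "v = 0 + c b1 *s b1 + c b2 *s b2 + c b3 *s b3" using b by (simp add: c(1) add.assoc)
    moreover have "0 \<in> ?D" by (simp add: diag_lat_def)
    ultimately show "v \<in> adjoin (adjoin (adjoin ?D b1) b2) b3"
      unfolding adjoin_def using c(2) b(1) by blast
  next
    have unit: "x \<in> L" if "x \<in> B" for x
      unfolding L using that fin
      by (intro CollectI exI[of _ "\<lambda>b. if b = x then 1 else 0"])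
        (simp add: if_distrib[of "\<lambda>c. c *s _"] cong: if_cong)
    fix v assume "v \<in> adjoin (adjoin (adjoin ?D b1) b2) b3"
    then show "v \<in> L"
      using sub unit b(1) unfolding adjoin_def by (auto intro!: lat_module_add[OF mod] lat_module_smult[OF mod])
  qed
  finally show ?thesis .
qed

lemma scale_eq_image_mat: "scale a L = (*v) (mat a) ` (L :: 'k::field vec3 set)"
proof -
  have "mat a *v v = a *s v" for v :: "'k vec3"
    by (simp add: vec_eq_iff matrix_vector_mult_def mat_def if_distrib[of "\<lambda>x. x * _"] cong: if_cong)
  then show ?thesis by (simp add: scale_def)
qed

lemma scale_diag_lat:
  assumes a: "a \<noteq> 0"
  shows "scale a (diag_lat n) = (diag_lat (\<lambda>i. n i - fls_subdegree a) :: 'k::field vec3 set)"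
proof -
  have *: "scale b (diag_lat n) \<subseteq> (diag_lat (\<lambda>i. n i - fls_subdegree b) :: 'k vec3 set)" for b n
  proof (clarsimp simp: scale_def diag_lat_def)
    fix v :: "'k vec3" and i k
    assume "\<forall>i k. k < - n i \<longrightarrow> v $ i $$ k = 0" "k < fls_subdegree b - n i"
    then show "(b * v $ i) $$ k = 0" by (intro fls_mult_nth_below[of "fls_subdegree b" b "- n i"]) auto
  qed
  have "scale (inverse a) (diag_lat (\<lambda>i. n i - fls_subdegree a)) \<subseteq> (diag_lat n :: 'k vec3 set)"
    using *[of "inverse a" "\<lambda>i. n i - fls_subdegree a"] by simp
  then have "scale a (scale (inverse a) (diag_lat (\<lambda>i. n i - fls_subdegree a))) \<subseteq> (scale a (diag_lat n) :: 'k vec3 set)"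
    by (rule iffD2[OF scale_mono_iff[OF a]])
  then show ?thesis using * a by (simp add: subset_antisym)
qed

section \<open>Inclusions and indices\<close>

lemma diag_lat_subset_iff: "diag_lat n \<subseteq> (diag_lat n' :: 'k::field vec3 set) \<longleftrightarrow> (\<forall>i. n i \<le> n' i)"
proof
  assume sub: "diag_lat n \<subseteq> (diag_lat n' :: 'k vec3 set)"
  show "\<forall>i. n i \<le> n' i"
  proof (rule ccontr)
    assume "\<not> ?thesis"
    then obtain i where i: "n' i < n i" by (auto simp: not_le)
    have "axis i (tpow (n i)) \<in> (diag_lat n :: 'k vec3 set)" by (auto simp: diag_lat_def axis_def)
    then have "axis i (tpow (n i)) \<in> (diag_lat n' :: 'k vec3 set)" using sub by blast
    then have "\<forall>k < - n' i. (axis i (tpow (n i)) :: 'k vec3) $ i $$ k = 0"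
      unfolding diag_lat_def by blast
    then have "(axis i (tpow (n i)) :: 'k vec3) $ i $$ (- n i) = 0"
      by (rule allE[of _ "- n i"]) (use i in simp)
    then show False by (simp add: axis_def)
  qed
next
  assume le: "\<forall>i. n i \<le> n' i"
  show "diag_lat n \<subseteq> (diag_lat n' :: 'k vec3 set)"
  proof
    fix v :: "'k vec3" assume v: "v \<in> diag_lat n"
    have "v $ i $$ k = 0" if "k < - n' i" for i k
    proof -
      have "k < - n i" using that le[rule_format, of i] by linarith
      then show ?thesis using v by (simp add: diag_lat_def)
    qed
    then show "v \<in> diag_lat n'" by (simp add: diag_lat_def)
  qed
qed

lemma diag_lat_eq_iff: "diag_lat n = (diag_lat n' :: 'k::field vec3 set) \<longleftrightarrow> n = n'"
proof -
  have "diag_lat n = (diag_lat n' :: 'k vec3 set) \<longleftrightarrow> (\<forall>i. n i \<le> n' i) \<and> (\<forall>i. n' i \<le> n i)"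
    unfolding diag_lat_subset_iff[symmetric, where 'k = 'k] by blast
  then show ?thesis by (auto simp: fun_eq_iff intro: antisym)
qed

lemma diag_lat_strict_subset_iff:
  "diag_lat n \<subset> (diag_lat n' :: 'k::field vec3 set) \<longleftrightarrow> (\<forall>i. n i \<le> n' i) \<and> n \<noteq> n'"
  by (simp add: psubset_eq diag_lat_subset_iff diag_lat_eq_iff)

lemma card_image_eq_of_kernel:
  assumes "\<And>v w. v \<in> S \<Longrightarrow> w \<in> S \<Longrightarrow> f v = f w \<longleftrightarrow> h v = h w"
  shows "card (f ` S) = card (h ` S)"
proof (rule bij_betw_same_card)
  show "bij_betw (\<lambda>y. h (inv_into S f y)) (f ` S) (h ` S)"
  proof (rule bij_betw_imageI)
    show "inj_on (\<lambda>y. h (inv_into S f y)) (f ` S)"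
      by (rule inj_onI) (metis assms f_inv_into_f inv_into_into)
    have "h (inv_into S f (f v)) = h v" if "v \<in> S" for v
      using assms that by (metis f_inv_into_f imageI inv_into_into)
    then show "(\<lambda>y. h (inv_into S f y)) ` f ` S = h ` S" by (simp add: image_image)
  qed
qed

lemma coset_eq_iff:
  assumes "lat_module D" "0 \<in> D"
  shows "(+) v ` D = (+) w ` D \<longleftrightarrow> v - w \<in> D"
proof
  assume "(+) v ` D = (+) w ` D"
  moreover have "v \<in> (+) v ` D" using assms(2) by force
  ultimately obtain d where "d \<in> D" "v = w + d" by auto
  then show "v - w \<in> D" by simp
next
  assume vw: "v - w \<in> D"
  have "(+) v ` D \<subseteq> (+) w ` D" if "v - w \<in> D" for v w
  proof
    fix x assume "x \<in> (+) v ` D"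
    then obtain d where "d \<in> D" "x = v + d" by auto
    then have "x = w + ((v - w) + d)" "(v - w) + d \<in> D" using that assms(1) by (auto intro: lat_module_add)
    then show "x \<in> (+) w ` D" by blast
  qed
  moreover have "w - v \<in> D" using lat_module_uminus[OF assms(1) vw] by simp
  ultimately show "(+) v ` D = (+) w ` D" using vw by blast
qed

lemma zero_diag_lat: "0 \<in> diag_lat n"
  by (simp add: diag_lat_def)

text \<open>The class of a vector of \<open>t\<close> times \<open>diag_lat n\<close> modulo
  \<open>diag_lat n\<close>; cosets are counted through these classes.\<close>

definition leading :: "(3 \<Rightarrow> int) \<Rightarrow> 'k::field vec3 \<Rightarrow> 3 \<Rightarrow> 'k" where
  "leading n v = (\<lambda>i. v $ i $$ (- n i - 1))"

lemma mem_diag_lat_leading: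
  assumes "v \<in> diag_lat (\<lambda>i. n i + 1)"
  shows "v \<in> diag_lat n \<longleftrightarrow> leading n v = (\<lambda>_. 0)"
proof
  assume *: "leading n v = (\<lambda>_. 0)"
  have "v $ i $$ k = 0" if "k < - n i" for i k
  proof (cases "k = - n i - 1")
    case True
    then show ?thesis using * by (metis leading_def)
  next
    case False
    then show ?thesis using that assms by (simp add: diag_lat_def)
  qed
  then show "v \<in> diag_lat n" by (simp add: diag_lat_def)
qed (auto simp: diag_lat_def leading_def)

lemma lattice_index_leading:
  assumes "L' \<subseteq> diag_lat (\<lambda>i. n i + 1)"
  shows "lattice_index L' (diag_lat n) = card (leading n ` L')"
  unfolding lattice_index_def
proof (rule card_image_eq_of_kernel)
  fix v w assume vw: "v \<in> L'" "w \<in> L'"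
  have D: "v - w \<in> diag_lat (\<lambda>i. n i + 1)"
  proof -
    have "v \<in> diag_lat (\<lambda>i. n i + 1)" "w \<in> diag_lat (\<lambda>i. n i + 1)" using vw assms by auto
    then show ?thesis by (simp add: diag_lat_def)
  qed
  have "(+) v ` diag_lat n = (+) w ` diag_lat n \<longleftrightarrow> v - w \<in> diag_lat n"
    by (rule coset_eq_iff[OF lat_module_diag_lat zero_diag_lat])
  also have "\<dots> \<longleftrightarrow> leading n v = leading n w"
    unfolding mem_diag_lat_leading[OF D] by (auto simp: leading_def fun_eq_iff)
  finally show "(+) v ` diag_lat n = (+) w ` diag_lat n \<longleftrightarrow> leading n v = leading n w" .
qed

lemma line_ext_leading:
  "line_ext n u = {v \<in> diag_lat (\<lambda>i. n i + 1). \<exists>c. leading n v = (\<lambda>i. c * u i)}"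
  by (auto simp: line_ext_def diag_lat_def leading_def fun_eq_iff)

lemma card_line: "(u :: 3 \<Rightarrow> 'k::{field,finite}) i \<noteq> 0 \<Longrightarrow> card (range (\<lambda>c i. c * u i)) = CARD('k)"
  by (rule card_image) (auto simp: inj_def fun_eq_iff)

text \<open>There are exactly q leading vectors, and with one nonzero vector all its q multiples
  occur, so they form a line.\<close>

lemma index_extension:
  fixes L' :: "'k::{field,finite} vec3 set"
  assumes mod: "lat_module L'" and sub: "diag_lat n \<subseteq> L'" "L' \<subseteq> diag_lat (\<lambda>i. n i + 1)"
    and index: "lattice_index L' (diag_lat n) = CARD('k)"
  shows "\<exists>u. (\<exists>i. u i \<noteq> 0) \<and> L' = line_ext n u"
proof -
  have card: "card (leading n ` L') = CARD('k)"
    using index lattice_index_leading[OF sub(2)] by simp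
  have "CARD('k) > 1"
  proof -
    have "card {0, 1 :: 'k} \<le> CARD('k)" by (rule card_mono) auto
    then show ?thesis by simp
  qed
  then have "\<not> leading n ` L' \<subseteq> {\<lambda>_. 0}"
    using card card_mono[of "{\<lambda>_. 0}" "leading n ` L'"] by force
  then obtain w where w: "w \<in> L'" "leading n w \<noteq> (\<lambda>_. 0)" by blast
  define u where "u = leading n w"
  obtain i where i: "u i \<noteq> 0" using w by (auto simp: u_def)
  have lead_w: "leading n (fls_const c *s w) = (\<lambda>i. c * u i)" for c
    by (simp add: leading_def u_def)
  have "range (\<lambda>c i. c * u i) \<subseteq> leading n ` L'"
  proof safe
    fix c
    have "fls_const c *s w \<in> L'" using w by (intro lat_module_smult[OF mod]) auto
    then show "(\<lambda>i. c * u i) \<in> leading n ` L'" unfolding lead_w[symmetric] by blast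
  qed
  then have eq: "range (\<lambda>c i. c * u i) = leading n ` L'"
    using card card_line[of u i] i by (intro card_subset_eq) (auto intro: card_ge_0_finite)
  have "L' = line_ext n u"
  proof (intro equalityI subsetI)
    fix v assume "v \<in> L'"
    then show "v \<in> line_ext n u" using sub(2) eq by (auto simp: line_ext_leading)
  next
    fix v assume "v \<in> line_ext n u"
    then obtain c where v: "v \<in> diag_lat (\<lambda>i. n i + 1)" "leading n v = (\<lambda>i. c * u i)"
      by (auto simp: line_ext_leading)
    have cw: "fls_const c *s w \<in> L'" using w by (intro lat_module_smult[OF mod]) auto
    then have "v - fls_const c *s w \<in> diag_lat (\<lambda>i. n i + 1)"
      using v(1) subsetD[OF sub(2) cw] by (simp add: diag_lat_def)
    moreover have "leading n (v - fls_const c *s w) = (\<lambda>_. 0)"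
      using v(2) by (simp add: leading_def u_def fun_eq_iff)
    ultimately have "v - fls_const c *s w \<in> L'" using sub(1) by (auto simp: mem_diag_lat_leading)
    then have "(v - fls_const c *s w) + fls_const c *s w \<in> L'" using cw by (rule lat_module_add[OF mod])
    then show "v \<in> L'" by simp
  qed
  then show ?thesis using i by blast
qed

lemma index_diag_step:
  "lattice_index (diag_lat (n(i := n i + 1))) (diag_lat n :: 'k::{field,finite} vec3 set) = CARD('k)"
proof -
  have sub: "diag_lat (n(i := n i + 1)) \<subseteq> (diag_lat (\<lambda>i. n i + 1) :: 'k vec3 set)"
    by (auto simp: diag_lat_subset_iff)
  have "leading n ` (diag_lat (n(i := n i + 1)) :: 'k vec3 set) = range (\<lambda>c k. c * (if k = i then 1 else 0))"
  proof (intro equalityI subsetI)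
    fix f assume "f \<in> leading n ` (diag_lat (n(i := n i + 1)) :: 'k vec3 set)"
    then obtain v :: "'k vec3" where v: "v \<in> diag_lat (n(i := n i + 1))" "f = leading n v" by blast
    then have "f k = f i * (if k = i then 1 else 0)" for k by (auto simp: leading_def diag_lat_def)
    then show "f \<in> range (\<lambda>c k. c * (if k = i then 1 else 0))" by (intro range_eqI[of _ _ "f i"] ext)
  next
    fix f assume "f \<in> range (\<lambda>(c :: 'k) k. c * (if k = i then 1 else 0))"
    then obtain c :: 'k where c: "f = (\<lambda>k. c * (if k = i then 1 else 0))" by blast
    have "axis i (fls_const c * tpow (n i + 1)) \<in> (diag_lat (n(i := n i + 1)) :: 'k vec3 set)"
      by (auto simp: diag_lat_def axis_def)
    moreover have "leading n (axis i (fls_const c * tpow (n i + 1))) = f"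
      by (auto simp: leading_def axis_def c fun_eq_iff)
    ultimately show "f \<in> leading n ` (diag_lat (n(i := n i + 1)) :: 'k vec3 set)" by blast
  qed
  then show ?thesis
    unfolding lattice_index_leading[OF sub] using card_line[of "\<lambda>k. if k = i then (1 :: 'k) else 0" i] by simp
qed

lemma lattice_index_image:
  fixes g :: "'k::field mat3"
  assumes "h ** g = mat 1"
  shows "lattice_index ((*v) g ` A) ((*v) g ` B) = lattice_index A B"
proof -
  have inj: "inj ((*v) g)" using assms by (rule inj_mult_vec)
  have "(+) (g *v v) ` (*v) g ` B = (*v) g ` (+) v ` B" for v
    by (simp add: image_image matrix_vector_right_distrib)
  then have "(\<lambda>v. (+) v ` (*v) g ` B) ` (*v) g ` A = (`) ((*v) g) ` (\<lambda>v. (+) v ` B) ` A"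
    by (simp add: image_image)
  moreover have "inj ((`) ((*v) g))" using inj by (intro injI) (simp add: inj_image_eq_iff)
  ultimately show ?thesis unfolding lattice_index_def by (simp add: card_image inj_on_subset)
qed

lemma lattice_index_scale: "a \<noteq> 0 \<Longrightarrow> lattice_index (scale a A) (scale a B) = lattice_index A (B :: 'k::field vec3 set)"
  unfolding scale_eq_image_mat by (rule lattice_index_image[of "mat (inverse a)"]) (simp add: mat_mult_mat)

section \<open>Uniqueness of the exponents\<close>

lemma GLpoly_diag_lat_le:
  fixes g :: "'k::field mat3"
  assumes g: "g \<in> GLpoly" and sub: "(*v) g ` diag_lat n \<subseteq> diag_lat n'"
  shows "\<exists>p. p permutes UNIV \<and> (\<forall>i. n (p i) \<le> n' i)"
proof -
  \<comment> \<open>A nonzero polynomial has degree at least 0 in \<open>t\<close>, so its product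
    with \<open>t\<close> to the power \<open>n j\<close> has degree at least \<open>n j\<close>,
    whereas membership in \<open>diag_lat n'\<close> bounds the degree by
    \<open>n' i\<close>.\<close>
  have entry: "n j \<le> n' i" if "g $ i $ j \<noteq> 0" for i j
  proof (rule ccontr)
    assume lt: "\<not> ?thesis"
    have "axis j (tpow (n j)) \<in> (diag_lat n :: 'k vec3 set)" by (auto simp: diag_lat_def axis_def)
    then have "g *v axis j (tpow (n j)) \<in> diag_lat n'" using sub by blast
    moreover have "(g *v axis j (tpow (n j))) $ i = tpow (n j) * g $ i $ j"
      by (simp add: matrix_vector_mult_def axis_def if_distrib[of "(*) _"] mult.commute cong: if_cong)
    ultimately have 0: "(tpow (n j) * g $ i $ j) $$ k = 0" if "k < - n' i" for k
      using that unfolding diag_lat_def by (metis (mono_tags, lifting) mem_Collect_eq)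
    have "g $ i $ j $$ k = 0" if "k < n j - n' i" for k
      using 0[of "k - n j"] that by (simp add: nth_tpow_mult)
    moreover have "g $ i $ j $$ k = 0" if "k > 0" for k
      using g that by (simp add: GLpoly_iff poly_ring_iff)
    ultimately have "g $ i $ j $$ k = 0" for k using lt by (cases "k > 0") auto
    then have "g $ i $ j = 0" by (intro fls_eqI) simp
    then show False using that by simp
  qed
  have "det g \<noteq> 0"
  proof -
    obtain h where "g ** h = mat 1" "h ** g = mat 1" using g by (rule GLpoly_inverse)
    then have "invertible g" unfolding invertible_def by blast
    then show ?thesis by (simp add: invertible_det_nz)
  qed
  \<comment> \<open>A nonzero term of the Leibniz formula selects a nonzero entry in every row and
    column.\<close>
  then obtain p where "p permutes (UNIV :: 3 set)" "(\<Prod>i\<in>UNIV. g $ i $ p i) \<noteq> 0"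
    unfolding det_def using sum.not_neutral_contains_not_neutral by force
  then show ?thesis using entry by auto
qed

text \<open>The inequalities for \<open>g\<close> and for its inverse bound the sum of the exponents
  from both sides, so they are equalities. The test function \<open>\<phi>\<close> expresses that
  the multisets of exponents agree without naming a permutation.\<close>

lemma GLpoly_diag_lat_eq:
  fixes g :: "'k::field mat3" and \<phi> :: "int \<Rightarrow> int"
  assumes g: "g \<in> GLpoly" and eq: "(*v) g ` diag_lat n = diag_lat n'"
  shows "(\<Sum>i\<in>UNIV. \<phi> (n i)) = (\<Sum>i\<in>UNIV. \<phi> (n' i))"
proof -
  obtain h where h: "h \<in> GLpoly" "h ** g = mat 1" using g by (rule GLpoly_inverse)
  have eq': "(*v) h ` diag_lat n' = diag_lat n"
    unfolding eq[symmetric] by (simp add: invertible_image_image h)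
  obtain p where p: "p permutes UNIV" "\<And>i. n (p i) \<le> n' i"
    using GLpoly_diag_lat_le[OF g, of n n'] eq by blast
  obtain r where r: "r permutes UNIV" "\<And>i. n' (r i) \<le> n i"
    using GLpoly_diag_lat_le[OF h(1), of n' n] eq' by blast
  have sp: "(\<Sum>i\<in>UNIV. f (n (p i))) = (\<Sum>i\<in>UNIV. f (n i))" for f :: "int \<Rightarrow> int"
    using sum.permute[OF p(1), of "\<lambda>i. f (n i)"] by (simp add: comp_def)
  have sr: "(\<Sum>i\<in>UNIV. n' (r i)) = (\<Sum>i\<in>UNIV. n' i)"
    using sum.permute[OF r(1), of n'] by (simp add: comp_def)
  have "(\<Sum>i\<in>UNIV. n' i) \<le> (\<Sum>i\<in>UNIV. n i)" using sum_mono[of UNIV "\<lambda>i. n' (r i)" n] r(2) sr by simp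
  then have "(\<Sum>i\<in>UNIV. n' i - n (p i)) \<le> 0" using sp[of "\<lambda>x. x"] by (simp add: sum_subtractf)
  moreover have "(\<Sum>i\<in>UNIV. n' i - n (p i)) \<ge> 0" using p(2) by (intro sum_nonneg) simp
  ultimately have "\<forall>i\<in>UNIV. n' i - n (p i) = 0"
    using p(2) by (subst sum_nonneg_eq_0_iff[symmetric]) auto
  then have "n' i = n (p i)" for i by simp
  then show ?thesis using sp[of \<phi>] by simp
qed

section \<open>The action of polynomial matrices on vertices and edges\<close>

definition vertex_map :: "'k::field mat3 \<Rightarrow> 'k vertex \<Rightarrow> 'k vertex" where
  "vertex_map g x = (\<lambda>L. (*v) g ` L) ` x"

definition edge_map :: "'k::field mat3 \<Rightarrow> 'k edge \<Rightarrow> 'k edge" where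
  "edge_map g = map_prod (vertex_map g) (vertex_map g)"

lemma vertex_map_hclass: "vertex_map g (hclass L) = hclass ((*v) g ` L)"
  by (simp add: vertex_map_def hclass_def setcompr_eq_image image_image image_scale)

lemma vertex_map_vertex_map: "vertex_map g (vertex_map h x) = vertex_map (g ** h) x"
  by (simp add: vertex_map_def image_image matrix_vector_mul_assoc)

lemma edge_map_edge_map: "edge_map g (edge_map h d) = edge_map (g ** h) d"
  by (cases d) (simp add: edge_map_def vertex_map_vertex_map)

lemma vertex_map_one: "vertex_map (mat 1) x = x"
  by (simp add: vertex_map_def)

lemma edge_map_one: "edge_map (mat 1) d = d"
  by (cases d) (simp add: edge_map_def vertex_map_one)

lemma vertex_map_vertices: "h ** g = mat 1 \<Longrightarrow> x \<in> vertices \<Longrightarrow> vertex_map g x \<in> vertices"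
  unfolding vertices_def by (auto simp: vertex_map_hclass intro: lattice_image)

lemma image_strict_mono_iff: "inj f \<Longrightarrow> f ` A \<subset> f ` B \<longleftrightarrow> A \<subset> B"
  by (simp add: psubset_eq inj_image_subset_iff inj_image_eq_iff)

lemma chamber_vertex_map:
  assumes "h ** g = mat 1" "chamber S"
  shows "chamber (vertex_map g ` S)"
proof -
  obtain x y z L1 L2 L3 where xyz: "x \<in> vertices" "y \<in> vertices" "z \<in> vertices" "S = {x, y, z}"
    and L: "L1 \<in> x" "L2 \<in> y" "L3 \<in> z" "scale fls_X L1 \<subset> L3" "L3 \<subset> L2" "L2 \<subset> L1"
    using assms(2) unfolding chamber_def by blast
  have "scale fls_X ((*v) g ` L1) \<subset> (*v) g ` L3" "(*v) g ` L3 \<subset> (*v) g ` L2" "(*v) g ` L2 \<subset> (*v) g ` L1"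
    using L inj_mult_vec[OF assms(1)] by (simp_all add: image_strict_mono_iff flip: image_scale)
  note incl = this
  have mem: "(*v) g ` L1 \<in> vertex_map g x" "(*v) g ` L2 \<in> vertex_map g y" "(*v) g ` L3 \<in> vertex_map g z"
    unfolding vertex_map_def by (rule imageI[OF L(1)] imageI[OF L(2)] imageI[OF L(3)])+
  show ?thesis
    unfolding chamber_def xyz(4) image_insert image_empty
    by (rule bexI[of _ "vertex_map g x"], rule bexI[of _ "vertex_map g y"], rule bexI[of _ "vertex_map g z"],
        rule conjI, rule refl, rule bexI[OF _ mem(1)], rule bexI[OF _ mem(2)], rule bexI[OF _ mem(3)])
      (simp_all add: incl vertex_map_vertices[OF assms(1)] xyz(1-3))
qed

lemma type1_edge_map:
  assumes hg: "h ** g = mat 1" and d: "d \<in> type1_edges"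
  shows "edge_map g d \<in> type1_edges"
proof -
  obtain x y where d_eq: "d = (x, y)" by (cases d)
  obtain S L L' where *: "x \<noteq> y" "chamber S" "x \<in> S" "y \<in> S" "L \<in> x" "L' \<in> y" "scale fls_X L' \<subseteq> L" "L \<subseteq> L'"
     "lattice_index L' L = CARD('a)"
    using d unfolding d_eq type1_edges_def directed_edges_def by blast
  have "vertex_map g x \<noteq> vertex_map g y"
    using *(1) vertex_map_vertex_map[of h g] hg by (metis vertex_map_one)
  then have "(vertex_map g x, vertex_map g y) \<in> directed_edges"
    using chamber_vertex_map[OF hg *(2)] *(3,4) by (auto simp: directed_edges_def)
  moreover have "(*v) g ` L \<in> vertex_map g x" "(*v) g ` L' \<in> vertex_map g y"
    unfolding vertex_map_def by (rule imageI[OF *(5)] imageI[OF *(6)])+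
  moreover have "scale fls_X ((*v) g ` L') \<subseteq> (*v) g ` L" "(*v) g ` L \<subseteq> (*v) g ` L'"
    using * unfolding image_scale[symmetric] by blast+
  moreover have "lattice_index ((*v) g ` L') ((*v) g ` L) = CARD('a)"
    using * by (simp add: lattice_index_image[OF hg])
  ultimately show ?thesis unfolding d_eq edge_map_def type1_edges_def by auto
qed

lemma geodesic_edge_map:
  assumes hg: "h ** g = mat 1" "g ** h = mat 1" and "geodesic d d'"
  shows "geodesic (edge_map g d) (edge_map g d')"
proof -
  have "{fst (edge_map g d), snd (edge_map g d), snd (edge_map g d')} = vertex_map g ` {fst d, snd d, snd d'}"
    by (auto simp: edge_map_def)
  moreover have "chamber {fst d, snd d, snd d'}" if "chamber (vertex_map g ` {fst d, snd d, snd d'})"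
    using chamber_vertex_map[OF hg(2) that] by (simp add: image_image vertex_map_vertex_map hg vertex_map_one)
  ultimately show ?thesis
    using assms(3) type1_edge_map[OF hg(1)] unfolding geodesic_def by (auto simp: edge_map_def)
qed

definition edge_orbit :: "'k::field edge \<Rightarrow> 'k edge set" where
  "edge_orbit d = (\<lambda>g. edge_map g d) ` GLpoly"

lemma self_edge_orbit: "d \<in> edge_orbit d"
  unfolding edge_orbit_def by (rule image_eqI[of _ _ "mat 1"]) (simp_all add: edge_map_one GLpoly_one)

lemma edge_orbit_map: "g \<in> GLpoly \<Longrightarrow> edge_orbit (edge_map g d) = edge_orbit d"
proof -
  have *: "edge_orbit (edge_map g d) \<subseteq> edge_orbit d" if "g \<in> GLpoly" for g :: "'a mat3" and d
    using that by (auto simp: edge_orbit_def edge_map_edge_map intro: GLpoly_mult)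
  assume g: "g \<in> GLpoly"
  then obtain h where h: "h \<in> GLpoly" "h ** g = mat 1" by (rule GLpoly_inverse)
  have "edge_orbit (edge_map h (edge_map g d)) \<subseteq> edge_orbit (edge_map g d)" using h by (intro *)
  then have "edge_orbit d \<subseteq> edge_orbit (edge_map g d)" using h by (simp add: edge_map_edge_map edge_map_one)
  then show "edge_orbit (edge_map g d) = edge_orbit d" using *[OF g] by (rule subset_antisym[rotated])
qed

lemma edge_orbit_eqI: "d' \<in> edge_orbit d \<Longrightarrow> edge_orbit d' = edge_orbit d"
proof -
  assume "d' \<in> edge_orbit d"
  then obtain g where "g \<in> GLpoly" "d' = edge_map g d" unfolding edge_orbit_def by blast
  then show ?thesis by (simp add: edge_orbit_map)
qed

text \<open>A vertex is stable under nonzero scalars, so a coset of the scalar matrices acts like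
  any single matrix in it.\<close>

lemma act_vertex_coset:
  assumes "x \<in> vertices"
  shows "act_vertex (scalar_mats #>\<^bsub>GL3 UNIV\<^esub> g) x = vertex_map g x"
proof -
  obtain L where x: "x = hclass L" using assms by (auto simp: vertices_def)
  have coset: "scalar_mats #>\<^bsub>GL3 UNIV\<^esub> g = {mat a ** g | a. a \<noteq> 0}"
    by (auto simp: r_coset_def scalar_mats_def GL3_def)
  have "act_vertex (scalar_mats #>\<^bsub>GL3 UNIV\<^esub> g) x = {scale a ((*v) g ` L') | a L'. a \<noteq> 0 \<and> L' \<in> x}"
    unfolding act_vertex_def coset scale_eq_image_mat
    by (auto simp: invertible_image_image)
  also have "\<dots> = vertex_map g x"
  proof (intro equalityI subsetI)
    fix M assume "M \<in> {scale a ((*v) g ` L') | a L'. a \<noteq> 0 \<and> L' \<in> x}"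
    then obtain a L' where "M = (*v) g ` scale a L'" "a \<noteq> 0" "L' \<in> x" by (auto simp: image_scale)
    moreover have "scale a L' \<in> x" if aL: "a \<noteq> 0" "L' \<in> x" for a L'
    proof -
      obtain b where "b \<noteq> 0" "L' = scale b L" using aL(2) unfolding x mem_hclass by blast
      then show ?thesis unfolding x mem_hclass using aL(1)
        by (intro exI[of _ "a * b"]) (simp add: scale_scale)
    qed
    ultimately show "M \<in> vertex_map g x" by (auto simp: vertex_map_def)
  next
    fix M assume "M \<in> vertex_map g x"
    then obtain L' where "M = scale 1 ((*v) g ` L')" "L' \<in> x" by (auto simp: vertex_map_def)
    then show "M \<in> {scale a ((*v) g ` L') | a L'. a \<noteq> 0 \<and> L' \<in> x}"
      by (intro CollectI exI[of _ 1] exI[of _ L']) auto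
  qed
  finally show ?thesis .
qed

lemma type1_vertices: "(x, y) \<in> type1_edges \<Longrightarrow> x \<in> vertices \<and> y \<in> vertices"
  unfolding type1_edges_def directed_edges_def chamber_def by blast

lemma quot_edges_PGL3_poly: "quot_edges (PGL3_poly :: 'k::{field,finite} mat3 set monoid) = edge_orbit ` type1_edges"
proof -
  have "orbit (PGL3_poly :: 'k mat3 set monoid) act_edge d = edge_orbit d" if "d \<in> type1_edges" for d
  proof -
    obtain x y where d: "d = (x, y)" by (cases d)
    have "orbit (PGL3_poly :: 'k mat3 set monoid) act_edge d =
        (\<lambda>g. act_edge (scalar_mats #>\<^bsub>GL3 UNIV\<^esub> g) d) ` GLpoly"
      by (auto simp: orbit_def PGL3_poly_def GLpoly_def)
    also have "\<dots> = edge_orbit d"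
      unfolding edge_orbit_def using type1_vertices[of x y] that
      by (intro image_cong refl) (simp add: d act_edge_def edge_map_def act_vertex_coset)
    finally show ?thesis .
  qed
  then show ?thesis unfolding quot_edges_def orbits_def Setcompr_eq_image by (rule image_cong[OF refl])
qed

section \<open>Edges and their orbits\<close>

lemma lattice_scale: "a \<noteq> 0 \<Longrightarrow> lattice L \<Longrightarrow> lattice (scale a L)"
  unfolding scale_eq_image_mat by (rule lattice_image[of "mat (inverse a)"]) (simp_all add: mat_mult_mat)

lemma lattice_of_vertex: "x \<in> vertices \<Longrightarrow> L \<in> x \<Longrightarrow> lattice L \<and> x = hclass L"
proof -
  assume "x \<in> vertices" "L \<in> x"
  then obtain M a where M: "lattice M" "x = hclass M" "a \<noteq> 0" "L = scale a M"
    by (auto simp: vertices_def mem_hclass)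
  then show ?thesis using lattice_scale[OF M(3,1)] hclass_scale[OF M(3), of M] by simp
qed

section \<open>Chambers as chains of lattices\<close>

definition lattice_chain :: "'k::field vec3 set \<Rightarrow> 'k vec3 set \<Rightarrow> 'k vec3 set \<Rightarrow> bool" where
  "lattice_chain L1 L2 L3 \<longleftrightarrow> lattice L1 \<and> lattice L2 \<and> lattice L3 \<and>
    scale fls_X L1 \<subset> L3 \<and> L3 \<subset> L2 \<and> L2 \<subset> L1"

lemma chamber_iff_chain:
  "chamber S \<longleftrightarrow> (\<exists>L1 L2 L3. lattice_chain L1 L2 L3 \<and> S = {hclass L1, hclass L2, hclass L3})"
proof
  assume "chamber S"
  then obtain x y z L1 L2 L3 where "x \<in> vertices" "y \<in> vertices" "z \<in> vertices" "S = {x, y, z}"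
    "L1 \<in> x" "L2 \<in> y" "L3 \<in> z" "scale fls_X L1 \<subset> L3" "L3 \<subset> L2" "L2 \<subset> L1"
    unfolding chamber_def by blast
  then show "\<exists>L1 L2 L3. lattice_chain L1 L2 L3 \<and> S = {hclass L1, hclass L2, hclass L3}"
    using lattice_of_vertex[of x L1] lattice_of_vertex[of y L2] lattice_of_vertex[of z L3]
    by (intro exI[of _ L1] exI[of _ L2] exI[of _ L3]) (auto simp: lattice_chain_def)
next
  assume "\<exists>L1 L2 L3. lattice_chain L1 L2 L3 \<and> S = {hclass L1, hclass L2, hclass L3}"
  then obtain L1 L2 L3 where L: "lattice_chain L1 L2 L3" and S: "S = {hclass L1, hclass L2, hclass L3}" by blast
  have v: "hclass L1 \<in> vertices" "hclass L2 \<in> vertices" "hclass L3 \<in> vertices"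
    using L by (auto simp: lattice_chain_def vertices_def)
  show "chamber S"
    unfolding chamber_def
    by (rule bexI[OF _ v(1)], rule bexI[OF _ v(2)], rule bexI[OF _ v(3)], rule conjI, rule S,
        rule bexI[OF _ self_hclass], rule bexI[OF _ self_hclass], rule bexI[OF _ self_hclass])
      (use L in \<open>auto simp: lattice_chain_def\<close>)
qed

lemma chain_rotate:
  assumes "lattice_chain L1 L2 L3"
  shows "lattice_chain L2 L3 (scale fls_X L1)" "lattice_chain (scale (inverse fls_X) L3) L1 L2"
proof -
  have "scale (inverse fls_X) (scale fls_X L1) \<subset> scale (inverse fls_X) L3"
    using assms by (intro iffD2[OF scale_strict_mono_iff]) (simp_all add: lattice_chain_def)
  then have "L1 \<subset> scale (inverse fls_X) L3" by simp
  then show "lattice_chain (scale (inverse fls_X) L3) L1 L2"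
    using assms by (simp add: lattice_chain_def lattice_scale)
  show "lattice_chain L2 L3 (scale fls_X L1)"
    using assms by (simp add: lattice_chain_def lattice_scale scale_strict_mono_iff)
qed

lemma chain_scale: "a \<noteq> 0 \<Longrightarrow> lattice_chain L1 L2 L3 \<Longrightarrow> lattice_chain (scale a L1) (scale a L2) (scale a L3)"
  unfolding lattice_chain_def scale_commute[of fls_X a]
  by (simp add: lattice_scale scale_strict_mono_iff)

lemma chain_distinct:
  assumes "lattice_chain L1 L2 L3"
  shows "hclass L1 \<noteq> hclass L2"
proof
  assume "hclass L1 = hclass L2"
  then have "L2 \<in> hclass L1" by simp
  then obtain a where a: "a \<noteq> 0" "L2 = scale a L1" unfolding mem_hclass by blast
  have L: "lat_module L1" "scale fls_X L1 \<subset> L2" "L2 \<subset> L1"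
    using assms by (auto simp: lattice_chain_def lattice_module)
  show False using between_not_homothetic[OF L a(1)] a(2) by blast
qed

text \<open>Chains may be rotated cyclically and rescaled, which puts any vertex, with any of its
  representatives, in the middle. The set \<open>{x, y, z}\<close> forgets the order of the other
  two vertices, hence the disjunction.\<close>

lemma chamber_middle:
  assumes "chamber {x, y, z}" "A \<in> y"
  shows "\<exists>L1 L3. lattice_chain L1 A L3 \<and>
    (hclass L1 = x \<and> hclass L3 = z \<or> hclass L1 = z \<and> hclass L3 = x)"
proof -
  obtain M1 M2 M3 where M: "lattice_chain M1 M2 M3" "{x, y, z} = {hclass M1, hclass M2, hclass M3}"
    using assms(1) unfolding chamber_iff_chain by (elim exE conjE)
  have "\<exists>L1 L2 L3. lattice_chain L1 L2 L3 \<and> {x, y, z} = {hclass L1, hclass L2, hclass L3} \<and> y = hclass L2"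
  proof -
    have "y \<in> {hclass M1, hclass M2, hclass M3}" unfolding M(2)[symmetric] by simp
    then consider "y = hclass M1" | "y = hclass M2" | "y = hclass M3" by auto
    then show ?thesis
    proof cases
      case 1
      show ?thesis
        by (rule exI[of _ "scale (inverse fls_X) M3"], rule exI[of _ M1], rule exI[of _ M2])
          (unfold M(2), simp add: chain_rotate(2)[OF M(1)] 1 hclass_scale insert_commute)
    next
      case 2
      then show ?thesis using M by (intro exI conjI)
    next
      case 3
      show ?thesis
        by (rule exI[of _ M2], rule exI[of _ M3], rule exI[of _ "scale fls_X M1"])
          (unfold M(2), simp add: chain_rotate(1)[OF M(1)] 3 hclass_scale insert_commute)
    qed
  qed
  then obtain L1 L2 L3 where L: "lattice_chain L1 L2 L3" "{x, y, z} = {hclass L1, hclass L2, hclass L3}" "y = hclass L2"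
    by (elim exE conjE)
  have ne: "hclass L1 \<noteq> hclass L2" "hclass L2 \<noteq> hclass L3" "hclass L3 \<noteq> hclass L1"
    using chain_distinct[OF L(1)] chain_distinct[OF chain_rotate(1)[OF L(1)]]
      chain_distinct[OF chain_rotate(2)[OF L(1)]] by (simp_all add: hclass_scale)
  obtain a where a: "a \<noteq> 0" "A = scale a L2" using assms(2) L(3) by (auto simp: mem_hclass)
  have "lattice_chain (scale a L1) A (scale a L3)" unfolding a(2) by (rule chain_scale[OF a(1) L(1)])
  moreover have "hclass L1 = x \<and> hclass L3 = z \<or> hclass L1 = z \<and> hclass L3 = x"
  proof -
    have "hclass L1 \<in> {x, y, z}" "hclass L3 \<in> {x, y, z}" unfolding L(2) by auto
    then show ?thesis using ne L(3) by auto
  qed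
  ultimately show ?thesis using a(1) by (metis hclass_scale)
qed

definition triple :: "'a \<Rightarrow> 'a \<Rightarrow> 'a \<Rightarrow> 3 \<Rightarrow> 'a" where
  "triple a b c = (\<lambda>i. if i = 1 then a else if i = 2 then b else c)"

lemma triple_simps [simp]: "triple a b c 1 = a" "triple a b c 2 = b" "triple a b c 3 = c"
  by (simp_all add: triple_def)

lemma triple_eq_iff: "f = triple a b c \<longleftrightarrow> f 1 = a \<and> f 2 = b \<and> f 3 = c"
  by (auto simp: fun_eq_iff forall_3)

lemma triple_update:
  "(triple a b c)(1 := d) = triple d b c" "(triple a b c)(2 := d) = triple a d c" "(triple a b c)(3 := d) = triple a b d"
  by (simp_all add: triple_eq_iff)

lemma other_coordinates: "\<exists>j k :: 3. j \<noteq> i \<and> k \<noteq> i \<and> k \<noteq> j"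
proof -
  consider "i = 1" | "i = 2" | "i = 3" using exhaust_3 by blast
  then show ?thesis
  proof cases
    case 1
    then show ?thesis by (intro exI[of _ 2] exI[of _ 3]) simp
  next
    case 2
    then show ?thesis by (intro exI[of _ 1] exI[of _ 3]) simp
  next
    case 3
    then show ?thesis by (intro exI[of _ 1] exI[of _ 2]) simp
  qed
qed

section \<open>Type 1 neighbours of a diagonal lattice\<close>

lemma scale_X_diag_lat: "scale fls_X (diag_lat n) = diag_lat (\<lambda>i. n i - 1)"
  by (simp add: scale_diag_lat)

lemma line_ext_leading_vec: "\<exists>w\<in>line_ext n u. \<forall>i. w $ i $$ (- n i - 1) = u i"
  by (rule bexI[of _ "\<chi> i. fls_const (u i) * tpow (n i + 1)"])
    (auto simp: line_ext_def intro!: exI[of _ 1])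

lemma line_ext_between:
  fixes u :: "3 \<Rightarrow> 'k::field"
  assumes "u i \<noteq> 0"
  shows "diag_lat n \<subset> line_ext n u" "line_ext n u \<subset> diag_lat (\<lambda>i. n i + 1)"
proof -
  have sub: "diag_lat n \<subseteq> line_ext n u"
    unfolding line_ext_def diag_lat_def by (auto intro!: exI[of _ 0])
  obtain w where w: "w \<in> line_ext n u" "\<And>i. w $ i $$ (- n i - 1) = u i" using line_ext_leading_vec by blast
  have "w \<notin> diag_lat n"
  proof
    assume "w \<in> diag_lat n"
    then have "w $ i $$ (- n i - 1) = 0" unfolding diag_lat_def by auto
    then show False using assms by (simp add: w)
  qed
  then show "diag_lat n \<subset> line_ext n u" using sub w(1) by blast
  obtain j where j: "j \<noteq> i" using other_coordinates[of i] by metis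
  have "line_ext n u \<subseteq> diag_lat (\<lambda>i. n i + 1)" by (auto simp: line_ext_def diag_lat_def)
  moreover have "line_ext n u \<noteq> diag_lat (\<lambda>i. n i + 1)"
  proof
    assume eq: "line_ext n u = diag_lat (\<lambda>i. n i + 1)"
    have "axis j (tpow (n j + 1)) \<in> (diag_lat (\<lambda>i. n i + 1) :: 'k vec3 set)"
      by (auto simp: diag_lat_def axis_def)
    then obtain c where c: "\<And>k. (axis j (tpow (n j + 1)) :: 'k vec3) $ k $$ (- n k - 1) = c * u k"
      unfolding eq[symmetric] line_ext_def by blast
    show False using c[of j] c[of i] assms j by (auto simp: axis_def)
  qed
  ultimately show "line_ext n u \<subset> diag_lat (\<lambda>i. n i + 1)" by blast
qed

lemma line_ext_mono_imp:
  fixes u u' :: "3 \<Rightarrow> 'k::field"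
  assumes "line_ext n u \<subseteq> line_ext n u'"
  shows "\<exists>c. \<forall>i. u i = c * u' i"
proof -
  obtain w where w: "w \<in> line_ext n u" "\<And>i. w $ i $$ (- n i - 1) = u i" using line_ext_leading_vec by blast
  from w(1) obtain c where "\<forall>i. w $ i $$ (- n i - 1) = c * u' i" using assms unfolding line_ext_def by blast
  then show ?thesis by (auto simp: w(2))
qed

lemma line_ext_smult:
  fixes u :: "3 \<Rightarrow> 'k::field"
  assumes "c \<noteq> 0"
  shows "line_ext n (\<lambda>i. c * u i) = line_ext n u"
proof -
  have "(\<exists>d. \<forall>i. v $ i $$ (- n i - 1) = d * (c * u i)) \<longleftrightarrow> (\<exists>d. \<forall>i. v $ i $$ (- n i - 1) = d * u i)" for v :: "'k vec3"
  proof (intro iffI; elim exE)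
    fix d assume "\<forall>i. v $ i $$ (- n i - 1) = d * (c * u i)"
    then show "\<exists>d. \<forall>i. v $ i $$ (- n i - 1) = d * u i" by (intro exI[of _ "d * c"]) (simp add: mult.assoc)
  next
    fix d assume "\<forall>i. v $ i $$ (- n i - 1) = d * u i"
    then show "\<exists>d. \<forall>i. v $ i $$ (- n i - 1) = d * (c * u i)"
      using assms by (intro exI[of _ "d / c"]) simp
  qed
  then show ?thesis unfolding line_ext_def by simp
qed

lemma line_ext_homothetic:
  fixes u u' :: "3 \<Rightarrow> 'k::field"
  assumes "hclass (line_ext n u) = hclass (line_ext n u')" "u i \<noteq> 0" "u' j \<noteq> 0"
  shows "line_ext n u = line_ext n u'"
proof -
  have "line_ext n u \<in> hclass (line_ext n u')" unfolding assms(1)[symmetric] by simp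
  then obtain a where a: "a \<noteq> 0" "line_ext n u = scale a (line_ext n u')" unfolding mem_hclass by blast
  have "lat_module (line_ext n u')"
    using split_line_ext[of u' n] assms(3) by (intro lattice_module split_lattice_lattice) blast
  moreover have X: "scale fls_X (diag_lat (\<lambda>i. n i + 1)) = (diag_lat n :: 'k vec3 set)"
    by (simp add: scale_X_diag_lat)
  ultimately have "scale a (line_ext n u') = line_ext n u'"
    using line_ext_between[of u i n] line_ext_between[of u' j n] assms a
    by (intro between_unique[of "diag_lat (\<lambda>i. n i + 1)"] lat_module_diag_lat) (simp_all add: X)
  then show ?thesis using a by simp
qed

text \<open>Rescaling both representatives by the same scalar turns the source into
  \<open>diag_lat n\<close> itself; the target then lies between it and \<open>t\<close> times it,
  with index q.\<close>

lemma type1_from_diag_lat: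
  fixes n :: "3 \<Rightarrow> int"
  assumes "(hclass (diag_lat n), z) \<in> (type1_edges :: 'k::{field,finite} edge set)"
  shows "\<exists>u. (\<exists>i. u i \<noteq> 0) \<and> z = hclass (line_ext n u)"
proof -
  obtain L L' where L: "L \<in> hclass (diag_lat n)" "L' \<in> z" "scale fls_X L' \<subseteq> L" "L \<subseteq> L'"
     "lattice_index L' L = CARD('k)"
    using assms unfolding type1_edges_def by auto
  have z: "lattice L'" "z = hclass L'" using type1_vertices[OF assms] lattice_of_vertex[OF _ L(2)] by auto
  obtain a where a: "a \<noteq> 0" "L = scale a (diag_lat n)" using L(1) unfolding mem_hclass by blast
  define M where "M = scale (inverse a) L'"
  have L': "L' = scale a M" using a(1) by (simp add: M_def)
  have "scale a (scale fls_X M) \<subseteq> scale a (diag_lat n)"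
    using L(3) unfolding L' a(2) by (simp add: scale_commute)
  then have XM: "scale fls_X M \<subseteq> diag_lat n" using a(1) by (simp add: scale_mono_iff)
  have "scale a (diag_lat n) \<subseteq> scale a M" using L(4) unfolding L' a(2) .
  then have DM: "diag_lat n \<subseteq> M" using a(1) by (simp add: scale_mono_iff)
  have "scale fls_X M \<subseteq> scale fls_X (diag_lat (\<lambda>i. n i + 1))" using XM by (simp add: scale_X_diag_lat)
  then have "M \<subseteq> diag_lat (\<lambda>i. n i + 1)" by (simp add: scale_mono_iff)
  moreover have "lattice_index M (diag_lat n) = CARD('k)"
    using L(5) a(1) unfolding L' a(2) by (simp add: lattice_index_scale)
  moreover have "lat_module M"
    unfolding M_def using z(1) a(1) by (intro lattice_module lattice_scale) auto
  ultimately obtain u where u: "\<exists>i. u i \<noteq> 0" "M = line_ext n u"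
    using index_extension[of M n] DM by blast
  have "z = hclass M" unfolding z(2) L' using a(1) by (simp add: hclass_scale)
  then show ?thesis using u by blast
qed

lemma type1_diag_step:
  "(hclass (diag_lat n), hclass (diag_lat (n(i := n i + 1)))) \<in> (type1_edges :: 'k::{field,finite} edge set)"
proof -
  obtain j k where j: "j \<noteq> i" and k: "k \<noteq> i" "k \<noteq> j" using other_coordinates[of i] by metis
  let ?n = "n(i := n i + 1)"
  \<comment> \<open>An edge has to lie in a chamber. A second raise, at \<open>j\<close>, supplies
    the third vertex, and the untouched coordinate \<open>k\<close> makes the inclusion of
    \<open>scale fls_X\<close> of it strict.\<close>
  let ?m = "?n(j := n j + 1)"
  have ne: "n i \<noteq> ?n i" "?n j \<noteq> ?m j" "?m j - 1 = n j" using j by simp_all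
  have "lattice_chain (diag_lat ?m) (diag_lat ?n) (diag_lat n :: 'k vec3 set)"
    unfolding lattice_chain_def scale_X_diag_lat diag_lat_strict_subset_iff
    using ne k j by (auto simp: lattice_diag_lat fun_eq_iff intro!: exI[of _ k])
  note ch = this
  have "chamber {hclass (diag_lat ?m), hclass (diag_lat ?n), hclass (diag_lat n :: 'k vec3 set)}"
    unfolding chamber_iff_chain using ch by blast
  moreover have "hclass (diag_lat ?n) \<noteq> hclass (diag_lat n :: 'k vec3 set)"
    using chain_distinct[OF chain_rotate(1)[OF ch]] .
  ultimately have "(hclass (diag_lat n), hclass (diag_lat ?n)) \<in> (directed_edges :: 'k edge set)"
    unfolding directed_edges_def by auto
  moreover have "scale fls_X (diag_lat ?n) \<subseteq> (diag_lat n :: 'k vec3 set)"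
    "diag_lat n \<subseteq> (diag_lat ?n :: 'k vec3 set)"
    by (auto simp: scale_X_diag_lat diag_lat_subset_iff)
  ultimately show ?thesis
    unfolding type1_edges_def using index_diag_step[of n i, where 'k = 'k] self_hclass by blast
qed

lemma line_ext_orbit:
  fixes u :: "3 \<Rightarrow> 'k::field"
  assumes "u i \<noteq> 0" "\<And>k. u k \<noteq> 0 \<Longrightarrow> n i \<le> n k"
  shows "edge_orbit (hclass (diag_lat n), hclass (line_ext n u)) =
    edge_orbit (hclass (diag_lat n), hclass (diag_lat (n(i := n i + 1))))"
proof -
  obtain g where g: "g \<in> GLpoly" "(*v) g ` diag_lat n = (diag_lat n :: 'k vec3 set)"
    "(*v) g ` line_ext n u = diag_lat (n(i := n i + 1))" using assms by (rule pivot)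
  have "edge_map g (hclass (diag_lat n), hclass (line_ext n u)) = (hclass (diag_lat n), hclass (diag_lat (n(i := n i + 1))))"
    using g by (simp add: edge_map_def vertex_map_hclass)
  then show ?thesis using edge_orbit_map[OF g(1)] by metis
qed

lemma orbit_subset_type1: "d \<in> type1_edges \<Longrightarrow> edge_orbit d \<subseteq> type1_edges"
proof
  fix d' assume d: "d \<in> type1_edges" and "d' \<in> edge_orbit d"
  then obtain g where g: "g \<in> GLpoly" "d' = edge_map g d" unfolding edge_orbit_def by blast
  obtain h where "h ** g = mat 1" using g(1) by (rule GLpoly_inverse)
  then show "d' \<in> type1_edges" using d g(2) by (simp add: type1_edge_map)
qed

lemma type1_line_ext:
  fixes u :: "3 \<Rightarrow> 'k::{field,finite}"
  assumes "\<exists>i. u i \<noteq> 0"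
  shows "(hclass (diag_lat n), hclass (line_ext n u)) \<in> type1_edges"
proof -
  obtain i where "u i \<noteq> 0" "\<And>k. u k \<noteq> 0 \<Longrightarrow> n i \<le> n k" using obtain_pivot[OF assms, of n] by metis
  then show ?thesis
    using line_ext_orbit[of u i n] orbit_subset_type1[OF type1_diag_step[of n i]] self_edge_orbit by blast
qed

definition perm_mat :: "(3 \<Rightarrow> 3) \<Rightarrow> 'k::field mat3" where
  "perm_mat p = (\<chi> i j. if j = p i then 1 else 0)"

lemma perm_mat_mult_vec: "(perm_mat p *v v) $ i = v $ p i"
  by (simp add: perm_mat_def matrix_vector_mult_def if_distrib[of "\<lambda>x. x * _"] cong: if_cong)

lemma edge_orbit_permute:
  assumes "bij p"
  shows "edge_orbit (hclass (diag_lat m), hclass (diag_lat m')) =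
    (edge_orbit (hclass (diag_lat (m \<circ> p)), hclass (diag_lat (m' \<circ> p))) :: 'k::field edge set)"
proof -
  have mult: "perm_mat r ** perm_mat s = (mat 1 :: 'k mat3)" if "\<And>i. s (r i) = i" for r s
    using that by (simp add: matrix_eq vec_eq_iff perm_mat_mult_vec flip: matrix_vector_mul_assoc)
  have p: "inv_into UNIV p (p i) = i" "p (inv_into UNIV p i) = i" for i
    using assms by (simp_all add: bij_is_inj bij_is_surj surj_f_inv_f)
  have g: "perm_mat p \<in> (GLpoly :: 'k mat3 set)"
    unfolding GLpoly_iff
    by (intro conjI exI[of _ "perm_mat (inv_into UNIV p)"] mult p) (auto simp: perm_mat_def poly_ring_iff)
  have D: "(*v) (perm_mat p) ` diag_lat n = (diag_lat (n \<circ> p) :: 'k vec3 set)" for n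
  proof (rule image_eq_by_inverse[of _ "perm_mat (inv_into UNIV p)"])
    show "perm_mat p ** perm_mat (inv_into UNIV p) = (mat 1 :: 'k mat3)" by (rule mult) (rule p)
    show "(*v) (perm_mat p) ` diag_lat n \<subseteq> (diag_lat (n \<circ> p) :: 'k vec3 set)"
      by (auto simp: diag_lat_def perm_mat_mult_vec)
    show "(*v) (perm_mat (inv_into UNIV p)) ` diag_lat (n \<circ> p) \<subseteq> (diag_lat n :: 'k vec3 set)"
    proof safe
      fix v :: "'k vec3" assume v: "v \<in> diag_lat (n \<circ> p)"
      have "v $ inv_into UNIV p i $$ k = 0" if "k < - n i" for i k
        using v that p(2)[of i] unfolding diag_lat_def by (metis (mono_tags, lifting) comp_apply mem_Collect_eq)
      then show "perm_mat (inv_into UNIV p) *v v \<in> diag_lat n" by (simp add: diag_lat_def perm_mat_mult_vec)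
    qed
  qed
  have "edge_map (perm_mat p) (hclass (diag_lat m), hclass (diag_lat m')) =
     (hclass (diag_lat (m \<circ> p)), hclass (diag_lat (m' \<circ> p)) :: 'k vertex)"
    by (simp add: edge_map_def vertex_map_hclass D)
  then show ?thesis using edge_orbit_map[OF g] by metis
qed

text \<open>
  A state \<open>(x, y, v)\<close> with \<open>x \<le> y\<close> stands for the lattice with exponents \<open>x, y, v\<close> together
  with its sublattice of index \<open>q\<close> in which the exponent \<open>v\<close> is lowered by one.
\<close>

fun edge_of :: "gaps \<Rightarrow> 'k::field edge" where
  "edge_of (x, y, v) = (hclass (diag_lat (triple x y (v - 1))), hclass (diag_lat (triple x y v)))"

text \<open>The last component of the result is the exponent just raised; the two others are listed
  in increasing order, which in each case follows from the conditions of the branch.\<close>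

fun step :: "gaps \<Rightarrow> 'k::field \<times> 'k \<Rightarrow> gaps" where
  "step (x, y, v) (a, b) =
    (if v \<le> x then (x, y, v + 1)
     else if v \<le> y then (if a \<noteq> 0 then (v, y, x + 1) else (x, y, v + 1))
     else if a \<noteq> 0 then (y, v, x + 1)
     else if b \<noteq> 0 then (x, v, y + 1) else (x, y, v + 1))"

definition sorted_gaps :: "gaps \<Rightarrow> bool" where
  "sorted_gaps = (\<lambda>(x, y, v). x \<le> y)"

lemma sorted_step: "sorted_gaps s \<Longrightarrow> sorted_gaps (step s u)"
  by (cases s; cases u) (auto simp: sorted_gaps_def)

lemma total_step: "total (step s u) = total s + 1"
  by (cases s; cases u) auto

lemma edge_orbit_diag_step:
  assumes "j \<noteq> i" "k \<noteq> i" "k \<noteq> j"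
  shows "edge_orbit (hclass (diag_lat n), hclass (diag_lat (n(i := n i + 1)))) =
    (edge_orbit (edge_of (n j, n k, n i + 1)) :: 'k::field edge set)"
proof -
  define p where "p = triple j k i"
  have ex: "l \<in> {i, j, k}" for l
    using assms exhaust_3[of i] exhaust_3[of j] exhaust_3[of k] exhaust_3[of l] by auto
  have "surj p"
  proof (rule surjI)
    fix l show "p (if l = j then 1 else if l = k then 2 else 3) = l"
      using ex[of l] assms by (auto simp: p_def)
  qed
  then have "bij p" by (simp add: bij_def finite_UNIV_surj_inj)
  moreover have "n \<circ> p = triple (n j) (n k) (n i)" "(n(i := n i + 1)) \<circ> p = triple (n j) (n k) (n i + 1)"
    using assms by (simp_all add: triple_eq_iff p_def)
  ultimately show ?thesis using edge_orbit_permute[of p n "n(i := n i + 1)", where 'k = 'k] by simp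
qed

lemma edge_orbit_step:
  fixes a b :: "'k::field"
  assumes "x \<le> y"
  shows "edge_orbit (hclass (diag_lat (triple x y v)), hclass (line_ext (triple x y v) (triple a b 1))) =
    edge_orbit (edge_of (step (x, y, v) (a, b)))"
proof -
  let ?n = "triple x y v" and ?u = "triple a b 1"
  have pivot1: ?thesis if "a \<noteq> 0" "x < v" and s: "step (x, y, v) (a, b) = (min v y, max v y, x + 1)"
  proof -
    have "edge_orbit (hclass (diag_lat ?n), hclass (line_ext ?n ?u)) =
        edge_orbit (hclass (diag_lat ?n), hclass (diag_lat (?n(1 := ?n 1 + 1))) :: 'k vertex)"
    proof (rule line_ext_orbit)
      fix k assume "?u k \<noteq> 0"
      show "?n 1 \<le> ?n k" using assms \<open>x < v\<close> exhaust_3[of k] by auto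
    qed (use \<open>a \<noteq> 0\<close> in simp)
    also have "\<dots> = edge_orbit (edge_of (min v y, max v y, x + 1))"
    proof (cases "v \<le> y")
      case True
      then show ?thesis using edge_orbit_diag_step[of 3 1 2 ?n, where 'k = 'k] by simp
    next
      case False
      then show ?thesis using edge_orbit_diag_step[of 2 1 3 ?n, where 'k = 'k] by simp
    qed
    finally show ?thesis using s by simp
  qed
  have pivot3: ?thesis if k: "a \<noteq> 0 \<Longrightarrow> v \<le> x" "b \<noteq> 0 \<Longrightarrow> v \<le> y"
    and s: "step (x, y, v) (a, b) = (x, y, v + 1)"
  proof -
    have "edge_orbit (hclass (diag_lat ?n), hclass (line_ext ?n ?u)) =
        edge_orbit (hclass (diag_lat ?n), hclass (diag_lat (?n(3 := ?n 3 + 1))) :: 'k vertex)"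
    proof (rule line_ext_orbit)
      fix i assume "?u i \<noteq> 0"
      then show "?n 3 \<le> ?n i" using k exhaust_3[of i] by auto
    qed simp
    also have "\<dots> = edge_orbit (edge_of (x, y, v + 1))"
      using edge_orbit_diag_step[of 1 3 2 ?n, where 'k = 'k] by simp
    finally show ?thesis using s by simp
  qed
  have pivot2: ?thesis if "y < v" "a = 0" "b \<noteq> 0"
  proof -
    have "edge_orbit (hclass (diag_lat ?n), hclass (line_ext ?n ?u)) =
        edge_orbit (hclass (diag_lat ?n), hclass (diag_lat (?n(2 := ?n 2 + 1))) :: 'k vertex)"
    proof (rule line_ext_orbit)
      fix i assume "?u i \<noteq> 0"
      then show "?n 2 \<le> ?n i" using that exhaust_3[of i] by auto
    qed (use that in simp)
    also have "\<dots> = edge_orbit (edge_of (x, v, y + 1))"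
      using edge_orbit_diag_step[of 1 2 3 ?n, where 'k = 'k] by simp
    finally show ?thesis using that assms by simp
  qed
  consider "v \<le> x" | "x < v" "a \<noteq> 0" | "x < v" "v \<le> y" "a = 0" | "y < v" "a = 0" "b \<noteq> 0" | "y < v" "a = 0" "b = 0"
    using assms by linarith
  then show ?thesis
  proof cases
    case 2
    then show ?thesis using pivot1 assms by (auto simp: min_def max_def)
  qed (use pivot2 pivot3 assms in auto)
qed

lemma type1_edge_of: "edge_of s \<in> (type1_edges :: 'k::{field,finite} edge set)"
proof -
  obtain x y v where s: "s = (x, y, v)" by (cases s)
  show ?thesis using type1_diag_step[of "triple x y (v - 1)" 3, where 'k = 'k] by (simp add: s triple_update)
qed

text \<open>Splitting a representative of the source makes it diagonal, and the pivot then
  diagonalises the target without moving the source.\<close>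

lemma edge_orbit_representative:
  assumes "d \<in> (type1_edges :: 'k::{field,finite} edge set)"
  shows "\<exists>s. sorted_gaps s \<and> edge_orbit d = edge_orbit (edge_of s)"
proof -
  obtain x y where d: "d = (x, y)" by (cases d)
  obtain L where L: "lattice L" "x = hclass L"
    using type1_vertices[of x y] assms unfolding d vertices_def by auto
  obtain g n where g: "g \<in> GLpoly" "L = (*v) g ` diag_lat n"
    using lattice_split[OF L(1)] unfolding split_lattice_def by blast
  obtain h where h: "h \<in> GLpoly" "g ** h = mat 1" "h ** g = mat 1" using g(1) by (rule GLpoly_inverse)
  have hd: "edge_map h d = (hclass (diag_lat n), vertex_map h y)"
    by (simp add: d edge_map_def vertex_map_hclass L(2) g(2) invertible_image_image h)
  then have "(hclass (diag_lat n), vertex_map h y) \<in> type1_edges"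
    using type1_edge_map[OF h(2) assms] by simp
  then obtain u where u: "\<exists>i. u i \<noteq> 0" "vertex_map h y = hclass (line_ext n u)"
    using type1_from_diag_lat by blast
  obtain i where i: "u i \<noteq> 0" "\<And>k. u k \<noteq> 0 \<Longrightarrow> n i \<le> n k" using obtain_pivot[OF u(1), of n] by metis
  obtain j k where jk: "j \<noteq> i" "k \<noteq> i" "k \<noteq> j" using other_coordinates[of i] by blast
  have "edge_orbit d = edge_orbit (edge_map h d)" using edge_orbit_map[OF h(1)] by simp
  also have "\<dots> = edge_orbit (hclass (diag_lat n), hclass (diag_lat (n(i := n i + 1))))"
    unfolding hd u(2) using i by (rule line_ext_orbit)
  finally have *: "edge_orbit d = edge_orbit (hclass (diag_lat n), hclass (diag_lat (n(i := n i + 1))))" .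
  show ?thesis
  proof (cases "n j \<le> n k")
    case True
    then show ?thesis unfolding * edge_orbit_diag_step[OF jk]
      by (intro exI[of _ "(n j, n k, n i + 1)"]) (simp add: sorted_gaps_def)
  next
    case False
    then show ?thesis unfolding * edge_orbit_diag_step[OF jk(2,1) jk(3)[symmetric]]
      by (intro exI[of _ "(n k, n j, n i + 1)"]) (simp add: sorted_gaps_def)
  qed
qed

fun shift_gaps :: "int \<Rightarrow> gaps \<Rightarrow> gaps" where
  "shift_gaps k (x, y, v) = (x + k, y + k, v + k)"

lemma edge_of_shift: "edge_of (shift_gaps k s) = (edge_of s :: 'k::field edge)"
proof -
  obtain x y v where s: "s = (x, y, v)" by (cases s)
  have "hclass (diag_lat (triple (a + k) (b + k) (c + k))) = (hclass (diag_lat (triple a b c)) :: 'k vertex)" for a b c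
  proof -
    have sub: "fls_subdegree (tpow k :: 'k fls) = - k" by (rule fls_subdegree_eqI) auto
    have "scale (tpow k) (diag_lat (triple a b c)) = (diag_lat (\<lambda>i. triple a b c i - (- k)) :: 'k vec3 set)"
      by (subst scale_diag_lat) (simp_all add: sub fls_shift_eq0_iff)
    also have "(\<lambda>i. triple a b c i - (- k)) = triple (a + k) (b + k) (c + k)" by (simp add: triple_eq_iff)
    finally show ?thesis using hclass_scale[of "tpow k :: 'k fls" "diag_lat (triple a b c)"]
      by (simp add: fls_shift_eq0_iff)
  qed
  from this[of x y "v - 1"] this[of x y v] show ?thesis by (simp add: s algebra_simps)
qed

text \<open>The sum and the sum of squares determine the square of the difference, and the order
  determines its sign.\<close>

lemma sorted_pair_unique:
  fixes x y x' y' :: int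
  assumes "x \<le> y" "x' \<le> y'" "x + y = x' + y'" "x\<^sup>2 + y\<^sup>2 = x'\<^sup>2 + y'\<^sup>2"
  shows "x = x'" "y = y'"
proof -
  have "(y - x)\<^sup>2 = 2 * (x\<^sup>2 + y\<^sup>2) - (x + y)\<^sup>2" by (simp add: power2_eq_square algebra_simps)
  also have "\<dots> = (y' - x')\<^sup>2" unfolding assms(3,4) by (simp add: power2_eq_square algebra_simps)
  finally have "y - x = y' - x'" using assms(1,2) by (simp add: power2_eq_iff_nonneg)
  then show "x = x'" "y = y'" using assms(3) by linarith+
qed

lemma GLpoly_hclass_diag_lat:
  fixes g :: "'k::field mat3"
  assumes "g \<in> GLpoly" "vertex_map g (hclass (diag_lat n)) = hclass (diag_lat n')"
  obtains k where "\<And>\<phi> :: int \<Rightarrow> int. \<phi> (n 1) + \<phi> (n 2) + \<phi> (n 3) = \<phi> (n' 1 - k) + \<phi> (n' 2 - k) + \<phi> (n' 3 - k)"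
proof -
  have "(*v) g ` diag_lat n \<in> (hclass (diag_lat n') :: 'k vertex)"
    unfolding assms(2)[symmetric] vertex_map_hclass by simp
  then obtain a where a: "a \<noteq> 0" "(*v) g ` diag_lat n = scale a (diag_lat n')" unfolding mem_hclass by blast
  have "(*v) g ` diag_lat n = diag_lat (\<lambda>i. n' i - fls_subdegree a)"
    using a by (simp add: scale_diag_lat)
  from that[of "fls_subdegree a"] GLpoly_diag_lat_eq[OF assms(1) this] show ?thesis by (simp add: sum_3)
qed

text \<open>Source and target are known up to homothety only, with shifts \<open>l\<close> and
  \<open>k\<close>; comparing the sums of the exponents gives \<open>k = l\<close>. The difference
  of the sums of squares then isolates \<open>v\<close>, and the remaining pair is determined by its
  sum and its sum of squares.\<close>

lemma edge_orbit_edge_of_eq: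
  assumes sorted: "sorted_gaps s" "sorted_gaps s'"
    and eq: "edge_orbit (edge_of s) = (edge_orbit (edge_of s') :: 'k::field edge set)"
  shows "\<exists>k. s' = shift_gaps k s"
proof -
  obtain x y v x' y' v' where s: "s = (x, y, v)" "s' = (x', y', v')" by (cases s; cases s')
  have "edge_of s' \<in> (edge_orbit (edge_of s) :: 'k edge set)" unfolding eq by (rule self_edge_orbit)
  then obtain g :: "'k mat3" where g: "g \<in> GLpoly" "edge_of s' = edge_map g (edge_of s)"
    unfolding edge_orbit_def by blast
  have "vertex_map g (hclass (diag_lat (triple x y (v - 1)))) = hclass (diag_lat (triple x' y' (v' - 1)))"
    "vertex_map g (hclass (diag_lat (triple x y v))) = hclass (diag_lat (triple x' y' v'))"
    using g(2) by (simp_all add: s edge_map_def)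
  then obtain k l where
    l: "\<And>\<phi> :: int \<Rightarrow> int. \<phi> x + \<phi> y + \<phi> (v - 1) = \<phi> (x' - l) + \<phi> (y' - l) + \<phi> (v' - 1 - l)" and
    k: "\<And>\<phi> :: int \<Rightarrow> int. \<phi> x + \<phi> y + \<phi> v = \<phi> (x' - k) + \<phi> (y' - k) + \<phi> (v' - k)"
    using GLpoly_hclass_diag_lat[OF g(1), of "triple x y (v - 1)" "triple x' y' (v' - 1)"]
      GLpoly_hclass_diag_lat[OF g(1), of "triple x y v" "triple x' y' v'"] by (metis triple_simps)
  have kl: "k = l" using k[of "\<lambda>x. x"] l[of "\<lambda>x. x"] by linarith
  have "v\<^sup>2 - (v - 1)\<^sup>2 = (v' - k)\<^sup>2 - (v' - 1 - k)\<^sup>2"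
    using k[of "\<lambda>x. x\<^sup>2"] l[of "\<lambda>x. x\<^sup>2"] unfolding kl by linarith
  then have v: "v = v' - k" by (simp add: power2_eq_square algebra_simps)
  have "x = x' - k" "y = y' - k"
    using sorted_pair_unique[of x y "x' - k" "y' - k"] sorted k[of "\<lambda>x. x"] k[of "\<lambda>x. x\<^sup>2"] v
    by (auto simp: s sorted_gaps_def)
  then show ?thesis using v by (intro exI[of _ k]) (simp add: s)
qed

section \<open>The geodesic condition in coordinates\<close>

lemma not_subset_scale_line_ext:
  fixes u :: "3 \<Rightarrow> 'k::field"
  shows "\<not> diag_lat (triple x y (v - 1)) \<subseteq> scale fls_X (line_ext (triple x y v) u)"
proof
  assume sub: "diag_lat (triple x y (v - 1)) \<subseteq> scale fls_X (line_ext (triple x y v) u)"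
  let ?n = "triple x y v"
  \<comment> \<open>Modulo \<open>fls_X\<close> times the lattice with exponents
    \<open>x, y, v\<close>, the left side is the plane of the first two axes and the right side at
    most a line.\<close>
  have *: "\<exists>c. \<forall>k. (if k = i then 1 else 0) = c * u k" if i: "i \<noteq> 3" for i
  proof -
    have "axis i (tpow (?n i)) \<in> (diag_lat (triple x y (v - 1)) :: 'k vec3 set)"
      using i exhaust_3[of i] by (auto simp: diag_lat_def axis_def)
    then obtain w where w: "axis i (tpow (?n i)) = fls_X *s w" "w \<in> line_ext ?n u"
      using sub by (auto simp: scale_def)
    obtain c where c: "\<And>k. w $ k $$ (- ?n k - 1) = c * u k" using w(2) unfolding line_ext_def by blast
    have "(if k = i then 1 else 0) = c * u k" for k
    proof -
      have "(axis i (tpow (?n i)) :: 'k vec3) $ k $$ (- ?n k) = w $ k $$ (- ?n k - 1)"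
        unfolding w(1) by (simp add: fls_X_times_conv_shift)
      then show ?thesis unfolding c by (auto simp: axis_def split: if_splits)
    qed
    then show ?thesis by blast
  qed
  obtain c where "\<And>k. (if k = 1 then 1 else 0) = c * u k" using *[of 1] by auto
  from this[of 1] this[of 2] have "u 2 = 0" by auto
  moreover obtain d where "\<And>k. (if k = 2 then 1 else 0) = d * u k" using *[of 2] by auto
  from this[of 2] have "u 2 \<noteq> 0" by auto
  ultimately show False by simp
qed

lemma scale_X_line_ext_subset_iff:
  fixes u :: "3 \<Rightarrow> 'k::field"
  shows "scale fls_X (line_ext (triple x y v) u) \<subseteq> diag_lat (triple x y (v - 1)) \<longleftrightarrow> u 3 = 0"
proof
  let ?n = "triple x y v"
  assume sub: "scale fls_X (line_ext ?n u) \<subseteq> diag_lat (triple x y (v - 1))"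
  obtain w where w: "w \<in> line_ext ?n u" "\<And>i. w $ i $$ (- ?n i - 1) = u i" using line_ext_leading_vec by blast
  then have "fls_X *s w \<in> diag_lat (triple x y (v - 1))" using sub by (auto simp: scale_def)
  then have "(fls_X *s w) $ 3 $$ (- v) = 0" unfolding diag_lat_def by auto
  then show "u 3 = 0" using w(2)[of 3] by (simp add: fls_X_times_conv_shift)
next
  let ?n = "triple x y v"
  assume u3: "u 3 = 0"
  show "scale fls_X (line_ext ?n u) \<subseteq> diag_lat (triple x y (v - 1))"
  proof (clarsimp simp: scale_def diag_lat_def fls_X_times_conv_shift)
    fix w :: "'k vec3" and i k
    assume w: "w \<in> line_ext ?n u" and k: "k < - triple x y (v - 1) i"
    obtain c where c: "\<And>k. w $ k $$ (- ?n k - 1) = c * u k" and w0: "\<And>i k. k < - ?n i - 1 \<Longrightarrow> w $ i $$ k = 0"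
      using w unfolding line_ext_def by blast
    show "w $ i $$ (k - 1) = 0"
    proof (cases "k - 1 < - ?n i - 1")
      case True
      then show ?thesis by (rule w0)
    next
      case False
      then have "i = 3" "k - 1 = - ?n 3 - 1" using k exhaust_3[of i] by auto
      then show ?thesis using c[of 3] u3 by simp
    qed
  qed
qed

text \<open>With the middle lattice of the chain fixed, \<open>between_unique\<close> pins down the
  two outer ones inside their classes. Either they are the line extension and the source lattice,
  and then \<open>u 3 = 0\<close>; or they are \<open>scale (inverse fls_X)\<close> of the source
  and \<open>scale fls_X\<close> of the extension, which would squeeze a plane into a line.\<close>

lemma chamber_line_ext_iff:
  fixes u :: "3 \<Rightarrow> 'k::{field,finite}"
  assumes u: "u i \<noteq> 0"
  shows "chamber {hclass (diag_lat (triple x y (v - 1))), hclass (diag_lat (triple x y v)), hclass (line_ext (triple x y v) u)}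
    \<longleftrightarrow> u 3 = 0"
proof -
  let ?n = "triple x y v"
  let ?A = "diag_lat ?n :: 'k vec3 set" and ?B = "diag_lat (triple x y (v - 1)) :: 'k vec3 set"
    and ?M = "line_ext ?n u"
  let ?A' = "diag_lat (\<lambda>i. ?n i + 1) :: 'k vec3 set"
  have XA': "scale fls_X ?A' = ?A" by (simp add: scale_X_diag_lat)
  have latM: "lattice ?M" using u by (intro split_lattice_lattice split_line_ext) blast
  have AM: "?A \<subset> ?M" "?M \<subset> ?A'" using line_ext_between[of u i ?n] u by auto
  have BA: "?B \<subset> ?A" "scale fls_X ?A \<subset> ?B"
  proof -
    have "triple x y (v - 1) 3 \<noteq> triple x y v 3" "triple x y v 1 - 1 \<noteq> triple x y (v - 1) 1" by simp_all
    then show "?B \<subset> ?A" "scale fls_X ?A \<subset> ?B"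
      unfolding scale_X_diag_lat diag_lat_strict_subset_iff by (auto simp: forall_3 fun_eq_iff)
  qed
  show ?thesis
  proof
    assume "u 3 = 0"
    then have "scale fls_X ?M \<subset> ?B"
      using scale_X_line_ext_subset_iff[of x y v u] not_subset_scale_line_ext[of x y v u] by blast
    then have "lattice_chain ?M ?A ?B"
      using AM BA latM by (simp add: lattice_chain_def lattice_diag_lat)
    then have "chamber {hclass ?M, hclass ?A, hclass ?B}" 
      by (intro iffD2[OF chamber_iff_chain] exI[of _ ?M] exI[of _ ?A] exI[of _ ?B]) simp
    then show "chamber {hclass ?B, hclass ?A, hclass ?M}" by (simp add: insert_commute)
  next
    assume "chamber {hclass ?B, hclass ?A, hclass ?M}"
    then obtain L1 L3 where L: "lattice_chain L1 ?A L3"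
      and cases: "hclass L1 = hclass ?B \<and> hclass L3 = hclass ?M \<or> hclass L1 = hclass ?M \<and> hclass L3 = hclass ?B"
      using chamber_middle[OF _ self_hclass] by blast
    have L': "scale fls_X L1 \<subset> L3" "L3 \<subset> ?A" "?A \<subset> L1" using L by (auto simp: lattice_chain_def)
    have XA3: "scale fls_X ?A \<subset> L3"
      using L'(1,3) scale_strict_mono_iff[of fls_X ?A L1] by auto
    have L1A': "L1 \<subset> ?A'"
      using L'(1,2) scale_strict_mono_iff[of fls_X L1 ?A'] unfolding XA' by auto
    have uniq: "P = Q" if "hclass P = hclass Q" "lat_module Q" "lat_module R" "scale fls_X R \<subset> P" "P \<subset> R"
      "scale fls_X R \<subset> Q" "Q \<subset> R" for P Q R :: "'k vec3 set"
    proof -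
      have "P \<in> hclass Q" unfolding that(1)[symmetric] by simp
      then obtain a where a: "a \<noteq> 0" "P = scale a Q" unfolding mem_hclass by blast
      then show ?thesis using between_unique[OF that(3,2) a(1)] that by simp
    qed
    from cases show "u 3 = 0"
    proof
      assume h: "hclass L1 = hclass ?M \<and> hclass L3 = hclass ?B"
      have "L3 = ?B"
        using h XA3 L'(2) BA by (intro uniq[of _ _ ?A] lat_module_diag_lat) auto
      moreover have "L1 = ?M"
        using h L1A' L'(3) AM by (intro uniq[of _ _ ?A'] lat_module_diag_lat lattice_module latM) (auto simp: XA')
      ultimately have "scale fls_X ?M \<subseteq> ?B" using L'(1) by blast
      then show ?thesis by (simp only: scale_X_line_ext_subset_iff)
    next
      assume h: "hclass L1 = hclass ?B \<and> hclass L3 = hclass ?M"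
      let ?B' = "scale (inverse fls_X) ?B" and ?M' = "scale fls_X ?M"
      have "?A \<subset> ?B'" "?B' \<subset> ?A'"
        using BA scale_strict_mono_iff[of fls_X ?A ?B'] scale_strict_mono_iff[of fls_X ?B' ?A'] by (simp_all add: XA')
      then have L1: "L1 = ?B'"
        using h L1A' L'(3)
        by (intro uniq[of _ _ ?A'] lat_module_diag_lat lat_module_scale) (simp_all add: XA' hclass_scale)
      have "scale fls_X ?A \<subset> ?M'" "?M' \<subset> ?A"
        using AM scale_strict_mono_iff[of fls_X ?A ?M] scale_strict_mono_iff[of fls_X ?M ?A'] by (simp_all add: XA')
      then have "L3 = ?M'"
        using h XA3 L'(2) by (intro uniq[of _ _ ?A] lat_module_diag_lat lat_module_scale lattice_module latM) (simp_all add: hclass_scale)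
      then have "?B \<subseteq> ?M'" using L'(1) L1 by simp
      then show ?thesis using not_subset_scale_line_ext by blast
    qed
  qed
qed

text \<open>A geodesic step is a line with nonzero third coordinate; normalising it to 1 leaves the
  q^2 pairs \<open>(a, b)\<close> as parameters.\<close>

definition successor :: "gaps \<Rightarrow> 'k::field \<times> 'k \<Rightarrow> 'k edge" where
  "successor s = (\<lambda>(a, b). (snd (edge_of s), hclass (line_ext (case s of (x, y, v) \<Rightarrow> triple x y v) (triple a b 1))))"

lemma inj_successor: "inj (successor s :: 'k::field \<times> 'k \<Rightarrow> 'k edge)"
proof (rule injI)
  fix p p' :: "'k \<times> 'k"
  obtain x y v where s: "s = (x, y, v)" by (cases s)
  obtain a b a' b' where p: "p = (a, b)" "p' = (a', b')" by (cases p; cases p')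
  assume "successor s p = successor s p'"
  then have "hclass (line_ext (triple x y v) (triple a b 1)) = hclass (line_ext (triple x y v) (triple a' b' 1))"
    by (simp add: successor_def s p)
  then have "line_ext (triple x y v) (triple a b 1) = line_ext (triple x y v) (triple a' b' 1)"
    by (rule line_ext_homothetic[where i = 3 and j = 3]) simp_all
  then obtain c where c: "\<And>i. triple a b 1 i = c * triple a' b' 1 i"
    using line_ext_mono_imp[of "triple x y v" "triple a b 1" "triple a' b' 1"] by auto
  show "p = p'" using c[of 1] c[of 2] c[of 3] by (simp add: p)
qed

lemma geodesic_successors:
  "{d'. geodesic (edge_of s) d'} = range (successor s :: 'k::{field,finite} \<times> 'k \<Rightarrow> 'k edge)"
proof -
  obtain x y v where s: "s = (x, y, v)" by (cases s)
  let ?n = "triple x y v"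
  have iff: "geodesic (edge_of s) (hclass (diag_lat ?n), hclass (line_ext ?n u)) \<longleftrightarrow> u 3 \<noteq> 0"
    if "u i \<noteq> 0" for u :: "3 \<Rightarrow> 'k" and i
    using type1_edge_of[of s, where 'k = 'k] type1_line_ext[of u ?n] chamber_line_ext_iff[of u i x y v] that
    unfolding geodesic_def by (auto simp: s)
  show ?thesis
  proof (intro equalityI subsetI)
    fix d' :: "'k edge" assume "d' \<in> {d'. geodesic (edge_of s) d'}"
    then have d': "geodesic (edge_of s) d'" by simp
    then have type1: "d' \<in> type1_edges" and fst: "fst d' = hclass (diag_lat ?n)" by (auto simp: geodesic_def s)
    have "d' = (hclass (diag_lat ?n), snd d')" using fst by (metis prod.collapse)
    then obtain u where u: "\<exists>i. u i \<noteq> 0" "d' = (hclass (diag_lat ?n), hclass (line_ext ?n u))"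
      using type1_from_diag_lat[of ?n "snd d'"] type1 by metis
    then have u3: "u 3 \<noteq> 0" using iff d' by blast
    have "(\<lambda>i. (1 / u 3) * u i) = triple (u 1 / u 3) (u 2 / u 3) 1" using u3 by (simp add: triple_eq_iff)
    then have "line_ext ?n (triple (u 1 / u 3) (u 2 / u 3) 1) = line_ext ?n u"
      using line_ext_smult[of "1 / u 3" ?n u] u3 by simp
    then have "d' = successor s (u 1 / u 3, u 2 / u 3)" by (simp add: u(2) successor_def s)
    then show "d' \<in> range (successor s)" by blast
  next
    fix d' :: "'k edge" assume "d' \<in> range (successor s)"
    then obtain a b where "d' = (hclass (diag_lat ?n), hclass (line_ext ?n (triple a b 1)))"
      by (auto simp: successor_def s)
    then show "d' \<in> {d'. geodesic (edge_of s) d'}" using iff[of "triple a b 1" 3] by simp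
  qed
qed

abbreviation orbit_of :: "gaps \<Rightarrow> 'k::field edge set" where
  "orbit_of s \<equiv> edge_orbit (edge_of s)"

lemma edge_orbit_successor:
  "sorted_gaps s \<Longrightarrow> edge_orbit (successor s u) = (orbit_of (step s u) :: 'k::field edge set)"
  by (cases s; cases u) (simp add: successor_def edge_orbit_step sorted_gaps_def)

lemma mem_edge_orbit_iff: "d \<in> edge_orbit f \<longleftrightarrow> edge_orbit d = edge_orbit f"
  using edge_orbit_eqI self_edge_orbit by blast

text \<open>The chosen lift is a translate of \<open>edge_of s\<close> by some polynomial matrix.
  Its inverse carries the geodesic continuations back without changing their orbits, and there they
  are the successors.\<close>

lemma edge_weight_orbit_of:
  fixes f :: "'k::{field,finite} edge"
  assumes s: "sorted_gaps s"
  shows "edge_weight (orbit_of s) (edge_orbit f) = card {u :: 'k \<times> 'k. orbit_of (step s u) = edge_orbit f}"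
proof -
  have "(SOME d. d \<in> orbit_of s) \<in> (orbit_of s :: 'k edge set)" by (rule someI) (rule self_edge_orbit)
  then obtain g :: "'k mat3" where g: "g \<in> GLpoly" "(SOME d. d \<in> orbit_of s) = edge_map g (edge_of s)"
    unfolding edge_orbit_def by blast
  obtain h where h: "h \<in> GLpoly" "g ** h = mat 1" "h ** g = mat 1" using g(1) by (rule GLpoly_inverse)
  have inv: "edge_map g (edge_map h d) = d" "edge_map h (edge_map g d) = d" for d
    by (simp_all add: edge_map_edge_map h edge_map_one)
  let ?S = "{d'. edge_orbit d' = edge_orbit f \<and> geodesic (edge_of s) d'}"
  have "{d' \<in> type1_edges. d' \<in> edge_orbit f \<and> geodesic (edge_map g (edge_of s)) d'} = edge_map g ` ?S"
  proof (intro equalityI subsetI)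
    fix d' assume "d' \<in> {d' \<in> type1_edges. d' \<in> edge_orbit f \<and> geodesic (edge_map g (edge_of s)) d'}"
    then have "edge_orbit d' = edge_orbit f" "geodesic (edge_map h (edge_map g (edge_of s))) (edge_map h d')"
      using geodesic_edge_map[OF h(2,3)] by (auto simp: mem_edge_orbit_iff)
    then have "edge_map h d' \<in> ?S" using h(1) by (simp add: inv edge_orbit_map)
    then show "d' \<in> edge_map g ` ?S" by (rule image_eqI[rotated]) (simp add: inv)
  next
    fix d' assume "d' \<in> edge_map g ` ?S"
    then obtain d where d: "d' = edge_map g d" "edge_orbit d = edge_orbit f" "geodesic (edge_of s) d" by blast
    then have "geodesic (edge_map g (edge_of s)) d'" using geodesic_edge_map[OF h(3,2)] by simp
    moreover from this have "d' \<in> type1_edges" by (simp add: geodesic_def)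
    ultimately show "d' \<in> {d' \<in> type1_edges. d' \<in> edge_orbit f \<and> geodesic (edge_map g (edge_of s)) d'}"
      using d g(1) by (simp add: mem_edge_orbit_iff edge_orbit_map)
  qed
  then have "edge_weight (orbit_of s) (edge_orbit f) = card (edge_map g ` ?S)"
    by (simp add: edge_weight_def g(2))
  also have "\<dots> = card ?S" by (rule card_image, rule inj_on_inverseI[of _ "edge_map h"]) (rule inv(2))
  also have "?S = successor s ` {u :: 'k \<times> 'k. orbit_of (step s u) = edge_orbit f}"
  proof -
    have "geodesic (edge_of s) d' \<longleftrightarrow> d' \<in> range (successor s)" for d' :: "'k edge"
      unfolding geodesic_successors[symmetric] by simp
    then have "?S = {d'. edge_orbit d' = edge_orbit f \<and> d' \<in> range (successor s)}" by simp
    also have "\<dots> = successor s ` {u. edge_orbit (successor s u) = edge_orbit f}" by blast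
    finally show ?thesis by (simp add: edge_orbit_successor[OF s])
  qed
  also have "card \<dots> = card {u :: 'k \<times> 'k. orbit_of (step s u) = edge_orbit f}"
    by (rule card_image) (rule inj_on_subset[OF inj_successor subset_UNIV])
  finally show ?thesis .
qed

lemma quot_edges_eq: "quot_edges PGL3_poly = (orbit_of ` {s. sorted_gaps s} :: 'k::{field,finite} edge set set)"
proof -
  have "edge_orbit d \<in> (orbit_of ` {s. sorted_gaps s} :: 'k edge set set)" if "d \<in> type1_edges" for d
    using edge_orbit_representative[OF that] by blast
  then show ?thesis unfolding quot_edges_PGL3_poly using type1_edge_of by blast
qed

lemma sum_step:
  "(\<Sum>u\<in>UNIV. f (step s (u :: 'k::{field,finite} \<times> 'k))) = transfer (int CARD('k)) f s"
proof -
  obtain x y v where s: "s = (x, y, v)" by (cases s)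
  have cond: "(\<Sum>a\<in>UNIV. if a \<noteq> (0 :: 'k) then p else r) = (int CARD('k) - 1) * p + r" for p r :: int
  proof -
    have "(\<Sum>a\<in>UNIV. if a \<noteq> (0 :: 'k) then p else r) = r + (\<Sum>a\<in>UNIV - {0 :: 'k}. p)"
      by (subst sum.remove[of _ 0]) (auto intro: sum.cong)
    also have "(\<Sum>a\<in>UNIV - {0 :: 'k}. p) = (int CARD('k) - 1) * p"
      by (simp add: card_Diff_singleton of_nat_diff Suc_leI)
    finally show ?thesis by simp
  qed
  have "(\<Sum>u\<in>UNIV. f (step s (u :: 'k \<times> 'k))) = (\<Sum>a\<in>UNIV. \<Sum>b\<in>UNIV. f (step s (a :: 'k, b :: 'k)))"
    by (simp add: sum.cartesian_product flip: UNIV_Times_UNIV)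
  also have "\<dots> = transfer (int CARD('k)) f s"
  proof -
    consider "v \<le> x" | "x < v" "v \<le> y" | "x < v" "y < v" by linarith
    then show ?thesis
    proof cases
      case 1
      then show ?thesis by (simp add: s power2_eq_square)
    next
      case 2
      have "(\<Sum>a\<in>UNIV. \<Sum>b\<in>UNIV. f (step s (a :: 'k, b :: 'k))) =
          (\<Sum>a\<in>UNIV. if a \<noteq> (0 :: 'k) then int CARD('k) * f (v, y, x + 1) else int CARD('k) * f (x, y, v + 1))"
        using 2 by (intro sum.cong) (auto simp: s)
      then show ?thesis using 2 by (simp only: cond) (simp add: s algebra_simps)
    next
      case 3
      have "(\<Sum>b\<in>UNIV. f (step s (a :: 'k, b :: 'k))) =
          (if a \<noteq> 0 then int CARD('k) * f (y, v, x + 1) else (int CARD('k) - 1) * f (x, v, y + 1) + f (x, y, v + 1))" for a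
      proof (cases "a = 0")
        case True
        have "(\<Sum>b\<in>UNIV. f (step s (a, b :: 'k))) = (\<Sum>b\<in>UNIV. if b \<noteq> (0 :: 'k) then f (x, v, y + 1) else f (x, y, v + 1))"
          using 3 True by (intro sum.cong) (auto simp: s)
        then show ?thesis using True by (simp only: cond) simp
      next
        case False
        then show ?thesis using 3 by (simp add: s)
      qed
      then show ?thesis using 3 by (simp only: cond) (simp add: s algebra_simps)
    qed
  qed
  finally show ?thesis .
qed

section \<open>The count of closed paths\<close>

type_synonym 'k word = "('k \<times> 'k) list"

lemma sorted_foldl_step: "sorted_gaps s \<Longrightarrow> sorted_gaps (foldl step s us)"
  by (induction us arbitrary: s) (simp_all add: sorted_step)

lemma total_foldl_step: "total (foldl step s us) = total s + int (length us)"
  by (induction us arbitrary: s) (simp_all add: total_step)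

lemma orbit_of_shift: "orbit_of (shift_gaps k s) = (orbit_of s :: 'k::field edge set)"
  by (simp only: edge_of_shift)

lemma total_shift_gaps: "total (shift_gaps k s) = total s + 3 * k"
  by (cases s) simp

lemma finite_words: "finite {us :: 'a::finite list. length us = n \<and> P us}"
  by (rule finite_subset[OF _ finite_lists_length_eq[of UNIV n]]) auto

section \<open>Words of successor choices above a path\<close>

definition lifts :: "gaps \<Rightarrow> nat \<Rightarrow> 'k::field edge set list \<Rightarrow> 'k word set" where
  "lifts s n es = {us. length us = n \<and> (\<forall>j\<le>n. orbit_of (foldl step s (take j us)) = es ! j)}"

text \<open>The letters that realise the first edge may lead to different states, but these lie in
  the same orbit, so the induction hypothesis gives the same count for all of them.\<close>

lemma card_lifts:
  fixes es :: "'k::{field,finite} edge set list"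
  assumes "sorted_gaps s" "length es = Suc n" "set es \<subseteq> quot_edges PGL3_poly" "es ! 0 = orbit_of s"
  shows "card (lifts s n es) = (\<Prod>j<n. edge_weight (es ! j) (es ! Suc j))"
  using assms
proof (induction n arbitrary: s es)
  case 0
  then have "lifts s 0 es = {[]}" by (auto simp: lifts_def)
  then show ?case by simp
next
  case (Suc n)
  obtain e0 fs where es: "es = e0 # fs" using Suc.prems(2) by (cases es) auto
  have lfs: "length fs = Suc n" using Suc.prems(2) es by simp
  then have "fs ! 0 \<in> set fs" by (intro nth_mem) simp
  then have "fs ! 0 \<in> quot_edges PGL3_poly" using Suc.prems(3) es by auto
  then obtain f where f: "fs ! 0 = (edge_orbit f :: 'k edge set)" unfolding quot_edges_eq by blast
  define A where "A = {u :: 'k \<times> 'k. orbit_of (step s u) = fs ! 0}"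
  have split: "(\<forall>j\<le>Suc n. P j) \<longleftrightarrow> P 0 \<and> (\<forall>j\<le>n. P (Suc j))" for P
    by (metis Suc_le_mono le0 not0_implies_Suc)
  have "lifts s (Suc n) es = (\<lambda>(u, us). u # us) ` (SIGMA u:A. lifts (step s u) n fs)"
  proof (intro equalityI subsetI)
    fix us :: "'k word"
    assume us: "us \<in> lifts s (Suc n) es"
    then obtain u vs where uv: "us = u # vs" by (cases us) (auto simp: lifts_def)
    have "length vs = n" "\<forall>j\<le>n. orbit_of (foldl step (step s u) (take j vs)) = fs ! j"
      using us unfolding lifts_def split by (auto simp: uv es)
    then have "vs \<in> lifts (step s u) n fs" "u \<in> A" by (auto simp: lifts_def A_def)
    then show "us \<in> (\<lambda>(u, us). u # us) ` (SIGMA u:A. lifts (step s u) n fs)" by (auto simp: uv)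
  next
    fix us assume "us \<in> (\<lambda>(u, us). u # us) ` (SIGMA u:A. lifts (step s u) n fs)"
    then obtain u vs where "us = u # vs" "u \<in> A" "vs \<in> lifts (step s u) n fs" by auto
    then show "us \<in> lifts s (Suc n) es"
      using Suc.prems(4) unfolding lifts_def split by (auto simp: es)
  qed
  then have "card (lifts s (Suc n) es) = card (SIGMA u:A. lifts (step s u) n fs)"
    by (simp add: card_image inj_on_def split_beta)
  also have "\<dots> = (\<Sum>u\<in>A. card (lifts (step s u) n fs))"
    by (rule card_SigmaI) (auto simp: A_def lifts_def intro: finite_words)
  also have "\<dots> = (\<Sum>u\<in>A. \<Prod>j<n. edge_weight (fs ! j) (fs ! Suc j))"
  proof (rule sum.cong[OF refl])
    fix u assume u: "u \<in> A"
    show "card (lifts (step s u) n fs) = (\<Prod>j<n. edge_weight (fs ! j) (fs ! Suc j))"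
      using u Suc.prems(1,3) lfs
      by (intro Suc.IH) (auto simp: A_def es sorted_step)
  qed
  also have "\<dots> = card A * (\<Prod>j<n. edge_weight (fs ! j) (fs ! Suc j))" by simp
  also have "card A = edge_weight (es ! 0) (es ! Suc 0)"
    using edge_weight_orbit_of[OF Suc.prems(1), of f] Suc.prems(4) by (simp add: A_def es f)
  also have "edge_weight (es ! 0) (es ! Suc 0) * (\<Prod>j<n. edge_weight (fs ! j) (fs ! Suc j)) =
      (\<Prod>j<Suc n. edge_weight (es ! j) (es ! Suc j))"
    unfolding prod.lessThan_Suc_shift by (simp add: es)
  finally show ?case .
qed

lemma foldl_step_sum:
  "(transfer (int CARD('k::{field,finite})) ^^ n) f s =
    (\<Sum>us | length us = n. f (foldl step s (us :: 'k word)))"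
proof (induction n arbitrary: s)
  case 0
  have "{us :: 'k word. length us = 0} = {[]}" by auto
  then show ?case by simp
next
  case (Suc n)
  have "{us :: 'k word. length us = Suc n} = (\<lambda>(u, us). u # us) ` (UNIV \<times> {us. length us = n})"
    by (auto simp: length_Suc_conv image_iff)
  then have "(\<Sum>us | length us = Suc n. f (foldl step s (us :: 'k word))) =
      (\<Sum>(u :: 'k \<times> 'k, us)\<in>UNIV \<times> {us. length us = n}. f (foldl step (step s u) (us :: 'k word)))"
    by (simp add: sum.reindex inj_on_def split_beta)
  also have "\<dots> = (\<Sum>u :: 'k \<times> 'k\<in>UNIV. \<Sum>us | length us = n. f (foldl step (step s u) (us :: 'k word)))"
    by (simp add: sum.cartesian_product)
  also have "\<dots> = (\<Sum>u\<in>UNIV. (transfer (int CARD('k)) ^^ n) f (step s (u :: 'k \<times> 'k)))"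
    by (simp add: Suc.IH)
  also have "\<dots> = (transfer (int CARD('k)) ^^ Suc n) f s" by (simp add: sum_step)
  finally show ?case by simp
qed

definition closing_words :: "gaps \<Rightarrow> nat \<Rightarrow> 'k::{field,finite} word set" where
  "closing_words s m = {us. length us = m \<and> orbit_of (foldl step s us) = (orbit_of s :: 'k edge set)}"

text \<open>Closing up in the quotient means returning to the start up to a common shift
  \<open>k\<close> of all three exponents; the shift adds \<open>3 * k\<close> to the total and
  every step adds 1.\<close>

lemma closing_words_iff:
  assumes "sorted_gaps s" "us \<in> closing_words s m"
  obtains k where "foldl step s us = shift_gaps k s" "int m = 3 * k"
proof -
  have us: "length us = m" "orbit_of (foldl step s us) = (orbit_of s :: 'a edge set)"
    using assms(2) by (auto simp: closing_words_def)
  obtain k where k: "foldl step s us = shift_gaps k s"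
    using edge_orbit_edge_of_eq[OF assms(1) sorted_foldl_step[OF assms(1)] us(2)[symmetric]] by blast
  then have "int m = 3 * k" using total_foldl_step[of s us] us(1) by (simp add: total_shift_gaps)
  then show ?thesis using k that by blast
qed

lemma card_closing_words:
  assumes "sorted_gaps s"
  shows "int (card (closing_words s (3 * r) :: 'k::{field,finite} word set)) =
    green (int CARD('k)) (shift_gaps (int r) s) s"
proof -
  let ?t = "shift_gaps (int r) s"
  have "closing_words s (3 * r) = {us :: 'k word. length us = 3 * r \<and> foldl step s us = ?t}"
  proof (intro equalityI subsetI)
    fix us :: "'k word" assume us: "us \<in> closing_words s (3 * r)"
    then obtain k where "foldl step s us = shift_gaps k s" "int (3 * r) = 3 * k"
      by (rule closing_words_iff[OF assms])
    moreover from this(2) have "k = int r" by simp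
    ultimately show "us \<in> {us. length us = 3 * r \<and> foldl step s us = ?t}"
      using us by (simp add: closing_words_def)
  qed (simp add: closing_words_def orbit_of_shift)
  also have "int (card \<dots>) = (\<Sum>us | length us = 3 * r. if foldl step s (us :: 'k word) = ?t then 1 else 0)"
  proof -
    have "finite {us :: 'k word. length us = 3 * r}" using finite_words[of "3 * r" "\<lambda>_. True"] by simp
    then show ?thesis by (simp add: sum.If_cases Int_def conj_commute)
  qed
  also have "\<dots> = (transfer (int CARD('k)) ^^ (3 * r)) (\<lambda>s. if s = ?t then 1 else 0) s"
    by (simp only: foldl_step_sum)
  also have "\<dots> = green (int CARD('k)) ?t s"
  proof -
    have "nat (total ?t - total s) = 3 * r" unfolding total_shift_gaps by simp
    then show ?thesis by (simp add: green_def)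
  qed
  finally show ?thesis .
qed

definition closed_paths_at :: "'k::{field,finite} edge set \<Rightarrow> nat \<Rightarrow> 'k edge set list set" where
  "closed_paths_at e m = {es. closed_path PGL3_poly es \<and> length es = m \<and> hd es = e}"

definition trail :: "gaps \<Rightarrow> 'k::field word \<Rightarrow> 'k edge set list" where
  "trail s us = map (\<lambda>j. orbit_of (foldl step s (take j us))) [0..<length us]"

lemma length_trail [simp]: "length (trail s us) = length us"
  by (simp add: trail_def)

lemma trail_nth: "j < length us \<Longrightarrow> trail s us ! j = orbit_of (foldl step s (take j us))"
  by (simp add: trail_def)

text \<open>Appending the first edge turns the cyclic product of weights into one along an open path
  with \<open>m\<close> steps.\<close>

lemma path_weight_eq_card_lifts:
  fixes es :: "'k::{field,finite} edge set list"
  assumes s: "sorted_gaps s" and m: "m \<ge> 1" and es: "length es = m" "set es \<subseteq> quot_edges PGL3_poly" "hd es = orbit_of s"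
  shows "path_weight es = card {us \<in> closing_words s m. trail s us = es}"
proof -
  have ne: "es \<noteq> []" using es(1) m by auto
  have hd: "es ! 0 = orbit_of s" using ne es(3) by (simp add: hd_conv_nth)
  let ?es = "es @ [es ! 0]"
  have set: "set ?es \<subseteq> quot_edges PGL3_poly" using es(2) ne by auto
  have "path_weight es = (\<Prod>j<m. edge_weight (?es ! j) (?es ! Suc j))"
    unfolding path_weight_def es(1)
  proof (rule prod.cong[OF refl])
    fix j assume "j \<in> {..<m}"
    then show "edge_weight (es ! j) (es ! (Suc j mod m)) = edge_weight (?es ! j) (?es ! Suc j)"
      using es(1) by (cases "Suc j = m") (auto simp: nth_append)
  qed
  also have "\<dots> = card (lifts s m ?es)"
    by (rule card_lifts[symmetric, OF s _ set]) (use es ne hd in \<open>auto simp: nth_append\<close>)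
  also have "lifts s m ?es = {us \<in> closing_words s m. trail s us = es}"
  proof -
    have "(\<forall>j\<le>m. orbit_of (foldl step s (take j us)) = ?es ! j) \<longleftrightarrow>
        orbit_of (foldl step s us) = (orbit_of s :: 'k edge set) \<and> trail s us = es"
      if "length us = m" for us :: "'k word"
    proof -
      have split: "(\<forall>j\<le>m. P j) \<longleftrightarrow> P m \<and> (\<forall>j<m. P j)" for P by (auto simp: le_less)
      have "(\<forall>j\<le>m. orbit_of (foldl step s (take j us)) = ?es ! j) \<longleftrightarrow>
          orbit_of (foldl step s (take m us)) = ?es ! m \<and> (\<forall>j<m. orbit_of (foldl step s (take j us)) = ?es ! j)"
        by (rule split)
      also have "?es ! m = orbit_of s" using es(1) hd by (simp add: nth_append)
      also have "(\<forall>j<m. orbit_of (foldl step s (take j us)) = ?es ! j) \<longleftrightarrow> trail s us = es"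
        using that es(1) by (auto simp: list_eq_iff_nth_eq trail_nth nth_append)
      finally show ?thesis using that by simp
    qed
    then show ?thesis by (auto simp: lifts_def closing_words_def)
  qed
  finally show ?thesis .
qed

lemma trail_in_quot_edges:
  "sorted_gaps s \<Longrightarrow> set (trail s us) \<subseteq> quot_edges (PGL3_poly :: 'k::{field,finite} mat3 set monoid)"
  unfolding quot_edges_eq trail_def by (auto intro!: sorted_foldl_step)

lemma closed_paths_at_orbit:
  assumes s: "sorted_gaps s" and m: "m \<ge> 1"
  shows "closed_paths_at (orbit_of s) m = (trail s ` closing_words s m :: 'k::{field,finite} edge set list set)"
proof (intro equalityI subsetI)
  fix es :: "'k edge set list" assume "es \<in> closed_paths_at (orbit_of s) m"
  then have es: "closed_path PGL3_poly es" "length es = m" "hd es = orbit_of s" by (auto simp: closed_paths_at_def)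
  then have "set es \<subseteq> quot_edges PGL3_poly" "path_weight es \<noteq> 0" by (auto simp: closed_path_iff_weight)
  then have "card {us \<in> closing_words s m. trail s us = es} \<noteq> 0"
    using path_weight_eq_card_lifts[OF s m es(2) _ es(3)] by simp
  then show "es \<in> trail s ` closing_words s m" by (auto simp: card_eq_0_iff)
next
  fix es :: "'k edge set list" assume "es \<in> trail s ` closing_words s m"
  then obtain us where us: "us \<in> closing_words s m" "es = trail s us" by blast
  have len: "length us = m" using us(1) by (simp add: closing_words_def)
  have sub: "set es \<subseteq> quot_edges PGL3_poly" unfolding us(2) by (rule trail_in_quot_edges[OF s])
  have "length es = m" by (simp add: us(2) len)
  then have ne: "es \<noteq> []" using m by auto
  have hd: "hd es = orbit_of s" using ne len m by (simp add: hd_conv_nth us(2) trail_nth)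
  have "finite {us \<in> closing_words s m. trail s us = es}"
    by (rule finite_subset[OF _ finite_words[of m "\<lambda>_. True"]]) (auto simp: closing_words_def)
  then have "path_weight es \<noteq> 0"
    using path_weight_eq_card_lifts[OF s m _ sub hd] us len by (auto simp: card_eq_0_iff)
  then show "es \<in> closed_paths_at (orbit_of s) m"
    using sub ne hd len us(2) by (simp add: closed_paths_at_def closed_path_iff_weight)
qed

lemma finite_closing_words: "finite (closing_words s m)"
  unfolding closing_words_def by (rule finite_words)

lemma finite_closed_paths_at: "sorted_gaps s \<Longrightarrow> m \<ge> 1 \<Longrightarrow> finite (closed_paths_at (orbit_of s) m)"
  by (simp add: closed_paths_at_orbit finite_closing_words)

lemma sum_closed_paths_at:
  assumes s: "sorted_gaps s" and m: "m \<ge> 1"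
  shows "(\<Sum>es\<in>closed_paths_at (orbit_of s :: 'k edge set) m. path_weight es) = card (closing_words s m :: 'k::{field,finite} word set)"
proof -
  have "card (closing_words s m :: 'k word set) =
      (\<Sum>es\<in>trail s ` closing_words s m. card {us \<in> closing_words s m. trail s us = (es :: 'k edge set list)})"
    using sum.image_gen[OF finite_closing_words, of "\<lambda>_. 1 :: nat" s m "trail s :: 'k word \<Rightarrow> _"] by simp
  also have "\<dots> = (\<Sum>es\<in>closed_paths_at (orbit_of s :: 'k edge set) m. path_weight es)"
    unfolding closed_paths_at_orbit[OF assms, symmetric]
    by (rule sum.cong[OF refl], rule path_weight_eq_card_lifts[OF s m, symmetric])
      (auto simp: closed_paths_at_def closed_path_def)
  finally show ?thesis by simp
qed

text \<open>
  Along a path, the potential \<open>3 max - total\<close> changes by \<open>2\<close> when the maximum grows, which happens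
  exactly on arrival at a state with \<open>y < v\<close>, and by \<open>- 1\<close> otherwise. So one third of the states of
  every closed path are of that kind.
\<close>

definition top_gaps :: "gaps \<Rightarrow> bool" where
  "top_gaps = (\<lambda>(x, y, v). y < v)"

definition potential :: "gaps \<Rightarrow> int" where
  "potential = (\<lambda>(x, y, v). 3 * max y v - (x + y + v))"

lemma potential_step:
  "sorted_gaps s \<Longrightarrow> potential (step s u) = potential s - 1 + (if top_gaps (step s u) then 3 else 0)"
  by (cases s; cases u) (auto simp: sorted_gaps_def top_gaps_def potential_def)

lemma potential_shift: "potential (shift_gaps k s) = potential s"
  by (cases s) (auto simp: potential_def max_def)

lemma top_gaps_shift: "top_gaps (shift_gaps k s) = top_gaps s"
  by (cases s) (auto simp: top_gaps_def)

definition top_orbit :: "'k::field edge set \<Rightarrow> bool" where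
  "top_orbit e \<longleftrightarrow> (\<exists>s. sorted_gaps s \<and> top_gaps s \<and> e = orbit_of s)"

lemma top_orbit_orbit_of: "sorted_gaps s \<Longrightarrow> top_orbit (orbit_of s :: 'k::field edge set) \<longleftrightarrow> top_gaps s"
  unfolding top_orbit_def using edge_orbit_edge_of_eq[of s, where 'k = 'k] top_gaps_shift by metis

lemma potential_foldl:
  "sorted_gaps s \<Longrightarrow> potential (foldl step s us) = potential s - int (length us) +
    3 * int (card {j. j < length us \<and> top_gaps (foldl step s (take (Suc j) us))})"
proof (induction us rule: rev_induct)
  case (snoc u us)
  let ?n = "length us"
  have "{j. j < Suc ?n \<and> top_gaps (foldl step s (take (Suc j) (us @ [u])))} =
      {j. j < ?n \<and> top_gaps (foldl step s (take (Suc j) us))} \<union>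
      (if top_gaps (step (foldl step s us) u) then {?n} else {})"
    by (auto simp: less_Suc_eq)
  then show ?case using snoc
    by (simp add: potential_step sorted_foldl_step card_insert_if split: if_splits)
qed simp

lemma card_top_positions:
  fixes es :: "'k::{field,finite} edge set list"
  assumes "closed_path PGL3_poly es"
  shows "3 * card {j. j < length es \<and> top_orbit (es ! j)} = length es"
proof -
  let ?m = "length es"
  have ne: "es \<noteq> []" and "hd es \<in> quot_edges PGL3_poly" using assms by (auto simp: closed_path_def)
  then obtain s where s: "sorted_gaps s" "hd es = orbit_of s" unfolding quot_edges_eq by blast
  have m: "?m \<ge> 1" using ne by (simp add: Suc_le_eq)
  have "es \<in> closed_paths_at (orbit_of s) ?m" using assms s by (simp add: closed_paths_at_def)
  then obtain us :: "'k word" where us: "us \<in> closing_words s ?m" "es = trail s us"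
    unfolding closed_paths_at_orbit[OF s(1) m] by blast
  have len: "length us = ?m" using us(2) by simp
  obtain k where k: "foldl step s us = shift_gaps k s" by (rule closing_words_iff[OF s(1) us(1)])
  have "?m = 3 * card {j. j < ?m \<and> top_gaps (foldl step s (take (Suc j) us))}"
    using potential_foldl[OF s(1), of us] k len by (simp add: potential_shift)
  \<comment> \<open>The potential registers arrivals, that is, positions \<open>Suc j\<close>;
    modulo the length this is a permutation of the positions.\<close>
  also have "card {j. j < ?m \<and> top_gaps (foldl step s (take (Suc j) us))} = card {j. j < ?m \<and> top_orbit (es ! j)}"
  proof (rule bij_betw_same_card[of "\<lambda>j. Suc j mod ?m"])
    have "top_gaps (foldl step s (take (Suc j) us)) \<longleftrightarrow> top_orbit (es ! (Suc j mod ?m))" if "j < ?m" for j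
    proof (cases "Suc j = ?m")
      case True
      have e: "es ! (Suc j mod ?m) = orbit_of s" unfolding True using s(2) ne by (simp add: hd_conv_nth)
      have t: "take (Suc j) us = us" unfolding True using len by simp
      show ?thesis unfolding e t k top_gaps_shift by (rule top_orbit_orbit_of[OF s(1), symmetric])
    next
      case False
      then have lt: "Suc j < length us" "Suc j mod ?m = Suc j" using that len by simp_all
      have "es ! Suc j = trail s us ! Suc j" by (simp only: us(2))
      then have e: "es ! (Suc j mod ?m) = orbit_of (foldl step s (take (Suc j) us))"
        unfolding lt(2) trail_nth[OF lt(1)] .
      show ?thesis unfolding e by (rule top_orbit_orbit_of[OF sorted_foldl_step[OF s(1)], symmetric])
    qed
    then have eq: "{j. j < ?m \<and> top_gaps (foldl step s (take (Suc j) us))} = {j. j < ?m \<and> top_orbit (es ! (Suc j mod ?m))}"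
      by blast
    have bij: "bij_betw (\<lambda>j. Suc j mod ?m) {..<?m} {..<?m}" using ne by (intro bij_betw_Suc_mod) simp
    show "bij_betw (\<lambda>j. Suc j mod ?m) {j. j < ?m \<and> top_gaps (foldl step s (take (Suc j) us))} {j. j < ?m \<and> top_orbit (es ! j)}"
      unfolding eq
    proof (rule bij_betw_imageI)
      show "inj_on (\<lambda>j. Suc j mod ?m) {j. j < ?m \<and> top_orbit (es ! (Suc j mod ?m))}"
        by (rule inj_on_subset[OF bij_betw_imp_inj_on[OF bij]]) auto
      show "(\<lambda>j. Suc j mod ?m) ` {j. j < ?m \<and> top_orbit (es ! (Suc j mod ?m))} = {j. j < ?m \<and> top_orbit (es ! j)}"
      proof (intro equalityI subsetI)
        fix i assume i: "i \<in> {j. j < ?m \<and> top_orbit (es ! j)}"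
        then have "i \<in> (\<lambda>j. Suc j mod ?m) ` {..<?m}" using bij_betw_imp_surj_on[OF bij] by simp
        then show "i \<in> (\<lambda>j. Suc j mod ?m) ` {j. j < ?m \<and> top_orbit (es ! (Suc j mod ?m))}" using i by auto
      qed (use ne in auto)
    qed
  qed
  finally show ?thesis by simp
qed

section \<open>Closed paths through top states\<close>

lemma sorted_top_state: "sorted_gaps (top_state a c v)"
  by (simp add: sorted_gaps_def top_state_def)

lemma top_orbit_iff: "top_orbit (e :: 'k::field edge set) \<longleftrightarrow> (\<exists>a c. c \<ge> 1 \<and> e = orbit_of (top_state a c 0))"
proof
  assume "top_orbit e"
  then obtain x y v where s: "x \<le> y" "y < v" "e = orbit_of (x, y, v)"
    by (auto simp: top_orbit_def sorted_gaps_def top_gaps_def)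
  have "shift_gaps (- v) (x, y, v) = top_state (nat (y - x)) (nat (v - y)) 0"
    using s by (simp add: top_state_def)
  then have "e = orbit_of (top_state (nat (y - x)) (nat (v - y)) 0)"
    using orbit_of_shift[of "- v" "(x, y, v)", where 'k = 'k] s(3) by simp
  moreover have "nat (v - y) \<ge> 1" using s by simp
  ultimately show "\<exists>a c. c \<ge> 1 \<and> e = orbit_of (top_state a c 0)" by blast
next
  assume "\<exists>a c. c \<ge> 1 \<and> e = orbit_of (top_state a c 0)"
  then obtain a c where "c \<ge> 1" "e = orbit_of (top_state a c 0)" by blast
  then show "top_orbit e"
    unfolding top_orbit_def using sorted_top_state[of a c 0]
    by (intro exI[of _ "top_state a c 0"]) (simp add: top_gaps_def top_state_def)
qed

lemma inj_orbit_of_top_state: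
  assumes "orbit_of (top_state a c 0) = (orbit_of (top_state a' c' 0) :: 'k::field edge set)"
  shows "a = a' \<and> c = c'"
proof -
  obtain k where "top_state a' c' 0 = shift_gaps k (top_state a c 0)"
    using edge_orbit_edge_of_eq[OF sorted_top_state sorted_top_state assms] by blast
  then show ?thesis by (simp add: top_state_def)
qed

text \<open>The difference \<open>int r - int r\<close> is kept so that the source has the form
  \<open>v - int n\<close> of the trace formula.\<close>

lemma card_closing_words_top:
  "int (card (closing_words (top_state a c 0) (3 * r) :: 'k::{field,finite} word set)) =
    green (int CARD('k)) (top_state a c (int r)) (top_state a c (int r - int r))"
proof -
  have "shift_gaps (int r) (top_state a c 0) = top_state a c (int r)" by (simp add: top_state_def)
  then show ?thesis using card_closing_words[OF sorted_top_state, of a c 0 r, where 'k = 'k] by simp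
qed

text \<open>The range of \<open>(c, a)\<close> given by \<open>green_diagonal_support\<close>; no
  closed path of length \<open>3 * r\<close> starts at a top state outside it.\<close>

definition top_index :: "nat \<Rightarrow> (nat \<times> nat) set" where
  "top_index r = {1..r} \<times> {..2 * r}"

abbreviation closed_paths :: "nat \<Rightarrow> 'k::{field,finite} edge set list set" where
  "closed_paths m \<equiv> {es. closed_path PGL3_poly es \<and> length es = m}"

abbreviation top_paths :: "nat \<Rightarrow> 'k::{field,finite} edge set list set" where
  "top_paths r \<equiv> {es. closed_path PGL3_poly es \<and> length es = 3 * r \<and> top_orbit (es ! 0)}"

lemma top_closed_paths:
  assumes "r \<ge> 1"
  shows "top_paths r =
    (\<Union>(c, a)\<in>top_index r. closed_paths_at (orbit_of (top_state a c 0)) (3 * r) :: 'k::{field,finite} edge set list set)"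
proof (intro equalityI subsetI)
  fix es :: "'k edge set list"
  assume es: "es \<in> top_paths r"
  then have hd: "es ! 0 = hd es" by (simp add: closed_path_def hd_conv_nth)
  have "top_orbit (hd es)" using es hd by simp
  then obtain a c where ac: "c \<ge> 1" "hd es = orbit_of (top_state a c 0)" unfolding top_orbit_iff by blast
  have mem: "es \<in> closed_paths_at (orbit_of (top_state a c 0)) (3 * r)" using es ac by (simp add: closed_paths_at_def)
  then have "closing_words (top_state a c 0) (3 * r) \<noteq> ({} :: 'k word set)"
    using closed_paths_at_orbit[OF sorted_top_state, of "3 * r" a c 0, where 'k = 'k] assms by auto
  then have nz: "green (int CARD('k)) (top_state a c (int r)) (top_state a c (int r - int r)) \<noteq> 0"
    unfolding card_closing_words_top[symmetric] using finite_closing_words by (simp add: card_eq_0_iff)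
  have "c \<le> r" "a \<le> 2 * r" by (rule green_diagonal_support[OF ac(1) assms nz])+
  then show "es \<in> (\<Union>(c, a)\<in>top_index r. closed_paths_at (orbit_of (top_state a c 0)) (3 * r))"
    using mem ac(1) by (auto simp: top_index_def)
next
  fix es :: "'k edge set list"
  assume "es \<in> (\<Union>(c, a)\<in>top_index r. closed_paths_at (orbit_of (top_state a c 0)) (3 * r))"
  then obtain a c where ac: "c \<ge> 1" "es \<in> closed_paths_at (orbit_of (top_state a c 0)) (3 * r)"
    by (auto simp: top_index_def)
  then have "es ! 0 = orbit_of (top_state a c 0)" using assms by (auto simp: closed_paths_at_def closed_path_def hd_conv_nth)
  then show "es \<in> top_paths r"
    using ac top_orbit_iff[of "es ! 0"] by (auto simp: closed_paths_at_def)
qed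

lemma finite_top_closed_paths:
  assumes "r \<ge> 1"
  shows "finite (top_paths r :: 'k::{field,finite} edge set list set)"
  unfolding top_closed_paths[OF assms]
  by (rule finite_UN_I) (use assms in \<open>auto simp: top_index_def intro!: finite_closed_paths_at sorted_top_state\<close>)

lemma sum_top_closed_paths:
  assumes r: "r \<ge> 1"
  shows "int (\<Sum>es\<in>top_paths r. path_weight (es :: 'k::{field,finite} edge set list)) =
    int CARD('k) ^ (6 * r) - 2 * int CARD('k) ^ (4 * r) + int CARD('k) ^ (3 * r)"
proof -
  have "(\<Sum>es\<in>top_paths r. path_weight (es :: 'k edge set list)) =
    (\<Sum>p\<in>top_index r. \<Sum>es\<in>(case p of (c, a) \<Rightarrow> closed_paths_at (orbit_of (top_state a c 0)) (3 * r)). path_weight (es :: 'k edge set list))"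
    unfolding top_closed_paths[OF r]
  proof (rule sum.UNION_disjoint)
    show "finite (top_index r)" by (simp add: top_index_def)
    show "\<forall>p\<in>top_index r. finite (case p of (c, a) \<Rightarrow> (closed_paths_at (orbit_of (top_state a c 0)) (3 * r) :: 'k edge set list set))"
      using r by (auto intro!: finite_closed_paths_at sorted_top_state)
    show "\<forall>p\<in>top_index r. \<forall>p'\<in>top_index r. p \<noteq> p' \<longrightarrow>
        (case p of (c, a) \<Rightarrow> closed_paths_at (orbit_of (top_state a c 0)) (3 * r)) \<inter>
        (case p' of (c, a) \<Rightarrow> closed_paths_at (orbit_of (top_state a c 0)) (3 * r)) = ({} :: 'k edge set list set)"
      by (auto simp: closed_paths_at_def dest!: inj_orbit_of_top_state)
  qed
  also have "\<dots> = (\<Sum>(c, a)\<in>top_index r. card (closing_words (top_state a c 0) (3 * r) :: 'k word set))"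
    using r by (intro sum.cong refl) (auto simp: sum_closed_paths_at[OF sorted_top_state])
  finally have "int (\<Sum>es\<in>top_paths r. path_weight (es :: 'k edge set list)) =
     (\<Sum>(c, a)\<in>top_index r. int (card (closing_words (top_state a c 0) (3 * r) :: 'k word set)))"
    by (simp add: split_def)
  also have "\<dots> = (\<Sum>c=1..r. \<Sum>a\<le>2*r. green (int CARD('k)) (top_state a c (int r)) (top_state a c (int r - int r)))"
    unfolding card_closing_words_top top_index_def by (rule sum.cartesian_product[symmetric])
  also have "\<dots> = int CARD('k) ^ (6 * r) - 2 * int CARD('k) ^ (4 * r) + int CARD('k) ^ (3 * r)"
    by (rule green_trace[OF r])
  finally show ?thesis .
qed

text \<open>Every closed path passes through a top state, so it is a rotation of one of the finitely
  many that start at such a state.\<close>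

lemma finite_closed_paths:
  assumes "r \<ge> 1"
  shows "finite (closed_paths (3 * r) :: 'k::{field,finite} edge set list set)"
proof -
  let ?T = "(top_paths r :: 'k edge set list set)"
  have "es \<in> (\<Union>i\<le>3 * r. rotate i ` ?T)" if es: "closed_path PGL3_poly es" "length es = 3 * r" for es
  proof -
    have "card {j. j < length es \<and> top_orbit (es ! j)} \<noteq> 0" using card_top_positions[OF es(1)] es(2) assms by simp
    then obtain j where j: "j < length es" "top_orbit (es ! j)" by (auto simp: card_eq_0_iff)
    have "rotate j es \<in> ?T" using es j by (simp add: closed_path_rotate nth_rotate)
    moreover have "es = rotate (3 * r - j) (rotate j es)" using j es(2) by (simp add: rotate_rotate)
    ultimately show ?thesis by (intro UN_I[of "3 * r - j"] image_eqI) auto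
  qed
  then have "(closed_paths (3 * r) :: 'k edge set list set) \<subseteq> (\<Union>i\<le>3 * r. rotate i ` ?T)" by blast
  moreover have "finite (\<Union>i\<le>3 * r. rotate i ` ?T)" using finite_top_closed_paths[OF assms, where 'k = 'k] by simp
  ultimately show ?thesis by (rule finite_subset)
qed

text \<open>Double counting of pairs of a closed path and one of its top positions: each path has
  \<open>r\<close> of them, and rotation shows that each of the \<open>3 * r\<close> positions
  contributes the same sum.\<close>

lemma sum_closed_paths:
  assumes r: "r \<ge> 1"
  shows "(\<Sum>es\<in>closed_paths (3 * r). path_weight (es :: 'k::{field,finite} edge set list)) =
    3 * (\<Sum>es\<in>top_paths r. path_weight (es :: 'k edge set list))"
proof -
  let ?P = "(closed_paths (3 * r) :: 'k edge set list set)"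
  let ?T = "(top_paths r :: 'k edge set list set)"
  have fin: "finite ?P" by (rule finite_closed_paths[OF r])
  have shift: "(\<Sum>es\<in>?P. if top_orbit (es ! j) then path_weight es else 0) = (\<Sum>es\<in>?T. path_weight es)" if j: "j < 3 * r" for j
  proof -
    have "(\<Sum>es\<in>?P. if top_orbit (es ! j) then path_weight es else 0) =
        (\<Sum>es\<in>?P. if top_orbit (rotate j es ! 0) then path_weight (rotate j es) else 0)"
      using j by (intro sum.cong refl) (auto simp: nth_rotate path_weight_rotate)
    also have "\<dots> = (\<Sum>es\<in>?P. if top_orbit (es ! 0) then path_weight es else 0)"
    proof (rule sum.reindex_bij_betw)
      have "inj_on (rotate j) ?P" by (rule inj_on_subset[OF inj_rotate]) simp
      moreover have "rotate j ` ?P \<subseteq> ?P" by (auto simp: closed_path_rotate)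
      ultimately show "bij_betw (rotate j) ?P ?P" using fin by (simp add: bij_betw_def endo_inj_surj)
    qed
    also have "\<dots> = (\<Sum>es\<in>?T. path_weight es)"
    proof -
      have "{es \<in> ?P. top_orbit (es ! 0)} = ?T" by auto
      then show ?thesis using sum.inter_filter[OF fin, of path_weight "\<lambda>es. top_orbit (es ! 0)"] by (simp only:)
    qed
    finally show ?thesis .
  qed
  have "r * (\<Sum>es\<in>?P. path_weight es) = (\<Sum>es\<in>?P. \<Sum>j<3 * r. if top_orbit (es ! j) then path_weight es else 0)"
    unfolding sum_distrib_left
  proof (rule sum.cong[OF refl])
    fix es assume es: "es \<in> ?P"
    then have "card {j. j < 3 * r \<and> top_orbit (es ! j)} = r" using card_top_positions[of es] by simp
    moreover have "{j. j < 3 * r \<and> top_orbit (es ! j)} = {..<3 * r} \<inter> {j. top_orbit (es ! j)}" by auto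
    ultimately show "r * path_weight es = (\<Sum>j<3 * r. if top_orbit (es ! j) then path_weight es else 0)"
      by (simp add: sum.If_cases)
  qed
  also have "\<dots> = (\<Sum>j<3 * r. \<Sum>es\<in>?P. if top_orbit (es ! j) then path_weight es else 0)" by (rule sum.swap)
  also have "\<dots> = (\<Sum>j<3 * r. \<Sum>es\<in>?T. path_weight es)" by (rule sum.cong[OF refl shift]) simp
  also have "\<dots> = r * (3 * (\<Sum>es\<in>?T. path_weight es))" by simp
  finally show ?thesis using r by simp
qed

theorem corollary1p2:
  fixes m :: nat
  assumes "m \<ge> 1"
  shows "(\<forall>r\<ge>1. m = 3 * r \<longrightarrow>
      int (cycle_count (PGL3_poly :: 'k::{field,finite} mat3 set monoid) m) =
        3 * int CARD('k) ^ (6 * r) - 6 * int CARD('k) ^ (4 * r) + 3 * int CARD('k) ^ (3 * r)) \<and>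
    ((\<nexists>r. r \<ge> 1 \<and> m = 3 * r) \<longrightarrow>
      cycle_count (PGL3_poly :: 'k mat3 set monoid) m = 0)"
proof (intro conjI allI impI)
  fix r :: nat assume r: "r \<ge> 1" and m: "m = 3 * r"
  have "cycle_count (PGL3_poly :: 'k mat3 set monoid) m =
      3 * (\<Sum>es\<in>top_paths r. path_weight (es :: 'k edge set list))"
    unfolding m by (simp only: cycle_count_eq_sum_paths[OF finite_closed_paths[OF r]] sum_closed_paths[OF r])
  then show "int (cycle_count (PGL3_poly :: 'k mat3 set monoid) m) =
        3 * int CARD('k) ^ (6 * r) - 6 * int CARD('k) ^ (4 * r) + 3 * int CARD('k) ^ (3 * r)"
    using sum_top_closed_paths[OF r, where 'k = 'k] by simp
next
  assume no: "\<nexists>r. r \<ge> 1 \<and> m = 3 * r"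
  have "{es :: 'k edge set list. closed_path PGL3_poly es \<and> length es = m} = {}"
  proof (rule ccontr)
    assume "\<not> ?thesis"
    then obtain es :: "'k edge set list" where "closed_path PGL3_poly es" "length es = m" by blast
    then have m: "m = 3 * card {j. j < m \<and> top_orbit (es ! j)}" using card_top_positions[of es] by simp
    then have "card {j. j < m \<and> top_orbit (es ! j)} \<ge> 1" using assms by linarith
    then show False using no m by blast
  qed
  note empty = this
  show "cycle_count (PGL3_poly :: 'k mat3 set monoid) m = 0"
    using cycle_count_eq_sum_paths[of "PGL3_poly :: 'k mat3 set monoid" m] unfolding empty by simp
qed

end
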